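(* Let $\Bbbk$ be a field, $R=\Bbbk[x_1,\ldots,x_n]$ with the standard grading, $\mathfrak m=(x_1,\ldots,x_n)$, and let $A=R/I$ ($I\subsetneq R$ a homogeneous ideal) be a standard $\mathbb N$-graded sequentially Cohen–Macaulay algebra of Krull dimension $d$. Then $$(t-1)^i\,\mathrm{Hilb}\bigl(H^i_{\mathfrak m}(A);t\bigr)=\mathrm h\bigl(U_i(A);t\bigr)\qquad\text{for } 1\le i\le d.$$
   Context: $H^i_{\mathfrak m}(A)$ is the $i$-th local cohomology module of $A$ supported on $\mathfrak m$, a $\mathbb Z$-graded $R$-module with finite-dimensional graded pieces vanishing in all large degrees, and $\mathrm{Hilb}(M;t)=\sum_{j\in\mathbb Z}\dim_\Bbbk(M_j)t^j$; the identity is in the ring $\mathbb Z((t^{-1}))$ of formal Laurent series in $t^{-1}$. Let $I=\bigcap_j\mathfrak q_j$ be a reduced primary decomposition and $\mathfrak p_j=\sqrt{\mathfrak q_j}$. Put $I^{\langle i\rangle}=\bigcap_{\dim(R/\mathfrak p_j)>i}\mathfrak q_j$ for $-1\le i\le d$ (empty intersection $=R$; so $I^{\langle -1\rangle}=I$ and $I^{\langle d\rangle}=R$); these ideals do not depend on the decomposition. The $i$-th unmixed layer of $A$ is $U_i(A)=I^{\langle i\rangle}/I^{\langle i-1\rangle}$, $0\le i\le d$; it is zero or of Krull dimension $i$. $A$ is sequentially Cohen–Macaulay if for all $0\le i\le d$ the module $U_i(A)$ is either zero or Cohen–Macaulay of dimension $i$. The polynomial $\mathrm h(U_i(A);t)\in\mathbb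 Z[t]$ is defined by $\mathrm{Hilb}(U_i(A);t)=\mathrm h(U_i(A);t)/(1-t)^i$ (it is $0$ if $U_i(A)=0$). *)

theory Defs
  imports
    "HOL-Algebra.Algebraic_Closure_Type"
    "HOL-Algebra.QuotRing"
    "HOL-Library.Poly_Mapping"
    "HOL-Library.Extended_Real"
    "HOL-Computational_Algebra.Formal_Laurent_Series"
begin

section \<open>Commutative algebra\<close>

text \<open>The supremum is taken in \<^typ>\<open>ereal\<close>, so the zero ring has dimension \<open>-\<infinity>\<close>.\<close>

definition krull_dim :: "('a, 'b) ring_scheme \<Rightarrow> ereal" where
  "krull_dim R =
     (SUP k \<in> {k. \<exists>P :: nat \<Rightarrow> 'a set.
                    (\<forall>j\<le>k. primeideal (P j) R) \<and> (\<forall>j<k. P j \<subset> P (Suc j))}. ereal (real k))"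

definition radical :: "('a, 'b) ring_scheme \<Rightarrow> 'a set \<Rightarrow> 'a set" where
  "radical R J = {f \<in> carrier R. \<exists>k::nat. f [^]\<^bsub>R\<^esub> k \<in> J}"

definition primary_ideal :: "('a, 'b) ring_scheme \<Rightarrow> 'a set \<Rightarrow> bool" where
  "primary_ideal R J \<longleftrightarrow>
     ideal J R \<and> J \<noteq> carrier R \<and>
     (\<forall>f\<in>carrier R. \<forall>g\<in>carrier R. f \<otimes>\<^bsub>R\<^esub> g \<in> J \<longrightarrow> f \<in> J \<or> g \<in> radical R J)"

text \<open>Reduced: the radicals are pairwise distinct and no component is redundant. Intersections are
  relativised to the carrier, so that the empty one is the whole ring.\<close>

definition reduced_primary_decomposition ::
  "('a, 'b) ring_scheme \<Rightarrow> 'a set \<Rightarrow> 'a set set \<Rightarrow> bool" where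
  "reduced_primary_decomposition R J Q \<longleftrightarrow>
     finite Q \<and> (\<forall>q\<in>Q. primary_ideal R q) \<and> J = carrier R \<inter> \<Inter>Q \<and>
     inj_on (radical R) Q \<and> (\<forall>q\<in>Q. \<not> carrier R \<inter> \<Inter>(Q - {q}) \<subseteq> q)"

definition annihilator :: "('a, 'b) ring_scheme \<Rightarrow> ('a, 'm, 'c) module_scheme \<Rightarrow> 'a set" where
  "annihilator R M = {r \<in> carrier R. \<forall>x\<in>carrier M. r \<odot>\<^bsub>M\<^esub> x = \<zero>\<^bsub>M\<^esub>}"

definition module_dim :: "('a, 'b) ring_scheme \<Rightarrow> ('a, 'm, 'c) module_scheme \<Rightarrow> ereal" where
  "module_dim R M = krull_dim (R Quot annihilator R M)"

text \<open>The submodule \<open>(f\<^sub>1, \<dots>, f\<^sub>r)M\<close>.\<close>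

definition seq_multiples :: "('a, 'm, 'c) module_scheme \<Rightarrow> 'a list \<Rightarrow> 'm set" where
  "seq_multiples M fs =
     {(\<Oplus>\<^bsub>M\<^esub>j\<in>{..<length fs}. (fs ! j) \<odot>\<^bsub>M\<^esub> y j) | y. y \<in> {..<length fs} \<rightarrow> carrier M}"

definition regular_sequence :: "('a, 'm, 'c) module_scheme \<Rightarrow> 'a list \<Rightarrow> bool" where
  "regular_sequence M fs \<longleftrightarrow>
     (\<forall>j<length fs. \<forall>x\<in>carrier M.
        (fs ! j) \<odot>\<^bsub>M\<^esub> x \<in> seq_multiples M (take j fs) \<longrightarrow> x \<in> seq_multiples M (take j fs)) \<and>
     seq_multiples M fs \<noteq> carrier M"

definition depth :: "'a set \<Rightarrow> ('a, 'm, 'c) module_scheme \<Rightarrow> ereal" where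
  "depth J M = (SUP fs \<in> {fs. set fs \<subseteq> J \<and> regular_sequence M fs}. ereal (real (length fs)))"


section \<open>The polynomial ring and its graded modules\<close>

text \<open>A finite linearly ordered type \<open>'n\<close> indexes the variables \<open>x\<^sub>1, \<dots>, x\<^sub>n\<close>; the order only enters
  in the signs of the Cech differential.\<close>

type_synonym ('n, 'k) mpoly = "('n \<Rightarrow>\<^sub>0 nat) \<Rightarrow>\<^sub>0 'k"

abbreviation mpoly_ring :: "('n::{finite,linorder}, 'k::field) mpoly ring" where
  "mpoly_ring \<equiv> ring_of_type_algebra"

definition const :: "'k::field \<Rightarrow> ('n::{finite,linorder}, 'k) mpoly" where
  "const c = Poly_Mapping.single 0 c"

definition mon :: "('n::{finite,linorder} \<Rightarrow>\<^sub>0 nat) \<Rightarrow> ('n, 'k::field) mpoly" where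
  "mon a = Poly_Mapping.single a 1"

definition var :: "'n::{finite,linorder} \<Rightarrow> ('n, 'k::field) mpoly" where
  "var v = mon (Poly_Mapping.single v 1)"

definition mdeg :: "('n::{finite,linorder} \<Rightarrow>\<^sub>0 nat) \<Rightarrow> nat" where
  "mdeg a = (\<Sum>v\<in>UNIV. Poly_Mapping.lookup a v)"

definition homogeneous_part :: "int \<Rightarrow> ('n::{finite,linorder}, 'k::field) mpoly set" where
  "homogeneous_part j = {f. \<forall>a\<in>Poly_Mapping.keys f. int (mdeg a) = j}"

definition homogeneous_ideal :: "('n::{finite,linorder}, 'k::field) mpoly set \<Rightarrow> bool" where
  "homogeneous_ideal J \<longleftrightarrow>
     (\<exists>F. F \<subseteq> (\<Union>j. homogeneous_part j) \<and> J = Idl\<^bsub>mpoly_ring\<^esub> F)"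

definition irrelevant_ideal :: "('n::{finite,linorder}, 'k::field) mpoly set" where
  "irrelevant_ideal = Idl\<^bsub>mpoly_ring\<^esub> (range var)"

text \<open>In all modules below the fields \<^const>\<open>monoid.mult\<close> and \<^const>\<open>one\<close>, which \<^locale>\<open>module\<close> ignores, are left
  unspecified.\<close>

record ('a, 'm) graded_module = "('a, 'm) module" +
  piece :: "int \<Rightarrow> 'm set"

type_synonym ('n, 'k, 'm) gmod = "(('n, 'k) mpoly, 'm) graded_module"

definition regular_module ::
  "('n::{finite,linorder}, 'k::field, ('n, 'k) mpoly) gmod" where
  "regular_module =
     \<lparr>carrier = UNIV, monoid.mult = undefined, one = undefined, zero = 0, add = (+),
      module.smult = (*), piece = homogeneous_part\<rparr>"

definition graded_sub :: "('a, 'm) graded_module \<Rightarrow> 'm set \<Rightarrow> ('a, 'm) graded_module" where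
  "graded_sub M N = M\<lparr>carrier := N, piece := (\<lambda>j. N \<inter> piece M j)\<rparr>"

definition graded_quot :: "('a, 'm) graded_module \<Rightarrow> 'm set \<Rightarrow> ('a, 'm set) graded_module" where
  "graded_quot M N =
     \<lparr>carrier = a_rcosets\<^bsub>M\<^esub> N, monoid.mult = undefined, one = undefined, zero = N, add = set_add M,
      module.smult = (\<lambda>r C. \<Union>x\<in>C. N +>\<^bsub>M\<^esub> (r \<odot>\<^bsub>M\<^esub> x)),
      piece = (\<lambda>j. (\<lambda>x. N +>\<^bsub>M\<^esub> x) ` piece M j)\<rparr>"


section \<open>Hilbert series\<close>

definition k_basis ::
  "('n::{finite,linorder}, 'k::field, 'm) gmod \<Rightarrow> 'm set \<Rightarrow> 'm set \<Rightarrow> bool" where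
  "k_basis M V B \<longleftrightarrow>
     finite B \<and> B \<subseteq> V \<and>
     (\<forall>c. (\<Oplus>\<^bsub>M\<^esub>b\<in>B. const (c b) \<odot>\<^bsub>M\<^esub> b) = \<zero>\<^bsub>M\<^esub> \<longrightarrow> (\<forall>b\<in>B. c b = 0)) \<and>
     (\<forall>x\<in>V. \<exists>c. x = (\<Oplus>\<^bsub>M\<^esub>b\<in>B. const (c b) \<odot>\<^bsub>M\<^esub> b))"

text \<open>Meaningful for a finite-dimensional \<open>k\<close>-subspace \<open>V\<close> of \<open>M\<close>.\<close>

definition k_dim :: "('n::{finite,linorder}, 'k::field, 'm) gmod \<Rightarrow> 'm set \<Rightarrow> nat" where
  "k_dim M V = card (SOME B. k_basis M V B)"

text \<open>Hilbert series in \<open>\<int>[[t]]\<close>, for modules without elements of negative degree.\<close>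

definition hilb_fps :: "('n::{finite,linorder}, 'k::field, 'm) gmod \<Rightarrow> int fps" where
  "hilb_fps M = Abs_fps (\<lambda>j. int (k_dim M (piece M (int j))))"

text \<open>Hilbert series in \<open>\<int>((t\<^sup>-\<^sup>1))\<close>, for modules vanishing in large degrees: the variable
  \<^const>\<open>fls_X\<close> stands for \<open>t\<^sup>-\<^sup>1\<close>, so \<open>t\<close> is \<^const>\<open>fls_X_inv\<close>.\<close>

definition hilb_inv :: "('n::{finite,linorder}, 'k::field, 'm) gmod \<Rightarrow> int fls" where
  "hilb_inv M = Abs_fls (\<lambda>j. int (k_dim M (piece M (- j))))"

text \<open>The power series \<open>1 - t\<close> is a unit, so this is \<open>Hilb(M;t) = h(t) / (1 - t)\<^sup>i\<close>; there is at most one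
  such \<open>h\<close>.\<close>

definition h_poly :: "('n::{finite,linorder}, 'k::field, 'm) gmod \<Rightarrow> nat \<Rightarrow> int poly" where
  "h_poly M i = (THE h. (1 - fps_X) ^ i * hilb_fps M = fps_of_poly h)"


section \<open>Local cohomology at the irrelevant ideal\<close>

text \<open>The localisation of \<open>M\<close> at the monomials in the variables from \<open>S\<close> (that is, at the product
  of these variables); a pair \<open>(m, a)\<close> represents the fraction \<open>m / x\<^sup>a\<close>.\<close>

definition loc_rel :: "('n::{finite,linorder}, 'k::field, 'm) gmod \<Rightarrow> 'n set \<Rightarrow>
    (('m \<times> ('n \<Rightarrow>\<^sub>0 nat)) \<times> ('m \<times> ('n \<Rightarrow>\<^sub>0 nat))) set" where
  "loc_rel M S =
     {((m, a), (m', a')). m \<in> carrier M \<and> m' \<in> carrier M \<and>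
        Poly_Mapping.keys a \<subseteq> S \<and> Poly_Mapping.keys a' \<subseteq> S \<and>
        (\<exists>b. Poly_Mapping.keys b \<subseteq> S \<and> mon (b + a') \<odot>\<^bsub>M\<^esub> m = mon (b + a) \<odot>\<^bsub>M\<^esub> m')}"

definition loc :: "('n::{finite,linorder}, 'k::field, 'm) gmod \<Rightarrow> 'n set \<Rightarrow>
    ('n, 'k, ('m \<times> ('n \<Rightarrow>\<^sub>0 nat)) set) gmod" where
  "loc M S =
     \<lparr>carrier = (carrier M \<times> {a. Poly_Mapping.keys a \<subseteq> S}) // loc_rel M S,
      monoid.mult = undefined, one = undefined,
      zero = loc_rel M S `` {(\<zero>\<^bsub>M\<^esub>, 0)},
      add = (\<lambda>C D. \<Union>(m, a)\<in>C. \<Union>(m', a')\<in>D.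
               loc_rel M S `` {(mon a' \<odot>\<^bsub>M\<^esub> m \<oplus>\<^bsub>M\<^esub> mon a \<odot>\<^bsub>M\<^esub> m', a + a')}),
      module.smult = (\<lambda>r C. \<Union>(m, a)\<in>C. loc_rel M S `` {(r \<odot>\<^bsub>M\<^esub> m, a)}),
      piece = (\<lambda>j. {loc_rel M S `` {(m, a)} | m a.
                      Poly_Mapping.keys a \<subseteq> S \<and> m \<in> piece M (j + int (mdeg a))})\<rparr>"

text \<open>The Cech complex of \<open>M\<close> on \<open>x\<^sub>1, \<dots>, x\<^sub>n\<close>. For \<open>S \<subseteq> T\<close>, the canonical map between the
  localisations sends a class \<open>C\<close> to \<open>loc_rel M T `` C\<close>.\<close>

definition cech :: "('n::{finite,linorder}, 'k::field, 'm) gmod \<Rightarrow> nat \<Rightarrow>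
    ('n, 'k, 'n set \<Rightarrow> ('m \<times> ('n \<Rightarrow>\<^sub>0 nat)) set) gmod" where
  "cech M p =
     \<lparr>carrier = (\<Pi>\<^sub>E S\<in>{S. card S = p}. carrier (loc M S)),
      monoid.mult = undefined, one = undefined,
      zero = (\<lambda>S\<in>{S. card S = p}. \<zero>\<^bsub>loc M S\<^esub>),
      add = (\<lambda>c c'. \<lambda>S\<in>{S. card S = p}. c S \<oplus>\<^bsub>loc M S\<^esub> c' S),
      module.smult = (\<lambda>r c. \<lambda>S\<in>{S. card S = p}. r \<odot>\<^bsub>loc M S\<^esub> c S),
      piece = (\<lambda>j. \<Pi>\<^sub>E S\<in>{S. card S = p}. piece (loc M S) j)\<rparr>"

definition cech_diff :: "('n::{finite,linorder}, 'k::field, 'm) gmod \<Rightarrow> nat \<Rightarrow>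
    ('n set \<Rightarrow> ('m \<times> ('n \<Rightarrow>\<^sub>0 nat)) set) \<Rightarrow> 'n set \<Rightarrow> ('m \<times> ('n \<Rightarrow>\<^sub>0 nat)) set" where
  "cech_diff M p c =
     (\<lambda>T\<in>{T. card T = Suc p}.
        \<Oplus>\<^bsub>loc M T\<^esub>v\<in>T. ((- 1) ^ card {u \<in> T. u < v}) \<odot>\<^bsub>loc M T\<^esub> (loc_rel M T `` c (T - {v})))"

definition cech_cocycles :: "('n::{finite,linorder}, 'k::field, 'm) gmod \<Rightarrow> nat \<Rightarrow>
    ('n set \<Rightarrow> ('m \<times> ('n \<Rightarrow>\<^sub>0 nat)) set) set" where
  "cech_cocycles M p = {c \<in> carrier (cech M p). cech_diff M p c = \<zero>\<^bsub>cech M (Suc p)\<^esub>}"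

fun cech_coboundaries :: "('n::{finite,linorder}, 'k::field, 'm) gmod \<Rightarrow> nat \<Rightarrow>
    ('n set \<Rightarrow> ('m \<times> ('n \<Rightarrow>\<^sub>0 nat)) set) set" where
  "cech_coboundaries M 0 = {\<zero>\<^bsub>cech M 0\<^esub>}"
| "cech_coboundaries M (Suc p) = cech_diff M p ` carrier (cech M p)"

definition local_cohomology :: "('n::{finite,linorder}, 'k::field, 'm) gmod \<Rightarrow> nat \<Rightarrow>
    ('n, 'k, ('n set \<Rightarrow> ('m \<times> ('n \<Rightarrow>\<^sub>0 nat)) set) set) gmod" where
  "local_cohomology M p = graded_quot (graded_sub (cech M p) (cech_cocycles M p)) (cech_coboundaries M p)"


section \<open>Unmixed layers and sequential Cohen-Macaulayness\<close>

text \<open>For a reduced primary decomposition \<open>Q\<close> of \<open>I\<close>, the ideal \<open>I\<^sup>\<langle>\<^sup>i\<^sup>\<rangle>\<close>, where \<open>i \<ge> -1\<close>.\<close>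

definition dim_filtration_ideal ::
  "('n::{finite,linorder}, 'k::field) mpoly set set \<Rightarrow> int \<Rightarrow> ('n, 'k) mpoly set" where
  "dim_filtration_ideal Q i =
     \<Inter>{q \<in> Q. krull_dim (mpoly_ring Quot radical mpoly_ring q) > ereal (real_of_int i)}"

definition unmixed_layer :: "('n::{finite,linorder}, 'k::field) mpoly set set \<Rightarrow> nat \<Rightarrow>
    ('n, 'k, ('n, 'k) mpoly set) gmod" where
  "unmixed_layer Q i =
     graded_quot (graded_sub regular_module (dim_filtration_ideal Q (int i)))
       (dim_filtration_ideal Q (int i - 1))"

text \<open>For finitely generated graded modules. As usual in the graded setting, the depth is the one
  with respect to the irrelevant ideal.\<close>

definition cohen_macaulay_of_dim ::
  "('n::{finite,linorder}, 'k::field, 'm) gmod \<Rightarrow> nat \<Rightarrow> bool" where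
  "cohen_macaulay_of_dim M i \<longleftrightarrow>
     carrier M \<noteq> {\<zero>\<^bsub>M\<^esub>} \<and> module_dim mpoly_ring M = ereal (real i) \<and>
     depth irrelevant_ideal M = module_dim mpoly_ring M"

text \<open>For the algebra of dimension \<open>d\<close> whose defining ideal has the reduced primary
  decomposition \<open>Q\<close>.\<close>

definition sequentially_cohen_macaulay ::
  "('n::{finite,linorder}, 'k::field) mpoly set set \<Rightarrow> nat \<Rightarrow> bool" where
  "sequentially_cohen_macaulay Q d \<longleftrightarrow>
     (\<forall>i\<le>d. carrier (unmixed_layer Q i) = {\<zero>\<^bsub>unmixed_layer Q i\<^esub>} \<or>
            cohen_macaulay_of_dim (unmixed_layer Q i) i)"

end

theory Submission
  imports Defs "HOL-Library.Function_Algebras"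
begin

text \<open>Everything takes place in the Laurent polynomial ring: the localisation of a subquotient
  \<open>N\<^sub>1/N\<^sub>2\<close> of \<open>R\<close> is a subquotient of it, so that all Cech complexes become pairs of subcomplexes of
  one ambient complex, and long exact sequences become inclusions of subspaces.

  Multiplication by the elements of a regular sequence is injective on cohomology by induction, whereas
  every cohomology class is torsion, and dividing by a regular element lowers the dimension. Hence a
  Cohen-Macaulay module of dimension \<open>i\<close> has cohomology in degree \<open>i\<close> only, also when the
  regular sequence is not homogeneous. The filtration by the ideals \<open>I\<^sup>\<langle>\<^sup>i\<^sup>\<rangle>\<close>, which are homogeneous although
  the primary components need not be, then gives \<open>H\<^sup>i(A) = H\<^sup>i(U\<^sub>i)\<close>.

  It remains to prove the Grothendieck-Serre formula: the Hilbert function of a graded module minus the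
  Euler characteristic of its local cohomology is a polynomial function. Devissage reduces this to
  modules on which a variable is a nonzerodivisor (no linear nonzerodivisor need exist over a finite
  field). The same induction bounds the growth of \<open>H\<^sup>i\<close> towards \<open>-\<infinity>\<close> by \<open>\<bar>j\<bar>\<^sup>i\<^sup>-\<^sup>1\<close>, hence the degree
  of the polynomial for \<open>U\<^sub>i\<close> by \<open>i - 1\<close>, so its \<open>i\<close>-th difference vanishes, which is the claim.\<close>

section \<open>Relative dimension\<close>

text \<open>For \<open>H\<close> the Hilbert function of U_i and \<open>h\<close> the dimension
  function of its top cohomology, the claim is that the i-th backward differences agree up to the
  sign \<open>(- 1) ^ i\<close>, which turns 1 - t into t - 1. Since \<open>H\<close> vanishes in
  negative degrees, \<open>H\<close> minus \<open>(- 1) ^ i * h\<close> is there \<open>h\<close> up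
  to sign; this is why the growth of \<open>h\<close> alone controls the degree.

  Two obstacles shape the proof. \<open>k_dim\<close> is the size of a chosen basis and is
  meaningful only in finite dimension, which for the pieces of local cohomology is itself to be
  proved. So each dimension is accompanied by a finiteness predicate, and the devissage carries
  both. Further, depth admits arbitrary sequences in the irrelevant ideal, and multiplication by
  their elements does not respect degrees. Vanishing is therefore shown for the ungraded complexes,
  where torsion and dimension arguments rest on primes obtained from Zorn's lemma, and is cut down
  to each degree afterwards. Noetherianity enters for graded ideals only, by way of leading
  monomials.\<close>

definition rel_basis :: "('f::field \<Rightarrow> 'b::ab_group_add \<Rightarrow> 'b) \<Rightarrow> 'b set \<Rightarrow> 'b set \<Rightarrow> 'b set \<Rightarrow> bool" where
  "rel_basis s Z B W \<longleftrightarrow> finite W \<and> W \<subseteq> Z \<and>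
     (\<forall>c. (\<Sum>x\<in>W. s (c x) x) \<in> B \<longrightarrow> (\<forall>x\<in>W. c x = 0)) \<and>
     (\<forall>z\<in>Z. \<exists>c. z - (\<Sum>x\<in>W. s (c x) x) \<in> B)"

definition qfin :: "('f::field \<Rightarrow> 'b::ab_group_add \<Rightarrow> 'b) \<Rightarrow> 'b set \<Rightarrow> 'b set \<Rightarrow> bool" where
  "qfin s Z B \<longleftrightarrow> (\<exists>W. rel_basis s Z B W)"

text \<open>The dimension of \<open>Z\<close> modulo \<open>B\<close>. As with \<open>k_dim\<close>,
  the value is arbitrary if no finite relative basis exists, so \<open>qfin\<close> has to travel
  along.\<close>

definition qd :: "('f::field \<Rightarrow> 'b::ab_group_add \<Rightarrow> 'b) \<Rightarrow> 'b set \<Rightarrow> 'b set \<Rightarrow> nat" where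
  "qd s Z B = card (SOME W. rel_basis s Z B W)"

context vector_space
begin

text \<open>A basis of \<open>B\<close> is extended to one of the whole space; \<open>f\<close>
  kills the former and fixes the added vectors. It models the projection modulo \<open>B\<close>
  inside the same space, so the ordinary dimension theory applies to images under
  \<open>f\<close>.\<close>

lemma ex_linear_kernel:
  assumes "subspace B"
  shows "\<exists>f. Vector_Spaces.linear scale scale f \<and> (\<forall>x. f x = 0 \<longleftrightarrow> x \<in> B)"
proof -
  interpret vp: vector_space_pair scale scale ..
  obtain B0 where B0: "B0 \<subseteq> B" "independent B0" "B \<subseteq> span B0"
    using basis_exists[of B] by metis
  have sB: "span B0 = B" using B0 span_minimal[OF B0(1) assms] by (rule_tac subset_antisym) auto
  define E where "E = extend_basis B0"
  have E: "B0 \<subseteq> E" "independent E" "span E = UNIV"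
    using B0 by (auto simp: E_def extend_basis_superset independent_extend_basis)
  obtain f where f: "Vector_Spaces.linear scale scale f" "\<And>x. x \<in> E \<Longrightarrow> f x = (if x \<in> B0 then 0 else x)"
    using vp.linear_independent_extend[OF E(2), of "\<lambda>x. if x \<in> B0 then 0 else x"] by auto
  interpret f: Vector_Spaces.linear scale scale f by (rule f(1))
  have "f b = 0" if "b \<in> B0" for b using f(2)[of b] that E by auto
  then have f0: "f x = 0" if "x \<in> B" for x
    using vp.linear_eq_on[of f "\<lambda>_. 0" x B0] f(1) that sB vp.linear_zero by auto
  have fid: "f y = y" if "y \<in> span (E - B0)" for y
    using vp.linear_eq_on[of f "\<lambda>x. x" y "E - B0"] f that linear_ident by auto
  have "x \<in> B" if "f x = 0" for x
  proof -
    have "x \<in> span (B0 \<union> (E - B0))" using E by (simp add: Un_absorb1)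
    then obtain b y where by_: "x = b + y" "b \<in> span B0" "y \<in> span (E - B0)"
      unfolding span_Un by blast
    have "f x = y" using by_ f0 fid sB by (simp add: f.add)
    then show ?thesis using that by_ sB by simp
  qed
  then show ?thesis using f f0 by blast
qed

lemma rel_basis_inj:
  assumes W: "rel_basis scale Z B W" and xy: "x \<in> W" "y \<in> W" "x - y \<in> B"
  shows "x = y"
proof (rule ccontr)
  assume ne: "x \<noteq> y"
  have W': "finite W" "\<And>c x. (\<Sum>x\<in>W. scale (c x) x) \<in> B \<Longrightarrow> x \<in> W \<Longrightarrow> c x = 0"
    using W by (auto simp: rel_basis_def)
  let ?c = "\<lambda>z. (if z = x then 1 else if z = y then - 1 else 0)"
  have "(\<Sum>z\<in>W. scale (?c z) z) = (\<Sum>z\<in>W. (if z = x then x else 0) - (if z = y then y else 0))"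
    using ne by (intro sum.cong) auto
  also have "\<dots> = x - y" using xy W' by (simp add: sum_subtractf)
  finally have "(\<Sum>z\<in>W. scale (?c z) z) \<in> B" using xy by simp
  from W'(2)[OF this xy(1)] show False by simp
qed

lemma rel_basis_image:
  assumes "Vector_Spaces.linear scale scale f" and ker: "\<And>x. f x = 0 \<longleftrightarrow> x \<in> B"
    and "subspace Z" and W: "rel_basis scale Z B W"
  shows "inj_on f W \<and> independent (f ` W) \<and> span (f ` W) = f ` Z"
proof -
  interpret f: Vector_Spaces.linear scale scale f by fact
  have W': "finite W" "W \<subseteq> Z" "\<And>c x. (\<Sum>x\<in>W. scale (c x) x) \<in> B \<Longrightarrow> x \<in> W \<Longrightarrow> c x = 0"
     "\<And>z. z \<in> Z \<Longrightarrow> \<exists>c. z - (\<Sum>x\<in>W. scale (c x) x) \<in> B"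
    using W by (auto simp: rel_basis_def)
  have fsum: "f (\<Sum>x\<in>W. scale (c x) x) = (\<Sum>x\<in>W. scale (c x) (f x))" for c
    by (simp add: f.sum f.scale)
  have inj: "inj_on f W"
  proof (rule inj_onI)
    fix x y assume xy: "x \<in> W" "y \<in> W" "f x = f y"
    then have "x - y \<in> B" using ker[of "x - y"] by (simp add: f.diff)
    then show "x = y" using rel_basis_inj[OF W xy(1,2)] by simp
  qed
  have indep: "independent (f ` W)"
  proof (rule independent_if_scalars_zero)
    show "finite (f ` W)" using W' by simp
    fix g y assume *: "(\<Sum>x\<in>f ` W. scale (g x) x) = 0" and y: "y \<in> f ` W"
    have "f (\<Sum>x\<in>W. scale (g (f x)) x) = 0"
      using * inj by (simp add: fsum sum.reindex)
    then show "g y = 0" using W'(3)[of "\<lambda>x. g (f x)"] y ker by auto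
  qed
  have sub: "subspace (f ` Z)" using assms f.subspace_image by blast
  have "span (f ` W) \<subseteq> f ` Z" using W'(2) sub by (intro span_minimal) auto
  moreover have "f ` Z \<subseteq> span (f ` W)"
  proof
    fix y assume "y \<in> f ` Z"
    then obtain z c where z: "y = f z" "z - (\<Sum>x\<in>W. scale (c x) x) \<in> B" using W'(4) by blast
    then have "y = (\<Sum>x\<in>W. scale (c x) (f x))" using ker by (metis eq_iff_diff_eq_0 f.diff fsum)
    then show "y \<in> span (f ` W)"
      by (simp, intro span_sum span_scale span_base imageI)
  qed
  ultimately show ?thesis using inj indep by blast
qed

text \<open>A projection \<open>f\<close> with kernel \<open>B\<close> maps every relative basis
  bijectively onto a basis of the image of \<open>Z\<close>, whose cardinality is the dimension of
  that image.\<close>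

lemma rel_basis_card_unique:
  assumes "subspace Z" "subspace B" "rel_basis scale Z B W" "rel_basis scale Z B Y"
  shows "card W = card Y"
proof -
  obtain f where f: "Vector_Spaces.linear scale scale f" "\<And>x. f x = 0 \<longleftrightarrow> x \<in> B"
    using ex_linear_kernel[OF assms(2)] by blast
  note W = rel_basis_image[OF f assms(1,3)] and Y = rel_basis_image[OF f assms(1,4)]
  have "card W = card (f ` W)" "card Y = card (f ` Y)" using W Y by (auto simp: card_image)
  moreover have "dim (f ` Z) = card (f ` W)" "dim (f ` Z) = card (f ` Y)"
    using W Y by (metis dim_eq_card_independent dim_span)+
  ultimately show ?thesis by simp
qed

lemma qd_eq_card:
  assumes "subspace Z" "subspace B" "rel_basis scale Z B W"
  shows "qd scale Z B = card W"
  unfolding qd_def using assms rel_basis_card_unique by (metis someI)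

text \<open>In the model of the quotient, the image of \<open>Z\<close> lies in the span of the
  image of \<open>F\<close>, so a basis of it is finite; choosing preimages in \<open>Z\<close>
  gives a relative basis.\<close>

lemma qfinI:
  assumes Z: "subspace Z" and B: "subspace B" and F: "finite F" "Z \<subseteq> span (F \<union> B)"
  shows "qfin scale Z B"
proof -
  obtain f where f: "Vector_Spaces.linear scale scale f" and ker: "\<And>x. f x = 0 \<longleftrightarrow> x \<in> B"
    using ex_linear_kernel[OF B] by blast
  interpret f: Vector_Spaces.linear scale scale f by (rule f)
  obtain b where b: "b \<subseteq> f ` Z" "independent b" "f ` Z \<subseteq> span b"
    using basis_exists[of "f ` Z"] by metis
  have "f ` Z \<subseteq> span (f ` F)"
  proof -
    have "f ` Z \<subseteq> span (f ` (F \<union> B))" using F(2) f.span_image by blast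
    also have "f ` (F \<union> B) \<subseteq> insert 0 (f ` F)" using ker by auto
    then have "span (f ` (F \<union> B)) \<subseteq> span (f ` F)" by (metis span_mono span_insert_0)
    finally show ?thesis .
  qed
  then have "finite b" using b F(1) independent_span_bound[of "f ` F" b] by blast
  define W where "W = inv_into Z f ` b"
  have fX: "f (inv_into Z f y) = y" "inv_into Z f y \<in> Z" if "y \<in> b" for y
    using that b(1) by (auto simp: f_inv_into_f inv_into_into)
  have inj: "inj_on (inv_into Z f) b" using fX by (metis inj_on_def)
  have fsum: "f (\<Sum>x\<in>W. scale (c x) x) = (\<Sum>y\<in>b. scale (c (inv_into Z f y)) y)" for c
    using inj fX by (simp add: W_def sum.reindex f.sum f.scale)
  have "rel_basis scale Z B W"
    unfolding rel_basis_def
  proof (intro conjI allI impI ballI)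
    show "finite W" using \<open>finite b\<close> by (simp add: W_def)
    show "W \<subseteq> Z" using fX by (auto simp: W_def)
  next
    fix c x assume "(\<Sum>x\<in>W. scale (c x) x) \<in> B" "x \<in> W"
    then have "(\<Sum>y\<in>b. scale (c (inv_into Z f y)) y) = 0" using ker fsum by metis
    then have "\<forall>y\<in>b. c (inv_into Z f y) = 0"
      using independentD[OF b(2) \<open>finite b\<close> subset_refl, of "\<lambda>y. c (inv_into Z f y)"] by blast
    then show "c x = 0" using \<open>x \<in> W\<close> by (auto simp: W_def)
  next
    fix z assume "z \<in> Z"
    then have "f z \<in> span b" using b by blast
    then obtain u where u: "f z = (\<Sum>y\<in>b. scale (u y) y)" using span_finite[OF \<open>finite b\<close>] by blast
    have "(\<Sum>y\<in>b. scale (u (f (inv_into Z f y))) y) = f z" using u fX by simp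
    then have "f (z - (\<Sum>x\<in>W. scale (u (f x)) x)) = 0" by (simp add: f.diff fsum)
    then have "z - (\<Sum>x\<in>W. scale (u (f x)) x) \<in> B" using ker by blast
    then show "\<exists>c. z - (\<Sum>x\<in>W. scale (c x) x) \<in> B" by (rule exI[where x = "\<lambda>x. u (f x)"])
  qed
  then show ?thesis by (auto simp: qfin_def)
qed

lemma rel_basis_span:
  assumes "subspace B" "rel_basis scale Z B W"
  shows "Z \<subseteq> span (W \<union> B)"
proof
  fix z assume "z \<in> Z"
  then obtain c where c: "z - (\<Sum>x\<in>W. scale (c x) x) \<in> B" using assms by (auto simp: rel_basis_def)
  have "(\<Sum>x\<in>W. scale (c x) x) \<in> span (W \<union> B)"
    by (intro span_sum span_scale span_base) auto
  moreover have "z - (\<Sum>x\<in>W. scale (c x) x) \<in> span (W \<union> B)" using c by (auto intro: span_base)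
  ultimately show "z \<in> span (W \<union> B)" by (metis diff_add_cancel span_add)
qed

text \<open>Concatenation of bases in a tower. Independence is read off modulo \<open>B\<close>
  first, then modulo \<open>C\<close>; disjointness is recorded because it gives the additivity of
  \<open>qd\<close>.\<close>

lemma rel_basis_Un:
  assumes "subspace B" "C \<subseteq> B" "subspace C" "B \<subseteq> A"
    and W: "rel_basis scale B C W" and Y: "rel_basis scale A B Y"
  shows "rel_basis scale A C (W \<union> Y)" "W \<inter> Y = {}"
proof -
  have W': "finite W" "W \<subseteq> B" "\<And>c x. (\<Sum>x\<in>W. scale (c x) x) \<in> C \<Longrightarrow> x \<in> W \<Longrightarrow> c x = 0"
     "\<And>z. z \<in> B \<Longrightarrow> \<exists>c. z - (\<Sum>x\<in>W. scale (c x) x) \<in> C"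
    using W by (auto simp: rel_basis_def)
  have Y': "finite Y" "Y \<subseteq> A" "\<And>c x. (\<Sum>x\<in>Y. scale (c x) x) \<in> B \<Longrightarrow> x \<in> Y \<Longrightarrow> c x = 0"
     "\<And>z. z \<in> A \<Longrightarrow> \<exists>c. z - (\<Sum>x\<in>Y. scale (c x) x) \<in> B"
    using Y by (auto simp: rel_basis_def)
  show disj: "W \<inter> Y = {}"
  proof (rule ccontr)
    assume "W \<inter> Y \<noteq> {}"
    then obtain y where y: "y \<in> W" "y \<in> Y" by blast
    have "(\<Sum>x\<in>Y. scale (if x = y then 1 else 0) x) = (\<Sum>x\<in>Y. if x = y then y else 0)"
      by (intro sum.cong) auto
    also have "\<dots> = y" using y Y' by simp
    finally have "(\<Sum>x\<in>Y. scale (if x = y then 1 else 0) x) \<in> B" using W'(2) y by auto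
    from Y'(3)[OF this y(2)] show False by simp
  qed
  have split: "(\<Sum>x\<in>W \<union> Y. scale (c x) x) = (\<Sum>x\<in>W. scale (c x) x) + (\<Sum>x\<in>Y. scale (c x) x)" for c
    using W' Y' disj by (simp add: sum.union_disjoint)
  have WB: "(\<Sum>x\<in>W. scale (c x) x) \<in> B" for c
    using W'(2) assms(1) by (auto intro!: subspace_sum subspace_scale)
  show "rel_basis scale A C (W \<union> Y)"
    unfolding rel_basis_def
  proof (intro conjI allI impI ballI)
    show "finite (W \<union> Y)" "W \<union> Y \<subseteq> A" using W' Y' assms by auto
  next
    fix c x assume *: "(\<Sum>x\<in>W \<union> Y. scale (c x) x) \<in> C" "x \<in> W \<union> Y"
    have "(\<Sum>x\<in>W \<union> Y. scale (c x) x) - (\<Sum>x\<in>W. scale (c x) x) \<in> B"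
      using * assms WB subspace_diff by blast
    then have "(\<Sum>x\<in>Y. scale (c x) x) \<in> B" by (simp add: split)
    then have y: "\<forall>y\<in>Y. c y = 0" using Y'(3) by blast
    then have "(\<Sum>x\<in>W. scale (c x) x) \<in> C" using * by (simp add: split)
    then show "c x = 0" using y W'(3) *(2) by blast
  next
    fix z assume "z \<in> A"
    then obtain c where c: "z - (\<Sum>x\<in>Y. scale (c x) x) \<in> B" using Y' by blast
    then obtain e where e: "z - (\<Sum>x\<in>Y. scale (c x) x) - (\<Sum>x\<in>W. scale (e x) x) \<in> C" using W' by blast
    let ?g = "\<lambda>x. if x \<in> W then e x else c x"
    have "(\<Sum>x\<in>Y. scale (?g x) x) = (\<Sum>x\<in>Y. scale (c x) x)" using disj by (intro sum.cong) auto
    moreover have "(\<Sum>x\<in>W. scale (?g x) x) = (\<Sum>x\<in>W. scale (e x) x)" by (intro sum.cong) auto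
    ultimately have "z - (\<Sum>x\<in>W \<union> Y. scale (?g x) x) \<in> C" using e
      unfolding split by (metis diff_diff_eq add.commute)
    then show "\<exists>c. z - (\<Sum>x\<in>W \<union> Y. scale (c x) x) \<in> C" by (rule exI[where x = ?g])
  qed
qed

lemma qfin_trans_iff:
  assumes "subspace A" "subspace B" "subspace C" "C \<subseteq> B" "B \<subseteq> A"
  shows "qfin scale A C \<longleftrightarrow> qfin scale A B \<and> qfin scale B C"
proof
  assume "qfin scale A C"
  then obtain W where W: "rel_basis scale A C W" by (auto simp: qfin_def)
  then have W': "finite W" "A \<subseteq> span (W \<union> C)"
    using rel_basis_span assms by (auto simp: rel_basis_def)
  have "span (W \<union> C) \<subseteq> span (W \<union> B)" using assms by (intro span_mono) auto
  then show "qfin scale A B \<and> qfin scale B C"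
    using qfinI[OF assms(1,2) W'(1)] qfinI[OF assms(2,3) W'(1)] W'(2) assms by blast
next
  assume "qfin scale A B \<and> qfin scale B C"
  then show "qfin scale A C" unfolding qfin_def using rel_basis_Un assms by metis
qed

lemma qd_trans:
  assumes "subspace A" "subspace B" "subspace C" "C \<subseteq> B" "B \<subseteq> A" "qfin scale A B" "qfin scale B C"
  shows "qd scale A C = qd scale A B + qd scale B C"
proof -
  obtain W Y where W: "rel_basis scale B C W" and Y: "rel_basis scale A B Y"
    using assms by (auto simp: qfin_def)
  note WY = rel_basis_Un[OF assms(2,4,3,5) W Y]
  have "qd scale A C = card (W \<union> Y)" using qd_eq_card WY assms by blast
  also have "\<dots> = card Y + card W" using WY W Y by (simp add: card_Un_disjoint rel_basis_def)
  finally show ?thesis using qd_eq_card W Y assms by simp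
qed

lemma rel_basis_empty:
  assumes "Z \<subseteq> B"
  shows "rel_basis scale Z B {}"
  using assms by (auto simp: rel_basis_def)

lemma qfin_trivial: "Z \<subseteq> B \<Longrightarrow> qfin scale Z B"
  using rel_basis_empty by (auto simp: qfin_def)

lemma qd_trivial: "subspace Z \<Longrightarrow> subspace B \<Longrightarrow> Z \<subseteq> B \<Longrightarrow> qd scale Z B = 0"
  using qd_eq_card rel_basis_empty by (metis card.empty)

lemma qd_eq_0D:
  assumes "qfin scale Z B" "qd scale Z B = 0"
  shows "Z \<subseteq> B"
proof -
  define W where "W = (SOME W. rel_basis scale Z B W)"
  have W: "rel_basis scale Z B W" unfolding W_def using assms(1) unfolding qfin_def by (rule someI_ex)
  have "card W = 0" using assms(2) by (simp add: qd_def W_def)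
  then have "W = {}" using W by (auto simp: rel_basis_def)
  then show ?thesis using W by (auto simp: rel_basis_def)
qed

end

context vector_space_pair
begin

lemma rel_basis_transfer:
  fixes f :: "'b \<Rightarrow> 'c"
  assumes Z: "vs1.subspace Z" "vs1.subspace B"
    and add: "\<And>x y. x \<in> Z \<Longrightarrow> y \<in> Z \<Longrightarrow> f (x + y) = f x + f y"
    and scale: "\<And>c x. x \<in> Z \<Longrightarrow> f (s1 c x) = s2 c (f x)"
    and B': "vs2.subspace B'" and fZ: "f ` Z \<subseteq> Z'" and ker: "\<And>z. z \<in> Z \<Longrightarrow> f z \<in> B' \<longleftrightarrow> z \<in> B"
    and surj: "\<And>z'. z' \<in> Z' \<Longrightarrow> \<exists>z\<in>Z. z' - f z \<in> B'"
    and W: "rel_basis s1 Z B W"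
  shows "rel_basis s2 Z' B' (f ` W)" "inj_on f W"
proof -
  have W': "finite W" "W \<subseteq> Z" "\<And>c x. (\<Sum>x\<in>W. s1 (c x) x) \<in> B \<Longrightarrow> x \<in> W \<Longrightarrow> c x = 0"
     "\<And>z. z \<in> Z \<Longrightarrow> \<exists>c. z - (\<Sum>x\<in>W. s1 (c x) x) \<in> B"
    using W by (auto simp: rel_basis_def)
  have f0: "f 0 = 0" using add[of 0 0] Z vs1.subspace_0 by auto
  have sumZ: "(\<Sum>x\<in>Y. s1 (c x) x) \<in> Z" if "Y \<subseteq> W" for c Y
    using that W' Z by (auto intro!: vs1.subspace_sum vs1.subspace_scale)
  have fsum: "f (\<Sum>x\<in>Y. s1 (c x) x) = (\<Sum>x\<in>Y. s2 (c x) (f x))" if "Y \<subseteq> W" for c Y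
  proof -
    have "finite Y" using that W' finite_subset by blast
    then show ?thesis using that
    proof induction
      case (insert x Y)
      then have "f (s1 (c x) x + (\<Sum>x\<in>Y. s1 (c x) x)) = f (s1 (c x) x) + f (\<Sum>x\<in>Y. s1 (c x) x)"
        using W' Z vs1.subspace_scale by (intro add sumZ) auto
      then show ?case using insert W' by (auto simp: scale)
    qed (simp add: f0)
  qed
  have fdiff: "f (x - y) = f x - f y" if "x \<in> Z" "y \<in> Z" for x y
    using add[of "x - y" y] that Z vs1.subspace_diff by auto
  show inj: "inj_on f W"
  proof (rule inj_onI)
    fix x y assume xy: "x \<in> W" "y \<in> W" "f x = f y"
    then have "f x - f y = 0" "x \<in> Z" "y \<in> Z" using W' by auto
    then have "f (x - y) \<in> B'" using fdiff[of x y] vs2.subspace_0[OF B'] by simp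
    then have "x - y \<in> B" using ker[of "x - y"] W' xy Z vs1.subspace_diff by blast
    then show "x = y" using vs1.rel_basis_inj[OF W xy(1,2)] by simp
  qed
  show "rel_basis s2 Z' B' (f ` W)"
    unfolding rel_basis_def
  proof (intro conjI allI impI ballI)
    show "finite (f ` W)" using W' by simp
    show "f ` W \<subseteq> Z'" using W'(2) fZ by blast
  next
    fix c y assume *: "(\<Sum>x\<in>f ` W. s2 (c x) x) \<in> B'" "y \<in> f ` W"
    then have "f (\<Sum>x\<in>W. s1 (c (f x)) x) \<in> B'" using inj by (simp add: fsum sum.reindex)
    then have "(\<Sum>x\<in>W. s1 (c (f x)) x) \<in> B"
      using ker[OF sumZ[OF subset_refl, of "\<lambda>x. c (f x)"]] by simp
    moreover obtain x where "x \<in> W" "y = f x" using *(2) by blast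
    ultimately show "c y = 0" using W'(3)[of "\<lambda>x. c (f x)" x] by simp
  next
    fix z' assume "z' \<in> Z'"
    then obtain z where z: "z \<in> Z" "z' - f z \<in> B'" using surj by blast
    then obtain c where c: "z - (\<Sum>x\<in>W. s1 (c x) x) \<in> B" using W' by blast
    let ?g = "\<lambda>y. c (inv_into W f y)"
    have "(\<Sum>y\<in>f ` W. s2 (?g y) y) = f (\<Sum>x\<in>W. s1 (c x) x)"
      using inj by (simp add: fsum sum.reindex)
    moreover have "f z - f (\<Sum>x\<in>W. s1 (c x) x) \<in> B'"
      using fdiff[OF z(1) sumZ[OF subset_refl]] c ker[of "z - (\<Sum>x\<in>W. s1 (c x) x)"] Z(1) z(1) sumZ
        vs1.subspace_diff by (metis subset_refl)
    ultimately have "(z' - f z) + (f z - (\<Sum>y\<in>f ` W. s2 (?g y) y)) \<in> B'"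
      using z B' vs2.subspace_add by metis
    then have "z' - (\<Sum>y\<in>f ` W. s2 (?g y) y) \<in> B'" by simp
    then show "\<exists>c. z' - (\<Sum>x\<in>f ` W. s2 (c x) x) \<in> B'"
      by (rule exI[where x = ?g])
  qed
qed

text \<open>The hypotheses say that \<open>f\<close> induces an isomorphism from \<open>Z/B\<close>
  onto \<open>Z'/B'\<close>. Finiteness also has to be pulled back, and no inverse map is given:
  preimages modulo \<open>B'\<close> of a relative basis of the target are chosen and shown to
  generate \<open>Z\<close> modulo \<open>B\<close>.\<close>

lemma qd_transfer:
  fixes f :: "'b \<Rightarrow> 'c"
  assumes Z: "vs1.subspace Z" "vs1.subspace B"
    and add: "\<And>x y. x \<in> Z \<Longrightarrow> y \<in> Z \<Longrightarrow> f (x + y) = f x + f y"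
    and scale: "\<And>c x. x \<in> Z \<Longrightarrow> f (s1 c x) = s2 c (f x)"
    and Z': "vs2.subspace Z'" and B': "vs2.subspace B'" and fZ: "f ` Z \<subseteq> Z'"
    and ker: "\<And>z. z \<in> Z \<Longrightarrow> f z \<in> B' \<longleftrightarrow> z \<in> B"
    and surj: "\<And>z'. z' \<in> Z' \<Longrightarrow> \<exists>z\<in>Z. z' - f z \<in> B'"
  shows "qfin s1 Z B \<longleftrightarrow> qfin s2 Z' B'" "qfin s1 Z B \<Longrightarrow> qd s1 Z B = qd s2 Z' B'"
proof -
  have tr: "rel_basis s2 Z' B' (f ` W) \<and> inj_on f W" if "rel_basis s1 Z B W" for W
    using rel_basis_transfer[where f = f, OF Z add scale B' fZ ker surj that] by blast
  have 1: "qfin s1 Z B" if fin: "qfin s2 Z' B'"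
  proof -
    obtain Y where Y: "rel_basis s2 Z' B' Y" using fin by (auto simp: qfin_def)
    then have Y': "finite Y" "Y \<subseteq> Z'" by (auto simp: rel_basis_def)
    obtain g where g: "\<And>y. y \<in> Y \<Longrightarrow> g y \<in> Z \<and> y - f (g y) \<in> B'" using surj Y' by (metis subsetD)
    have f0: "f 0 = 0" using add[of 0 0] Z vs1.subspace_0 by auto
    have sumZ: "(\<Sum>y\<in>U. s1 (c y) (g y)) \<in> Z" if "U \<subseteq> Y" for c U
      using that g Z by (auto intro!: vs1.subspace_sum vs1.subspace_scale)
    have fsum: "f (\<Sum>y\<in>U. s1 (c y) (g y)) = (\<Sum>y\<in>U. s2 (c y) (f (g y)))" if "U \<subseteq> Y" for c U
    proof -
      have "finite U" using that Y' finite_subset by blast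
      then show ?thesis using that
      proof induction
        case (insert x U)
        then have "f (s1 (c x) (g x) + (\<Sum>x\<in>U. s1 (c x) (g x))) = f (s1 (c x) (g x)) + f (\<Sum>x\<in>U. s1 (c x) (g x))"
          using g Z vs1.subspace_scale by (intro add sumZ) auto
        then show ?case using insert g by (auto simp: scale)
      qed (simp add: f0)
    qed
    have fdiff: "f (x - y) = f x - f y" if "x \<in> Z" "y \<in> Z" for x y
      using add[of "x - y" y] that Z vs1.subspace_diff by auto
    have "Z \<subseteq> vs1.span (g ` Y \<union> B)"
    proof
      fix z assume z: "z \<in> Z"
      then have "f z \<in> Z'" using fZ by blast
      then obtain c where c: "f z - (\<Sum>y\<in>Y. s2 (c y) y) \<in> B'" using Y by (auto simp: rel_basis_def)
      have "(\<Sum>y\<in>Y. s2 (c y) (y - f (g y))) \<in> B'"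
        using g B' by (auto intro!: vs2.subspace_sum vs2.subspace_scale)
      then have "(f z - (\<Sum>y\<in>Y. s2 (c y) y)) + ((\<Sum>y\<in>Y. s2 (c y) y) - (\<Sum>y\<in>Y. s2 (c y) (f (g y)))) \<in> B'"
        using vs2.subspace_add[OF B' c, of "\<Sum>y\<in>Y. s2 (c y) (y - f (g y))"]
        by (simp only: vs2.scale_right_diff_distrib sum_subtractf)
      then have "f (z - (\<Sum>y\<in>Y. s1 (c y) (g y))) \<in> B'" using z by (simp add: fdiff sumZ fsum)
      then have "z - (\<Sum>y\<in>Y. s1 (c y) (g y)) \<in> B" using ker Z z sumZ vs1.subspace_diff by blast
      then have "z - (\<Sum>y\<in>Y. s1 (c y) (g y)) \<in> vs1.span (g ` Y \<union> B)" by (auto intro: vs1.span_base)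
      moreover have "(\<Sum>y\<in>Y. s1 (c y) (g y)) \<in> vs1.span (g ` Y \<union> B)"
        by (intro vs1.span_sum vs1.span_scale vs1.span_base) auto
      ultimately show "z \<in> vs1.span (g ` Y \<union> B)" by (metis diff_add_cancel vs1.span_add)
    qed
    then show ?thesis using vs1.qfinI[OF Z, of "g ` Y"] Y' by blast
  qed
  have 2: "qfin s2 Z' B'" if "qfin s1 Z B"
    using that tr unfolding qfin_def by blast
  show iff: "qfin s1 Z B \<longleftrightarrow> qfin s2 Z' B'" using 1 2 by blast
  show "qd s1 Z B = qd s2 Z' B'" if fin: "qfin s1 Z B"
  proof -
    obtain W where W: "rel_basis s1 Z B W" using fin by (auto simp: qfin_def)
    then show ?thesis using tr[OF W] vs1.qd_eq_card[OF Z W] vs2.qd_eq_card[OF Z' B', of "f ` W"]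
      by (simp add: card_image)
  qed
qed

end

section \<open>Cohomology of pairs of complexes\<close>

text \<open>All complexes live inside one ambient vector space and are given by their graded pieces; a pair
  \<open>B \<subseteq> A\<close> stands for the quotient complex \<open>A/B\<close>.\<close>

locale cochain = vector_space scale
  for scale :: "'f::field \<Rightarrow> 'b::ab_group_add \<Rightarrow> 'b" +
  fixes d :: "'b \<Rightarrow> 'b"
  assumes d_add: "d (x + y) = d x + d y"
    and d_scale: "d (scale c x) = scale c (d x)"
    and d_d: "d (d x) = 0"
begin

text \<open>The cocycles of \<open>A/B\<close>, pulled back to \<open>A\<close>. The coboundaries
  \<open>cobd\<close> are pulled back likewise and hence contain all of \<open>B p\<close>.\<close>

definition cocyc :: "(int \<Rightarrow> 'b set) \<Rightarrow> (int \<Rightarrow> 'b set) \<Rightarrow> int \<Rightarrow> 'b set" where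
  "cocyc A B p = {z \<in> A p. d z \<in> B (p + 1)}"

definition cobd :: "(int \<Rightarrow> 'b set) \<Rightarrow> (int \<Rightarrow> 'b set) \<Rightarrow> int \<Rightarrow> 'b set" where
  "cobd A B p = {w + d u |w u. w \<in> B p \<and> u \<in> A (p - 1)}"

definition subcomplex :: "(int \<Rightarrow> 'b set) \<Rightarrow> bool" where
  "subcomplex A \<longleftrightarrow> (\<forall>p. subspace (A p) \<and> (\<forall>x\<in>A p. d x \<in> A (p + 1)))"

definition hfin :: "(int \<Rightarrow> 'b set) \<Rightarrow> (int \<Rightarrow> 'b set) \<Rightarrow> int \<Rightarrow> bool" where
  "hfin A B p \<longleftrightarrow> qfin scale (cocyc A B p) (cobd A B p)"

definition hdim :: "(int \<Rightarrow> 'b set) \<Rightarrow> (int \<Rightarrow> 'b set) \<Rightarrow> int \<Rightarrow> nat" where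
  "hdim A B p = qd scale (cocyc A B p) (cobd A B p)"

lemma d_0: "d 0 = 0" using d_add[of 0 0] by simp

lemma d_diff: "d (x - y) = d x - d y" using d_add[of "x - y" y] by simp

lemma subspace_cocyc:
  assumes "subcomplex A" "subcomplex B"
  shows "subspace (cocyc A B p)"
  using assms unfolding subcomplex_def cocyc_def subspace_def by (auto simp: d_0 d_add d_scale)

lemma subspace_d_image: "subspace A \<Longrightarrow> subspace (d ` A)"
  unfolding subspace_def
  by (auto simp: image_iff) (metis d_0, metis d_add, metis d_scale)

lemma subspace_cobd:
  assumes "subcomplex A" "subcomplex B"
  shows "subspace (cobd A B p)"
proof -
  have "cobd A B p = {x + y |x y. x \<in> B p \<and> y \<in> d ` A (p - 1)}" unfolding cobd_def by auto
  then show ?thesis using assms subspace_sums subspace_d_image unfolding subcomplex_def by auto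
qed

lemma cobd_subset_cocyc:
  assumes "subcomplex A" "subcomplex B" "\<And>p. B p \<subseteq> A p"
  shows "cobd A B p \<subseteq> cocyc A B p"
proof
  fix z assume "z \<in> cobd A B p"
  then obtain w u where z: "z = w + d u" "w \<in> B p" "u \<in> A (p - 1)" by (auto simp: cobd_def)
  have "d u \<in> A p" using assms(1) z(3) unfolding subcomplex_def by (metis diff_add_cancel)
  then have "z \<in> A p" using z assms subspace_add unfolding subcomplex_def by blast
  moreover have "d z \<in> B (p + 1)" using z assms by (auto simp: d_add d_d subcomplex_def)
  ultimately show "z \<in> cocyc A B p" by (simp add: cocyc_def)
qed

lemma hdim_trivial:
  assumes "subcomplex A" "subcomplex B" "cocyc A B p \<subseteq> cobd A B p"
  shows "hfin A B p" "hdim A B p = 0"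
  using assms qfin_trivial qd_trivial subspace_cocyc subspace_cobd by (auto simp: hfin_def hdim_def)

text \<open>The long exact sequence of \<open>C \<subseteq> B \<subseteq> A\<close>, recorded by the dimensions of its images: \<open>e1 p\<close>
  is that of \<open>H\<^sup>p(A/C) \<rightarrow> H\<^sup>p(A/B)\<close>, \<open>e2 p\<close> that of \<open>H\<^sup>p(B/C) \<rightarrow> H\<^sup>p(A/C)\<close>, and
  \<open>r p\<close> that of the connecting map out of \<open>H\<^sup>p(A/B)\<close>; \<open>f1\<close>, \<open>f2\<close>, \<open>fr\<close> tell whether they are finite.\<close>

lemma long_exact_sequence:
  assumes A: "subcomplex A" and B: "subcomplex B" and C: "subcomplex C"
    and BA: "\<And>p. B p \<subseteq> A p" and CB: "\<And>p. C p \<subseteq> B p"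
  obtains f1 f2 fr :: "int \<Rightarrow> bool" and e1 e2 r :: "int \<Rightarrow> nat" where
    "\<And>p. hfin A C p \<longleftrightarrow> f1 p \<and> f2 p" "\<And>p. hfin A C p \<Longrightarrow> hdim A C p = e1 p + e2 p"
    "\<And>p. hfin A B p \<longleftrightarrow> fr p \<and> f1 p" "\<And>p. hfin A B p \<Longrightarrow> hdim A B p = r p + e1 p"
    "\<And>p. hfin B C p \<longleftrightarrow> f2 p \<and> fr (p - 1)" "\<And>p. hfin B C p \<Longrightarrow> hdim B C p = e2 p + r (p - 1)"
proof -
  interpret vp: vector_space_pair scale scale ..
  have sA: "subspace (A p)" and sB: "subspace (B p)" and sC: "subspace (C p)" for p
    using A B C by (auto simp: subcomplex_def)
  have dA: "x \<in> A (p - 1) \<Longrightarrow> d x \<in> A p" for x p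
    using A by (metis subcomplex_def diff_add_cancel)
  \<comment> \<open>Modulo the coboundaries, \<open>Y\<close> is the image of H^p(A/C) in H^p(A/B),
    \<open>R\<close> the kernel of that map, and \<open>S\<close> the kernel of H^p(B/C) to
    H^p(A/C). The three isomorphisms below express exactness at the three places.\<close>
  define Y where "Y p = {x + w |x w. x \<in> cocyc A C p \<and> w \<in> B p}" for p
  define R where "R p = cocyc A C p \<inter> cobd A B p" for p
  define S where "S p = cocyc B C p \<inter> cobd A C p" for p
  have ss: "subspace (cocyc A B p)" "subspace (cocyc A C p)" "subspace (cocyc B C p)"
     "subspace (cobd A B p)" "subspace (cobd A C p)" "subspace (cobd B C p)" for p
    using A B C subspace_cocyc subspace_cobd by auto
  have sY: "subspace (Y p)" for p unfolding Y_def using ss sB by (intro subspace_sums) auto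
  have sR: "subspace (R p)" "subspace (S p)" for p unfolding R_def S_def using ss subspace_inter by auto
  have CA: "C p \<subseteq> A p" for p using BA CB by blast
  have c1: "cobd A C p \<subseteq> R p" for p
    using cobd_subset_cocyc[OF A C CA] CB unfolding R_def cobd_def by blast
  have c2: "cobd A B p \<subseteq> Y p" for p
  proof
    fix z assume "z \<in> cobd A B p"
    then obtain w u where z: "z = w + d u" "w \<in> B p" "u \<in> A (p - 1)" by (auto simp: cobd_def)
    have "d u \<in> cocyc A C p" using dA[OF z(3)] sC subspace_0 by (auto simp: cocyc_def d_d)
    then have "d u + w \<in> Y p" using z(2) unfolding Y_def by blast
    then show "z \<in> Y p" using z(1) by (simp add: add.commute)
  qed
  have c3: "Y p \<subseteq> cocyc A B p" for p
  proof
    fix z assume "z \<in> Y p"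
    then obtain x w where z: "z = x + w" "x \<in> A p" "d x \<in> C (p + 1)" "w \<in> B p"
      by (auto simp: Y_def cocyc_def)
    have "d x \<in> B (p + 1)" "d w \<in> B (p + 1)" using z CB B by (auto simp: subcomplex_def)
    then have "d z \<in> B (p + 1)" using z(1) subspace_add[OF sB] by (simp add: d_add)
    moreover have "z \<in> A p" using z BA[of p] subspace_add[OF sA] by blast
    ultimately show "z \<in> cocyc A B p" by (simp add: cocyc_def)
  qed
  have c4: "cobd B C p \<subseteq> S p" for p
    using cobd_subset_cocyc[OF B C CB] BA unfolding S_def cobd_def by blast
  have c5: "R p \<subseteq> cocyc A C p" "S p \<subseteq> cocyc B C p" for p unfolding R_def S_def by auto
  have iso1: "qfin scale (cocyc A C p) (R p) \<longleftrightarrow> qfin scale (Y p) (cobd A B p)"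
    "qfin scale (cocyc A C p) (R p) \<Longrightarrow> qd scale (cocyc A C p) (R p) = qd scale (Y p) (cobd A B p)" for p
  proof -
    have a: "(\<lambda>x. x) ` cocyc A C p \<subseteq> Y p" unfolding Y_def using sB subspace_0 by force
    have b: "\<And>z. z \<in> cocyc A C p \<Longrightarrow> z \<in> cobd A B p \<longleftrightarrow> z \<in> R p" unfolding R_def by auto
    have c: "\<exists>z\<in>cocyc A C p. y - z \<in> cobd A B p" if yin: "y \<in> Y p" for y
    proof -
      obtain x w where y: "y = x + w" "x \<in> cocyc A C p" "w \<in> B p"
        using yin unfolding Y_def by blast
      have "w + d 0 \<in> cobd A B p" unfolding cobd_def using y sA subspace_0 by blast
      then show ?thesis using y(1,2) by (intro bexI[of _ x]) (auto simp: d_0)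
    qed
    show "qfin scale (cocyc A C p) (R p) \<longleftrightarrow> qfin scale (Y p) (cobd A B p)"
    "qfin scale (cocyc A C p) (R p) \<Longrightarrow> qd scale (cocyc A C p) (R p) = qd scale (Y p) (cobd A B p)"
      using vp.qd_transfer[OF ss(2) sR(1) _ _ sY ss(4) a b c] by auto
  qed
  have iso2: "qfin scale (cocyc B C p) (S p) \<longleftrightarrow> qfin scale (R p) (cobd A C p)"
    "qfin scale (cocyc B C p) (S p) \<Longrightarrow> qd scale (cocyc B C p) (S p) = qd scale (R p) (cobd A C p)" for p
  proof -
    have a: "(\<lambda>x. x) ` cocyc B C p \<subseteq> R p"
    proof clarify
      fix x assume x: "x \<in> cocyc B C p"
      then have "x + d 0 \<in> cobd A B p" unfolding cobd_def cocyc_def using sA subspace_0 by blast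
      then show "x \<in> R p" using x BA by (auto simp: R_def cocyc_def d_0)
    qed
    have b: "\<And>z. z \<in> cocyc B C p \<Longrightarrow> z \<in> cobd A C p \<longleftrightarrow> z \<in> S p" unfolding S_def by auto
    have c: "\<exists>z\<in>cocyc B C p. y - z \<in> cobd A C p" if yin: "y \<in> R p" for y
    proof -
      obtain w u where y: "y = w + d u" "w \<in> B p" "u \<in> A (p - 1)" "d y \<in> C (p + 1)"
        using yin by (auto simp: R_def cobd_def cocyc_def)
      have "0 + d u \<in> cobd A C p" unfolding cobd_def using y sC subspace_0 by blast
      moreover have "w \<in> cocyc B C p" using y by (auto simp: cocyc_def d_add d_d)
      ultimately show ?thesis using y(1) by (intro bexI[of _ w]) auto
    qed
    show "qfin scale (cocyc B C p) (S p) \<longleftrightarrow> qfin scale (R p) (cobd A C p)"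
    "qfin scale (cocyc B C p) (S p) \<Longrightarrow> qd scale (cocyc B C p) (S p) = qd scale (R p) (cobd A C p)"
      using vp.qd_transfer[OF ss(3) sR(2) _ _ sR(1) ss(5) a b c] by auto
  qed
  \<comment> \<open>On representatives the connecting map is \<open>d\<close> itself: its kernel is
    \<open>Y\<close> in degree \<open>p - 1\<close> and its image is \<open>S\<close> in degree
    \<open>p\<close>.\<close>
  have iso3: "qfin scale (cocyc A B (p - 1)) (Y (p - 1)) \<longleftrightarrow> qfin scale (S p) (cobd B C p)"
    "qfin scale (cocyc A B (p - 1)) (Y (p - 1)) \<Longrightarrow>
      qd scale (cocyc A B (p - 1)) (Y (p - 1)) = qd scale (S p) (cobd B C p)" for p
  proof -
    have a: "d ` cocyc A B (p - 1) \<subseteq> S p"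
    proof clarify
      fix x assume x: "x \<in> cocyc A B (p - 1)"
      then have "0 + d x \<in> cobd A C p" unfolding cobd_def cocyc_def using sC subspace_0 by blast
      then show "d x \<in> S p" using x sC subspace_0 by (auto simp: S_def cocyc_def d_d)
    qed
    have b: "d z \<in> cobd B C p \<longleftrightarrow> z \<in> Y (p - 1)" if "z \<in> cocyc A B (p - 1)" for z
    proof
      assume "d z \<in> cobd B C p"
      then obtain w u where y: "d z = w + d u" "w \<in> C p" "u \<in> B (p - 1)" by (auto simp: cobd_def)
      have "z - u \<in> cocyc A C (p - 1)"
        using y that BA[of "p - 1"] subspace_diff[OF sA] by (auto simp: cocyc_def d_diff)
      then have "(z - u) + u \<in> Y (p - 1)" using y(3) unfolding Y_def by blast
      then show "z \<in> Y (p - 1)" by simp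
    next
      assume "z \<in> Y (p - 1)"
      then obtain x w where "z = x + w" "d x \<in> C p" "w \<in> B (p - 1)" by (auto simp: Y_def cocyc_def)
      then show "d z \<in> cobd B C p" by (auto simp: cobd_def d_add)
    qed
    have c: "\<exists>z\<in>cocyc A B (p - 1). y - d z \<in> cobd B C p" if yin: "y \<in> S p" for y
    proof -
      obtain w u where y: "y = w + d u" "w \<in> C p" "u \<in> A (p - 1)" "y \<in> B p"
        using yin by (auto simp: S_def cobd_def cocyc_def)
      have "d u = y - w" using y by simp
      moreover have "y - w \<in> B p" using subspace_diff[OF sB y(4)] y(2) CB by blast
      ultimately have "u \<in> cocyc A B (p - 1)" using y(3) by (simp add: cocyc_def)
      moreover have "w + d 0 \<in> cobd B C p" unfolding cobd_def using y sB subspace_0 by blast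
      ultimately show ?thesis using y(1) by (intro bexI[of _ u]) (auto simp: d_0)
    qed
    show "qfin scale (cocyc A B (p - 1)) (Y (p - 1)) \<longleftrightarrow> qfin scale (S p) (cobd B C p)"
    "qfin scale (cocyc A B (p - 1)) (Y (p - 1)) \<Longrightarrow>
      qd scale (cocyc A B (p - 1)) (Y (p - 1)) = qd scale (S p) (cobd B C p)"
      using vp.qd_transfer[OF ss(1) sY _ _ sR(2) ss(6) a b c] by (auto simp: d_add d_scale)
  qed
  show thesis
  proof (rule that[of "\<lambda>p. qfin scale (cocyc A C p) (R p)" "\<lambda>p. qfin scale (R p) (cobd A C p)"
        "\<lambda>p. qd scale (cocyc A C p) (R p)" "\<lambda>p. qd scale (R p) (cobd A C p)"
        "\<lambda>p. qfin scale (cocyc A B p) (Y p)" "\<lambda>p. qd scale (cocyc A B p) (Y p)"])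
    fix p
    show 1: "hfin A C p \<longleftrightarrow> qfin scale (cocyc A C p) (R p) \<and> qfin scale (R p) (cobd A C p)"
      unfolding hfin_def using qfin_trans_iff ss sR c1 c5 by metis
    show "hdim A C p = qd scale (cocyc A C p) (R p) + qd scale (R p) (cobd A C p)" if "hfin A C p"
      unfolding hdim_def using that 1 qd_trans ss sR c1 c5 by metis
    show 2: "hfin A B p \<longleftrightarrow> qfin scale (cocyc A B p) (Y p) \<and> qfin scale (cocyc A C p) (R p)"
      unfolding hfin_def iso1 using qfin_trans_iff ss sY c2 c3 by metis
    show "hdim A B p = qd scale (cocyc A B p) (Y p) + qd scale (cocyc A C p) (R p)" if "hfin A B p"
      using that 2 iso1[of p] qd_trans[OF ss(1) sY ss(4) c2 c3, of p] unfolding hdim_def by simp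
    show 3: "hfin B C p \<longleftrightarrow> qfin scale (R p) (cobd A C p) \<and> qfin scale (cocyc A B (p - 1)) (Y (p - 1))"
      unfolding hfin_def iso3 iso2[symmetric] using qfin_trans_iff ss sR c4 c5 by metis
    show "hdim B C p = qd scale (R p) (cobd A C p) + qd scale (cocyc A B (p - 1)) (Y (p - 1))"
      if "hfin B C p"
      using that 3 iso2[of p] iso3[of p] qd_trans[OF ss(3) sR(2) ss(6) c4 c5(2), of p]
      unfolding hdim_def by simp
  qed
qed

context
  fixes A B C
  assumes A: "subcomplex A" and B: "subcomplex B" and C: "subcomplex C"
    and BA: "\<And>p. B p \<subseteq> A p" and CB: "\<And>p. C p \<subseteq> B p"
begin

lemma hdim_extension:
  assumes "hfin A B p" "hfin B C p"
  shows "hfin A C p" "hdim A C p \<le> hdim A B p + hdim B C p"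
proof -
  obtain f1 f2 fr e1 e2 r where les:
    "\<And>p. hfin A C p \<longleftrightarrow> f1 p \<and> f2 p" "\<And>p. hfin A C p \<Longrightarrow> hdim A C p = e1 p + e2 p"
    "\<And>p. hfin A B p \<longleftrightarrow> fr p \<and> f1 p" "\<And>p. hfin A B p \<Longrightarrow> hdim A B p = r p + e1 p"
    "\<And>p. hfin B C p \<longleftrightarrow> f2 p \<and> fr (p - 1)" "\<And>p. hfin B C p \<Longrightarrow> hdim B C p = e2 p + r (p - 1)"
    by (rule long_exact_sequence[OF A B C BA CB]; rule that; assumption)
  show "hfin A C p" using assms les(1,3,5) by blast
  then show "hdim A C p \<le> hdim A B p + hdim B C p" using les(2,4,6) assms by simp
qed

lemma hdim_kernel:
  assumes "hfin A C p" "hfin A B (p - 1)"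
  shows "hfin B C p" "hdim B C p \<le> hdim A C p + hdim A B (p - 1)"
proof -
  obtain f1 f2 fr e1 e2 r where les:
    "\<And>p. hfin A C p \<longleftrightarrow> f1 p \<and> f2 p" "\<And>p. hfin A C p \<Longrightarrow> hdim A C p = e1 p + e2 p"
    "\<And>p. hfin A B p \<longleftrightarrow> fr p \<and> f1 p" "\<And>p. hfin A B p \<Longrightarrow> hdim A B p = r p + e1 p"
    "\<And>p. hfin B C p \<longleftrightarrow> f2 p \<and> fr (p - 1)" "\<And>p. hfin B C p \<Longrightarrow> hdim B C p = e2 p + r (p - 1)"
    by (rule long_exact_sequence[OF A B C BA CB]; rule that; assumption)
  show "hfin B C p" using assms les(1,3,5) by blast
  then show "hdim B C p \<le> hdim A C p + hdim A B (p - 1)" using les(2,4,6) assms by simp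
qed

lemma euler_characteristic_additive:
  assumes fin: "\<And>p. hfin A B p" "\<And>p. hfin B C p"
    and neg: "A (- 1) = {0}" and top: "A (int n + 1) = {0}"
  shows "(\<Sum>p\<le>n. (- 1) ^ p * int (hdim A C (int p))) =
     (\<Sum>p\<le>n. (- 1) ^ p * int (hdim A B (int p))) + (\<Sum>p\<le>n. (- 1) ^ p * int (hdim B C (int p)))"
proof -
  obtain f1 f2 fr e1 e2 r where les:
    "\<And>p. hfin A C p \<longleftrightarrow> f1 p \<and> f2 p" "\<And>p. hfin A C p \<Longrightarrow> hdim A C p = e1 p + e2 p"
    "\<And>p. hfin A B p \<longleftrightarrow> fr p \<and> f1 p" "\<And>p. hfin A B p \<Longrightarrow> hdim A B p = r p + e1 p"
    "\<And>p. hfin B C p \<longleftrightarrow> f2 p \<and> fr (p - 1)" "\<And>p. hfin B C p \<Longrightarrow> hdim B C p = e2 p + r (p - 1)"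
    by (rule long_exact_sequence[OF A B C BA CB]; rule that; assumption)
  have fAC: "hfin A C p" for p using fin les by blast
  have "cocyc A B (- 1) \<subseteq> {0}" using neg by (auto simp: cocyc_def)
  then have "cocyc A B (- 1) \<subseteq> cobd A B (- 1)" using subspace_cobd[OF A B] subspace_0 by blast
  then have r0: "r (- 1) = 0" using hdim_trivial[OF A B] les(4)[of "- 1"] by simp
  have "B (int n + 1) \<subseteq> {0}" using top BA by blast
  then have "cocyc B C (int n + 1) \<subseteq> {0}" by (auto simp: cocyc_def)
  then have "cocyc B C (int n + 1) \<subseteq> cobd B C (int n + 1)" using subspace_cobd[OF B C] subspace_0 by blast
  then have rn: "r (int n) = 0" using hdim_trivial[OF B C] les(6)[of "int n + 1"] by simp
  \<comment> \<open>Sums truncated at \<open>m\<close> fail to be additive exactly by the rank of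
    the connecting map leaving degree \<open>m\<close>. That rank is 0 before the first degree and
    after the last.\<close>
  have "(\<Sum>p\<le>m. (- 1) ^ p * int (hdim A B (int p))) + (\<Sum>p\<le>m. (- 1) ^ p * int (hdim B C (int p)))
     = (\<Sum>p\<le>m. (- 1) ^ p * int (hdim A C (int p))) + (- 1) ^ m * int (r (int m))" for m
  proof (induction m)
    case 0
    then show ?case using les(2,4,6)[of 0] fAC fin r0 by simp
  next
    case (Suc m)
    have eqs: "hdim A C (int (Suc m)) = e1 (int (Suc m)) + e2 (int (Suc m))"
      "hdim A B (int (Suc m)) = r (int (Suc m)) + e1 (int (Suc m))"
      "hdim B C (int (Suc m)) = e2 (int (Suc m)) + r (int m)"
      using les(2,4,6)[of "int (Suc m)"] fAC fin by auto
    show ?case unfolding sum.atMost_Suc eqs using Suc by (simp add: algebra_simps)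
  qed
  from this[of n] show ?thesis using rn by simp
qed

text \<open>In the long exact sequence the map from H^p(B/C) to H^p(A/C) stands between H^(p-1)(A/B)
  and H^p(A/B).\<close>

lemma hdim_acyclic_quotient:
  assumes "cocyc A B p \<subseteq> cobd A B p" "cocyc A B (p - 1) \<subseteq> cobd A B (p - 1)"
  shows "hfin A C p \<longleftrightarrow> hfin B C p" "hfin A C p \<Longrightarrow> hdim A C p = hdim B C p"
proof -
  obtain f1 f2 fr e1 e2 r where les:
    "\<And>p. hfin A C p \<longleftrightarrow> f1 p \<and> f2 p" "\<And>p. hfin A C p \<Longrightarrow> hdim A C p = e1 p + e2 p"
    "\<And>p. hfin A B p \<longleftrightarrow> fr p \<and> f1 p" "\<And>p. hfin A B p \<Longrightarrow> hdim A B p = r p + e1 p"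
    "\<And>p. hfin B C p \<longleftrightarrow> f2 p \<and> fr (p - 1)" "\<And>p. hfin B C p \<Longrightarrow> hdim B C p = e2 p + r (p - 1)"
    by (rule long_exact_sequence[OF A B C BA CB]; rule that; assumption)
  note 1 = hdim_trivial[OF A B assms(1)] hdim_trivial[OF A B assms(2)]
  show *: "hfin A C p \<longleftrightarrow> hfin B C p" using 1 les(1)[of p] les(3)[of p] les(3)[of "p - 1"] les(5)[of p] by blast
  show "hdim A C p = hdim B C p" if "hfin A C p"
    using that * 1 les(2,6)[of p] les(4)[of p] les(4)[of "p - 1"] by simp
qed

text \<open>Here the map from H^p(A/C) to H^p(A/B) stands between H^p(B/C) and H^(p+1)(B/C), so the
  second degree is \<open>p + 1\<close>.\<close>

lemma hdim_acyclic_sub: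
  assumes "cocyc B C p \<subseteq> cobd B C p" "cocyc B C (p + 1) \<subseteq> cobd B C (p + 1)"
  shows "hfin A C p \<longleftrightarrow> hfin A B p" "hfin A C p \<Longrightarrow> hdim A C p = hdim A B p"
proof -
  obtain f1 f2 fr e1 e2 r where les:
    "\<And>p. hfin A C p \<longleftrightarrow> f1 p \<and> f2 p" "\<And>p. hfin A C p \<Longrightarrow> hdim A C p = e1 p + e2 p"
    "\<And>p. hfin A B p \<longleftrightarrow> fr p \<and> f1 p" "\<And>p. hfin A B p \<Longrightarrow> hdim A B p = r p + e1 p"
    "\<And>p. hfin B C p \<longleftrightarrow> f2 p \<and> fr (p - 1)" "\<And>p. hfin B C p \<Longrightarrow> hdim B C p = e2 p + r (p - 1)"
    by (rule long_exact_sequence[OF A B C BA CB]; rule that; assumption)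
  note 1 = hdim_trivial[OF B C assms(1)] hdim_trivial[OF B C assms(2)]
  have fr: "fr p" using 1(3) les(5)[of "p + 1"] by simp
  show *: "hfin A C p \<longleftrightarrow> hfin A B p" using 1 fr les(1)[of p] les(3)[of p] les(5)[of p] by blast
  show "hdim A C p = hdim A B p" if "hfin A C p"
    using that * 1 les(2,4)[of p] les(6)[of p] les(6)[of "p + 1"] by simp
qed

end

text \<open>If \<open>g\<close> is injective on \<open>A/B\<close>, with image in \<open>A'/B'\<close> and cokernel \<open>A'/N\<close>, the connecting
  map from \<open>H\<^sup>p\<^sup>-\<^sup>1(A'/N)\<close> is all that prevents \<open>g\<close> from being injective on \<open>H\<^sup>p(A/B)\<close>.\<close>

lemma injective_on_cohomology:
  assumes A': "subcomplex A'" and B': "subcomplex B'"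
    and g: "\<And>x y. g (x + y) = g x + g y" "\<And>x. g (d x) = d (g x)"
    and inj: "\<And>y. y \<in> A p \<Longrightarrow> g y \<in> B' p \<Longrightarrow> y \<in> B p"
    and N: "\<And>q. N q = {w + g u |w u. w \<in> B' q \<and> u \<in> A q}"
    and A: "subcomplex A"
    and van: "cocyc A' N (p - 1) \<subseteq> cobd A' N (p - 1)"
    and y: "y \<in> A p" "g y \<in> cobd A' B' p"
  shows "y \<in> cobd A B p"
proof -
  have g_diff: "g (x - y) = g x - g y" for x y using g(1)[of "x - y" y] by simp
  obtain w u where wu: "g y = w + d u" "w \<in> B' p" "u \<in> A' (p - 1)" using y(2) by (auto simp: cobd_def)
  have "- w \<in> B' p" using wu B' subspace_neg by (auto simp: subcomplex_def)
  then have "- w + g y \<in> N p" using y(1) unfolding N by blast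
  \<comment> \<open>\<open>u\<close> represents the class in H^(p-1)(A'/N) whose image under the
    connecting map is the class of \<open>y\<close>. As it is a coboundary, \<open>u\<close> may be
    replaced by \<open>b + g a\<close> without changing \<open>d u\<close>, and then
    \<open>d a\<close> bounds \<open>y\<close> modulo \<open>B\<close>.\<close>
  then have "u \<in> cocyc A' N (p - 1)" using wu by (simp add: cocyc_def)
  then have "u \<in> cobd A' N (p - 1)" using van by blast
  then obtain w' u' where 1: "u = w' + d u'" "w' \<in> N (p - 1)" by (auto simp: cobd_def)
  then obtain b a where 2: "w' = b + g a" "b \<in> B' (p - 1)" "a \<in> A (p - 1)" unfolding N by auto
  have "d u = d b + g (d a)" using 1 2 by (simp add: d_add d_d g)
  then have eq: "g (y - d a) = w + d b" using wu by (simp add: g_diff)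
  have "d b \<in> B' p" using B' 2(2) by (metis subcomplex_def diff_add_cancel)
  then have "w + d b \<in> B' p" using B' wu subspace_add by (auto simp: subcomplex_def)
  moreover have "d a \<in> A p" using A 2(3) by (metis subcomplex_def diff_add_cancel)
  then have "y - d a \<in> A p" using A y(1) subspace_diff by (auto simp: subcomplex_def)
  ultimately have "y - d a \<in> B p" using inj[of "y - d a"] eq by simp
  then have "(y - d a) + d a \<in> cobd A B p" using 2(3) unfolding cobd_def by blast
  then show ?thesis by simp
qed

end

section \<open>Ideals and homogeneous parts\<close>

definition is_ideal :: "'a::comm_ring_1 set \<Rightarrow> bool" where
  "is_ideal N \<longleftrightarrow> 0 \<in> N \<and> (\<forall>x\<in>N. \<forall>y\<in>N. x + y \<in> N) \<and> (\<forall>x\<in>N. \<forall>r. r * x \<in> N)"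

lemma ideal_0: "is_ideal N \<Longrightarrow> 0 \<in> N"
  and ideal_add: "is_ideal N \<Longrightarrow> x \<in> N \<Longrightarrow> y \<in> N \<Longrightarrow> x + y \<in> N"
  and ideal_mult: "is_ideal N \<Longrightarrow> x \<in> N \<Longrightarrow> r * x \<in> N"
  by (auto simp: is_ideal_def)

lemma ideal_mult2: "is_ideal N \<Longrightarrow> x \<in> N \<Longrightarrow> x * r \<in> N"
  using ideal_mult[of N x r] by (simp add: mult.commute)

lemma ideal_neg: "is_ideal N \<Longrightarrow> x \<in> N \<Longrightarrow> - x \<in> N"
  using ideal_mult[of N x "- 1"] by simp

lemma ideal_diff: "is_ideal N \<Longrightarrow> x \<in> N \<Longrightarrow> y \<in> N \<Longrightarrow> x - y \<in> N"
  using ideal_add[of N x "- y"] ideal_neg[of N y] by simp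

lemma ideal_sum: "is_ideal N \<Longrightarrow> (\<And>i. i \<in> A \<Longrightarrow> f i \<in> N) \<Longrightarrow> sum f A \<in> N"
  by (induction A rule: infinite_finite_induct) (auto simp: ideal_0 ideal_add)

lemma ideal_UNIV: "is_ideal UNIV" by (simp add: is_ideal_def)

lemma ideal_Inter: "(\<And>N. N \<in> F \<Longrightarrow> is_ideal N) \<Longrightarrow> is_ideal (\<Inter>F)"
  by (auto simp: is_ideal_def)

lemma ideal_Int: "is_ideal N \<Longrightarrow> is_ideal N' \<Longrightarrow> is_ideal (N \<inter> N')"
  by (auto simp: is_ideal_def)

text \<open>The colon ideal (N : r).\<close>

definition ideal_quot :: "'a::comm_ring_1 set \<Rightarrow> 'a \<Rightarrow> 'a set" where
  "ideal_quot N r = {x. r * x \<in> N}"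

lemma ideal_ideal_quot: "is_ideal N \<Longrightarrow> is_ideal (ideal_quot N r)"
  by (auto simp: is_ideal_def ideal_quot_def distrib_left mult.left_commute)

text \<open>The ideal N + rM. With \<open>N = N2\<close> and \<open>M = N1\<close> it is the
  denominator of the cokernel of multiplication by \<open>r\<close> on \<open>N1/N2\<close>.\<close>

definition add_multiples :: "'a::comm_ring_1 set \<Rightarrow> 'a \<Rightarrow> 'a set \<Rightarrow> 'a set" where
  "add_multiples N r M = {x + r * y |x y. x \<in> N \<and> y \<in> M}"

lemma ideal_add_multiples:
  assumes "is_ideal N" "is_ideal M"
  shows "is_ideal (add_multiples N r M)"
  unfolding is_ideal_def
proof (intro conjI ballI allI)
  show "0 \<in> add_multiples N r M"
    using ideal_0 assms by (force simp: add_multiples_def)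
  fix x assume "x \<in> add_multiples N r M"
  then obtain a b where x: "x = a + r * b" "a \<in> N" "b \<in> M" by (auto simp: add_multiples_def)
  show "s * x \<in> add_multiples N r M" for s
  proof -
    have "s * x = s * a + r * (s * b)" using x by (simp add: algebra_simps)
    then show ?thesis unfolding add_multiples_def using x assms ideal_mult by blast
  qed
  fix y assume "y \<in> add_multiples N r M"
  then obtain a' b' where y: "y = a' + r * b'" "a' \<in> N" "b' \<in> M" by (auto simp: add_multiples_def)
  have "x + y = (a + a') + r * (b + b')" using x y by (simp add: algebra_simps)
  then show "x + y \<in> add_multiples N r M" unfolding add_multiples_def using x y assms ideal_add by blast
qed

lemma add_multiples_superset: "is_ideal M \<Longrightarrow> N \<subseteq> add_multiples N r M"
  unfolding add_multiples_def using ideal_0 by force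

lemma add_multiples_mult: "is_ideal N \<Longrightarrow> y \<in> M \<Longrightarrow> r * y \<in> add_multiples N r M"
  unfolding add_multiples_def using ideal_0 by force

lemma add_multiples_subset: "is_ideal M \<Longrightarrow> N \<subseteq> M \<Longrightarrow> add_multiples N r M \<subseteq> M"
  unfolding add_multiples_def using ideal_add ideal_mult by blast

section \<open>Homogeneous parts of polynomials and graded ideals\<close>

lemma poly_mapping_single_induct [case_names single add]:
  assumes "\<And>k v. P (Poly_Mapping.single k v)" "\<And>f g. P f \<Longrightarrow> P g \<Longrightarrow> P (f + g)"
  shows "P f"
proof (induction f rule: update_induct)
  case const
  show ?case using assms(1)[of undefined 0] by simp
next
  case (update f a b)
  have "Poly_Mapping.update a b f = f + Poly_Mapping.single a b"
    using update(1) by (intro poly_mapping_eqI) (auto simp: lookup_update lookup_add lookup_single in_keys_iff)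
  then show ?case using assms update by metis
qed

text \<open>The degree function is a parameter because the same operation is applied to polynomials,
  with \<open>pdeg\<close>, and to Laurent polynomials, with \<open>ldeg\<close>.\<close>

definition hpart :: "('a \<Rightarrow> int) \<Rightarrow> int \<Rightarrow> ('a \<Rightarrow>\<^sub>0 'b::comm_monoid_add) \<Rightarrow> ('a \<Rightarrow>\<^sub>0 'b)" where
  "hpart dg j f = Poly_Mapping.mapp (\<lambda>k v. v when dg k = j) f"

lemma lookup_hpart: "Poly_Mapping.lookup (hpart dg j f) k = (Poly_Mapping.lookup f k when dg k = j)"
  by (auto simp: hpart_def lookup_mapp when_def in_keys_iff)

lemma hpart_add: "hpart dg j (f + g) = hpart dg j f + hpart dg j g"
  by (rule poly_mapping_eqI) (auto simp: lookup_hpart lookup_add when_def)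

lemma hpart_0 [simp]: "hpart dg j 0 = 0"
  by (rule poly_mapping_eqI) (auto simp: lookup_hpart)

lemma hpart_sum: "hpart dg j (sum f A) = (\<Sum>i\<in>A. hpart dg j (f i))"
  by (induction A rule: infinite_finite_induct) (auto simp: hpart_add)

lemma hpart_single: "hpart dg j (Poly_Mapping.single k v) = (if dg k = j then Poly_Mapping.single k v else 0)"
  by (rule poly_mapping_eqI) (auto simp: lookup_hpart lookup_single when_def)

lemma hpart_single_mult:
  fixes f :: "'a::comm_monoid_add \<Rightarrow>\<^sub>0 'b::comm_semiring_1"
  assumes "\<And>a b. dg (a + b) = dg a + dg b"
  shows "hpart dg j (Poly_Mapping.single b c * f) = Poly_Mapping.single b c * hpart dg (j - dg b) f"
  by (induction f rule: poly_mapping_single_induct)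
    (auto simp: hpart_single mult_single assms hpart_add distrib_left)

lemma hpart_hpart: "hpart dg j (hpart dg i f) = (if i = j then hpart dg i f else 0)"
  by (rule poly_mapping_eqI) (auto simp: lookup_hpart when_def)

lemma keys_hpart: "Poly_Mapping.keys (hpart dg j f) = {k \<in> Poly_Mapping.keys f. dg k = j}"
  by (auto simp: in_keys_iff lookup_hpart)

lemma hpart_eq_self_iff: "hpart dg j f = f \<longleftrightarrow> (\<forall>k\<in>Poly_Mapping.keys f. dg k = j)"
proof
  show "\<forall>k\<in>Poly_Mapping.keys f. dg k = j" if "hpart dg j f = f"
    using keys_hpart[of dg j f] that by auto
  show "hpart dg j f = f" if "\<forall>k\<in>Poly_Mapping.keys f. dg k = j"
    using that by (intro poly_mapping_eqI) (auto simp: lookup_hpart when_def in_keys_iff)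
qed

lemma sum_hpart:
  assumes "finite J" "dg ` Poly_Mapping.keys f \<subseteq> J"
  shows "(\<Sum>j\<in>J. hpart dg j f) = f"
proof (rule poly_mapping_eqI)
  fix k
  have "(\<Sum>j\<in>J. Poly_Mapping.lookup (hpart dg j f) k) = (\<Sum>j\<in>J. if dg k = j then Poly_Mapping.lookup f k else 0)"
    by (auto simp: lookup_hpart when_def)
  also have "\<dots> = Poly_Mapping.lookup f k"
  proof (cases "dg k \<in> J")
    case False
    then have "k \<notin> Poly_Mapping.keys f" using assms by blast
    then show ?thesis using assms(1) by (simp add: in_keys_iff)
  qed (use assms(1) in simp)
  finally show "Poly_Mapping.lookup (\<Sum>j\<in>J. hpart dg j f) k = Poly_Mapping.lookup f k"
    by (simp add: lookup_sum)
qed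

abbreviation pdeg :: "('n::{finite,linorder} \<Rightarrow>\<^sub>0 nat) \<Rightarrow> int" where
  "pdeg a \<equiv> int (mdeg a)"

lemma mdeg_add: "mdeg (a + b) = mdeg a + mdeg b"
  by (simp add: mdeg_def lookup_add sum.distrib)

lemma mdeg_single: "mdeg (Poly_Mapping.single v n) = n"
  by (simp add: mdeg_def lookup_single when_def)

lemma mem_homogeneous_part_iff: "f \<in> homogeneous_part j \<longleftrightarrow> hpart pdeg j f = f"
  by (auto simp: homogeneous_part_def hpart_eq_self_iff)

lemma hpart_mem_homogeneous_part: "hpart pdeg j f \<in> homogeneous_part j"
  by (auto simp: homogeneous_part_def keys_hpart)

text \<open>Closure under homogeneous parts, rather than homogeneous generation: this form passes
  directly to intersections, colon ideals by monomials and \<open>add_multiples\<close>.\<close>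

definition graded_ideal :: "('n::{finite,linorder}, 'k::field) mpoly set \<Rightarrow> bool" where
  "graded_ideal N \<longleftrightarrow> is_ideal N \<and> (\<forall>f\<in>N. \<forall>j. hpart pdeg j f \<in> N)"

lemma graded_is_ideal: "graded_ideal N \<Longrightarrow> is_ideal N"
  and graded_hpart: "graded_ideal N \<Longrightarrow> f \<in> N \<Longrightarrow> hpart pdeg j f \<in> N"
  by (auto simp: graded_ideal_def)

lemma mon_add: "mon (a + b) = (mon a * mon b :: ('n::{finite,linorder}, 'k::field) mpoly)"
  by (simp add: mon_def mult_single)

lemma mon_0: "mon 0 = (1 :: ('n::{finite,linorder}, 'k::field) mpoly)"
  by (simp add: mon_def)

lemma hpart_mon_mult: "hpart pdeg j (mon a * f) = mon a * hpart pdeg (j - pdeg a) f"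
  unfolding mon_def by (rule hpart_single_mult) (simp add: mdeg_add)

lemma hpart_const_mult: "hpart pdeg j (const c * f) = const c * hpart pdeg j f"
proof -
  have "mdeg (0 :: 'a \<Rightarrow>\<^sub>0 nat) = 0" by (simp add: mdeg_def)
  then show ?thesis
    unfolding const_def using hpart_single_mult[of pdeg j 0 c f] by (simp add: mdeg_add)
qed

lemma hpart_var_mult: "hpart pdeg j (var v * f) = var v * hpart pdeg (j - 1) f"
  unfolding var_def by (simp add: hpart_mon_mult mdeg_single)

lemma hpart_diff: "hpart dg j (f - g) = hpart dg j f - hpart dg j (g :: 'a \<Rightarrow>\<^sub>0 'b::ab_group_add)"
  by (rule poly_mapping_eqI) (auto simp: lookup_hpart lookup_minus when_def)

lemma graded_ideal_Int: "graded_ideal N \<Longrightarrow> graded_ideal N' \<Longrightarrow> graded_ideal (N \<inter> N')"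
  by (auto simp: graded_ideal_def ideal_Int)

lemma graded_ideal_quot_mon:
  assumes "graded_ideal N" shows "graded_ideal (ideal_quot N (mon a))"
proof -
  have "mon a * hpart pdeg j f \<in> N" if "mon a * f \<in> N" for f j
    using assms graded_hpart[OF _ that, of "j + pdeg a"] by (simp add: hpart_mon_mult)
  then show ?thesis using assms ideal_ideal_quot by (auto simp: graded_ideal_def ideal_quot_def)
qed

lemma graded_add_multiples:
  assumes "graded_ideal N" "graded_ideal M"
  shows "graded_ideal (add_multiples N (var v) M)"
proof -
  have "hpart pdeg j (x + var v * y) \<in> add_multiples N (var v) M" if "x \<in> N" "y \<in> M" for x y j
    using that assms graded_hpart unfolding hpart_add hpart_var_mult add_multiples_def by blast
  then show ?thesis
    using assms ideal_add_multiples by (auto simp: graded_ideal_def) (auto simp: add_multiples_def)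
qed

lemma graded_ideal_UNIV: "graded_ideal UNIV" by (simp add: graded_ideal_def ideal_UNIV)

section \<open>Laurent polynomials\<close>

type_synonym ('n, 'k) laurent = "('n \<Rightarrow>\<^sub>0 int) \<Rightarrow>\<^sub>0 'k"

definition int_exp :: "('n \<Rightarrow>\<^sub>0 nat) \<Rightarrow> ('n \<Rightarrow>\<^sub>0 int)" where
  "int_exp a = Poly_Mapping.map int a"

lemma lookup_int_exp: "Poly_Mapping.lookup (int_exp a) v = int (Poly_Mapping.lookup a v)"
  by (simp add: int_exp_def map.rep_eq when_def)

lemma int_exp_add: "int_exp (a + b) = int_exp a + int_exp b"
  by (rule poly_mapping_eqI) (simp add: lookup_int_exp lookup_add)

lemma int_exp_0 [simp]: "int_exp 0 = 0"
  by (rule poly_mapping_eqI) (simp add: lookup_int_exp)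

lemma int_exp_inject: "int_exp a = int_exp b \<longleftrightarrow> a = b"
  by (metis lookup_int_exp of_nat_eq_iff poly_mapping_eqI)

definition ldeg :: "('n::finite \<Rightarrow>\<^sub>0 int) \<Rightarrow> int" where
  "ldeg a = (\<Sum>v\<in>UNIV. Poly_Mapping.lookup a v)"

lemma ldeg_add: "ldeg (a + b) = ldeg a + ldeg b"
  by (simp add: ldeg_def lookup_add sum.distrib)

lemma ldeg_uminus: "ldeg (- a) = - ldeg a"
  by (simp add: ldeg_def sum_negf)

lemma ldeg_int_exp: "ldeg (int_exp a) = pdeg a"
  by (simp add: ldeg_def mdeg_def lookup_int_exp)

definition laurent_of :: "('n::{finite,linorder}, 'k::field) mpoly \<Rightarrow> ('n, 'k) laurent" where
  "laurent_of r = (\<Sum>a\<in>Poly_Mapping.keys r. Poly_Mapping.single (int_exp a) (Poly_Mapping.lookup r a))"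

lemma laurent_of_superset:
  assumes "finite A" "Poly_Mapping.keys r \<subseteq> A"
  shows "laurent_of r = (\<Sum>a\<in>A. Poly_Mapping.single (int_exp a) (Poly_Mapping.lookup r a))"
  unfolding laurent_of_def
  by (rule sum.mono_neutral_left) (use assms in \<open>auto simp: in_keys_iff\<close>)

lemma laurent_of_add: "laurent_of (f + g) = laurent_of f + laurent_of g"
proof -
  let ?A = "Poly_Mapping.keys f \<union> Poly_Mapping.keys g"
  have "Poly_Mapping.keys (f + g) \<subseteq> ?A" by (rule Poly_Mapping.keys_add)
  then show ?thesis
    by (simp add: laurent_of_superset[of ?A] lookup_add single_add sum.distrib)
qed

lemma laurent_of_single: "laurent_of (Poly_Mapping.single a c) = Poly_Mapping.single (int_exp a) c"
  by (subst laurent_of_superset[of "{a}"]) auto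

lemma laurent_of_0 [simp]: "laurent_of 0 = 0" by (simp add: laurent_of_def)

lemma laurent_of_1 [simp]: "laurent_of 1 = 1"
  using laurent_of_single[of 0 1] by simp

lemma laurent_of_mult: "laurent_of (f * g) = laurent_of f * laurent_of g"
proof (induction f rule: poly_mapping_single_induct)
  case (single a c)
  show ?case
    by (induction g rule: poly_mapping_single_induct)
      (auto simp: laurent_of_single laurent_of_add mult_single int_exp_add distrib_left)
qed (auto simp: laurent_of_add distrib_right)

lemma laurent_of_uminus: "laurent_of (- f) = - laurent_of f"
  using laurent_of_add[of f "- f"] by (simp add: eq_neg_iff_add_eq_0 add.commute)

lemma laurent_of_diff: "laurent_of (f - g) = laurent_of f - laurent_of g"
  using laurent_of_add[of f "- g"] by (simp add: laurent_of_uminus)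

lemma laurent_of_power: "laurent_of (f ^ k) = laurent_of f ^ k"
  by (induction k) (auto simp: laurent_of_mult)

lemma laurent_of_inject: "laurent_of f = laurent_of g \<longleftrightarrow> f = g"
proof
  have lk: "Poly_Mapping.lookup (laurent_of f) (int_exp a) = Poly_Mapping.lookup f a" for f :: "('a::{finite,linorder}, 'b::field) mpoly" and a
    by (simp add: laurent_of_def lookup_sum lookup_single when_def int_exp_inject in_keys_iff)
  show "f = g" if "laurent_of f = laurent_of g"
    using that lk by (metis poly_mapping_eqI)
qed simp

lemma laurent_of_hpart: "laurent_of (hpart pdeg j f) = hpart ldeg j (laurent_of f)"
  by (induction f rule: poly_mapping_single_induct)
    (auto simp: laurent_of_add laurent_of_single hpart_single ldeg_int_exp hpart_add)

definition lmon :: "('n::{finite,linorder} \<Rightarrow>\<^sub>0 int) \<Rightarrow> ('n, 'k::field) laurent" where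
  "lmon a = Poly_Mapping.single a 1"

lemma lmon_add: "lmon (a + b) = lmon a * lmon b"
  by (simp add: lmon_def mult_single)

lemma lmon_0 [simp]: "lmon 0 = 1" by (simp add: lmon_def)

lemma lmon_cancel: "lmon (- a) * (lmon a * f) = f" "lmon a * (lmon (- a) * f) = f"
  by (simp_all add: mult.assoc[symmetric] lmon_add[symmetric])

lemma laurent_of_mon: "laurent_of (mon a) = lmon (int_exp a)"
  by (simp add: mon_def lmon_def laurent_of_single)

lemma hpart_lmon_mult: "hpart ldeg j (lmon a * f) = lmon a * hpart ldeg (j - ldeg a) f"
  unfolding lmon_def by (rule hpart_single_mult) (simp add: ldeg_add)

definition lfrac :: "('n::{finite,linorder}, 'k::field) mpoly \<Rightarrow> ('n \<Rightarrow>\<^sub>0 nat) \<Rightarrow> ('n, 'k) laurent" where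
  "lfrac r a = lmon (- int_exp a) * laurent_of r"

lemma lmon_mult_lfrac: "lmon (int_exp a) * lfrac r a = laurent_of r"
  by (simp add: lfrac_def lmon_cancel)

lemma lfrac_eq_iff: "lfrac r a = lfrac r' a' \<longleftrightarrow> mon a' * r = mon a * r'"
proof -
  have "lfrac r a = lfrac r' a' \<longleftrightarrow>
      lmon (int_exp a + int_exp a') * lfrac r a = lmon (int_exp a + int_exp a') * lfrac r' a'"
    by (metis lmon_cancel(1))
  also have "lmon (int_exp a + int_exp a') * lfrac r a = laurent_of (mon a' * r)"
    by (simp add: lmon_add laurent_of_mult laurent_of_mon lmon_mult_lfrac mult.assoc mult.left_commute)
  also have "lmon (int_exp a + int_exp a') * lfrac r' a' = laurent_of (mon a * r')"
    by (simp add: lmon_add laurent_of_mult laurent_of_mon lmon_mult_lfrac mult.assoc)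
  finally show ?thesis by (simp add: laurent_of_inject)
qed

lemma lfrac_expand: "lfrac (mon b * r) (b + a) = lfrac r a"
  by (simp add: lfrac_eq_iff mon_add mult.assoc mult.left_commute)

lemma lfrac_add_same: "lfrac (r + r') a = lfrac r a + lfrac r' a"
  by (simp add: lfrac_def laurent_of_add distrib_left)

lemma lfrac_diff_same: "lfrac (r - r') a = lfrac r a - lfrac r' a"
  by (simp add: lfrac_def laurent_of_diff right_diff_distrib)

lemma lfrac_add: "lfrac r a + lfrac r' a' = lfrac (mon a' * r + mon a * r') (a + a')"
  using lfrac_expand[of a' r a] lfrac_expand[of a r' a'] by (simp add: lfrac_add_same add.commute)

lemma lfrac_diff: "lfrac r a - lfrac r' a' = lfrac (mon a' * r - mon a * r') (a + a')"
  using lfrac_expand[of a' r a] lfrac_expand[of a r' a'] by (simp add: lfrac_diff_same add.commute)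

lemma laurent_of_mult_lfrac: "laurent_of s * lfrac r a = lfrac (s * r) a"
  by (simp add: lfrac_def laurent_of_mult mult.left_commute)

lemma lfrac_0_right: "lfrac r 0 = laurent_of r" by (simp add: lfrac_def)

lemma lfrac_0_left: "lfrac 0 a = 0" by (simp add: lfrac_def)

definition loc_ideal :: "('n::{finite,linorder}, 'k::field) mpoly set \<Rightarrow> 'n set \<Rightarrow> ('n, 'k) laurent set" where
  "loc_ideal N S = {lfrac r a |r a. r \<in> N \<and> Poly_Mapping.keys a \<subseteq> S}"

lemma lfrac_mem_loc_ideal: "r \<in> N \<Longrightarrow> Poly_Mapping.keys a \<subseteq> S \<Longrightarrow> lfrac r a \<in> loc_ideal N S"
  by (auto simp: loc_ideal_def)

lemma loc_ideal_mono: "N \<subseteq> N' \<Longrightarrow> S \<subseteq> S' \<Longrightarrow> loc_ideal N S \<subseteq> loc_ideal N' S'"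
  unfolding loc_ideal_def by blast

lemma loc_ideal_0: "is_ideal N \<Longrightarrow> 0 \<in> loc_ideal N S"
  using lfrac_mem_loc_ideal[of 0 N 0 S] by (simp add: ideal_0 lfrac_0_left)

lemma keys_add_subset: "Poly_Mapping.keys a \<subseteq> S \<Longrightarrow> Poly_Mapping.keys b \<subseteq> S \<Longrightarrow> Poly_Mapping.keys (a + b) \<subseteq> S"
  by (rule order_trans[OF Poly_Mapping.keys_add]) simp

lemma loc_ideal_add:
  assumes "is_ideal N" "x \<in> loc_ideal N S" "y \<in> loc_ideal N S"
  shows "x + y \<in> loc_ideal N S"
  using assms by (auto simp: loc_ideal_def lfrac_add) (metis ideal_add ideal_mult keys_add_subset)

lemma loc_ideal_mult:
  assumes "is_ideal N" "x \<in> loc_ideal N S"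
  shows "laurent_of r * x \<in> loc_ideal N S"
  using assms by (auto simp: loc_ideal_def laurent_of_mult_lfrac) (metis ideal_mult)

lemma loc_ideal_lmon_uminus:
  assumes "x \<in> loc_ideal N S" "Poly_Mapping.keys b \<subseteq> S"
  shows "lmon (- int_exp b) * x \<in> loc_ideal N S"
proof -
  obtain r a where x: "x = lfrac r a" "r \<in> N" "Poly_Mapping.keys a \<subseteq> S" using assms by (auto simp: loc_ideal_def)
  have "lmon (- int_exp b) * x = lfrac r (b + a)"
    using x by (simp add: lfrac_def int_exp_add lmon_add[symmetric] mult.assoc[symmetric])
  then show ?thesis using x assms lfrac_mem_loc_ideal keys_add_subset by metis
qed

lemma loc_ideal_hpart:
  assumes "graded_ideal N" "x \<in> loc_ideal N S"
  shows "hpart ldeg j x \<in> loc_ideal N S"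
proof -
  obtain r a where x: "x = lfrac r a" "r \<in> N" "Poly_Mapping.keys a \<subseteq> S" using assms by (auto simp: loc_ideal_def)
  have "hpart ldeg j x = lfrac (hpart pdeg (j + pdeg a) r) a"
    by (simp add: x lfrac_def hpart_lmon_mult laurent_of_hpart ldeg_uminus ldeg_int_exp)
  then show ?thesis using x assms lfrac_mem_loc_ideal graded_hpart by metis
qed

text \<open>Equality of fractions in the Laurent ring needs no auxiliary factor, but membership in a
  localised ideal holds as soon as a monomial in \<open>S\<close> moves the numerator into
  \<open>N\<close>. This \<open>b\<close> is the one in \<open>loc_rel\<close>.\<close>

lemma lfrac_mem_loc_ideal_iff:
  assumes "is_ideal N" "Poly_Mapping.keys a \<subseteq> S"
  shows "lfrac r a \<in> loc_ideal N S \<longleftrightarrow> (\<exists>b. Poly_Mapping.keys b \<subseteq> S \<and> mon b * r \<in> N)"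
proof
  assume "lfrac r a \<in> loc_ideal N S"
  then obtain r' a' where "lfrac r a = lfrac r' a'" "r' \<in> N" "Poly_Mapping.keys a' \<subseteq> S" by (auto simp: loc_ideal_def)
  then show "\<exists>b. Poly_Mapping.keys b \<subseteq> S \<and> mon b * r \<in> N" using assms ideal_mult lfrac_eq_iff by metis
next
  assume "\<exists>b. Poly_Mapping.keys b \<subseteq> S \<and> mon b * r \<in> N"
  then obtain b where b: "Poly_Mapping.keys b \<subseteq> S" "mon b * r \<in> N" by blast
  then have "lfrac (mon b * r) (b + a) \<in> loc_ideal N S"
    using assms keys_add_subset lfrac_mem_loc_ideal by metis
  then show "lfrac r a \<in> loc_ideal N S" by (simp add: lfrac_expand)
qed

section \<open>The Cech complex of a pair of ideals\<close>

type_synonym ('n, 'k) cochains = "'n set \<Rightarrow> ('n, 'k) laurent"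

definition esign :: "'n::{finite,linorder} \<Rightarrow> 'n set \<Rightarrow> 'a::comm_ring_1" where
  "esign v T = (- 1) ^ card {u \<in> T. u < v}"

text \<open>Cochains are families over all subsets of the variables, so one map serves every
  cohomological degree; \<open>cech_ideal\<close> imposes the degree as a condition on the
  support.\<close>

definition cdiff :: "('n::{finite,linorder}, 'k::field) cochains \<Rightarrow> ('n, 'k) cochains" where
  "cdiff c = (\<lambda>T. \<Sum>v\<in>T. esign v T * c (T - {v}))"

definition act :: "('n::{finite,linorder}, 'k::field) mpoly \<Rightarrow> ('n, 'k) cochains \<Rightarrow> ('n, 'k) cochains" where
  "act r c = (\<lambda>S. laurent_of r * c S)"

text \<open>A contraction of the complex in which every component is the full Laurent ring. It does
  not respect the localisations, since the component at \<open>insert v S\<close> may have x_v in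
  the denominator; multiplication by a power of x_v repairs this, which makes cohomology
  x_v-torsion.\<close>

definition homotopy :: "'n::{finite,linorder} \<Rightarrow> ('n, 'k::field) cochains \<Rightarrow> ('n, 'k) cochains" where
  "homotopy v c = (\<lambda>S. if v \<in> S then 0 else esign v S * c (insert v S))"

lemma esign_insert:
  assumes "w \<notin> T"
  shows "esign v (insert w T) = (if w < v then - esign v T else esign v T)"
proof -
  have "{u \<in> insert w T. u < v} = (if w < v then insert w {u \<in> T. u < v} else {u \<in> T. u < v})" by auto
  then show ?thesis using assms by (simp add: esign_def)
qed

lemma esign_square: "esign v T * (esign v T * x) = x"
  by (simp add: esign_def mult.assoc[symmetric] flip: power_add)

lemma laurent_of_esign:
  "esign v T = laurent_of (esign v T :: ('n::{finite,linorder}, 'k::field) mpoly)"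
proof -
  have "laurent_of ((- 1 :: ('n, 'k) mpoly) ^ k) = (- 1) ^ k" for k by (simp add: laurent_of_power laurent_of_uminus)
  then show ?thesis by (simp add: esign_def)
qed

text \<open>In characteristic 2 a sum equal to its own negative need not vanish; the induction
  instead cancels the row of the new element against its column.\<close>

lemma antisymmetric_sum_0:
  fixes F :: "'a \<Rightarrow> 'a \<Rightarrow> 'b::ab_group_add"
  assumes "finite T" "\<And>v w. v \<in> T \<Longrightarrow> w \<in> T \<Longrightarrow> v \<noteq> w \<Longrightarrow> F v w = - F w v"
  shows "(\<Sum>v\<in>T. \<Sum>w\<in>T - {v}. F v w) = 0"
  using assms
proof (induction T rule: finite_induct)
  case (insert x T)
  have 1: "insert x T - {x} = T" using insert(2) by simp
  have "(\<Sum>w\<in>insert x T - {v}. F v w) = F v x + (\<Sum>w\<in>T - {v}. F v w)" if "v \<in> T" for v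
  proof -
    have "insert x T - {v} = insert x (T - {v})" using insert(2) that by auto
    then show ?thesis using insert(1,2) by simp
  qed
  then have "(\<Sum>v\<in>insert x T. \<Sum>w\<in>insert x T - {v}. F v w) =
      (\<Sum>w\<in>T. F x w) + ((\<Sum>v\<in>T. F v x) + (\<Sum>v\<in>T. \<Sum>w\<in>T - {v}. F v w))"
    using insert(1,2) 1 by (simp add: sum.distrib)
  also have "(\<Sum>v\<in>T. \<Sum>w\<in>T - {v}. F v w) = 0" by (rule insert.IH) (rule insert.prems; simp)
  also have "(\<Sum>w\<in>T. F x w) = (\<Sum>w\<in>T. - F w x)"
  proof (intro sum.cong refl)
    fix w assume "w \<in> T"
    then have "x \<noteq> w" using insert(2) by blast
    then show "F x w = - F w x" using insert.prems[of x w] \<open>w \<in> T\<close> by blast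
  qed
  finally show ?case by (simp add: sum_negf)
qed simp

lemma cdiff_cdiff: "cdiff (cdiff c) = 0"
proof
  fix T :: "'a set"
  define F where "F v w = esign v T * (esign w (T - {v}) * c (T - {v} - {w}))" for v w
  have anti: "F v w = - F w v" if "v \<in> T" "w \<in> T" "v \<noteq> w" for v w
  proof -
    define U where "U = T - {v} - {w}"
    have T: "T = insert v (insert w U)" "T - {v} = insert w U" "T - {w} = insert v U" "T - {w} - {v} = U"
      "v \<notin> insert w U" "w \<notin> U" "v \<notin> U" "w \<notin> insert v U"
      using that by (auto simp: U_def)
    have e1: "esign v T = (if w < v then - esign v U else esign v U :: ('a, 'b) laurent)"
      unfolding T(1) using T(5,6) by (simp add: esign_insert)
    have T': "T = insert w (insert v U)" using T(1) by blast
    have e2: "esign w T = (if v < w then - esign w U else esign w U :: ('a, 'b) laurent)"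
      unfolding T' using T(7,8) by (simp add: esign_insert)
    have e3: "esign w (T - {v}) = (esign w U :: ('a, 'b) laurent)"
      "esign v (T - {w}) = (esign v U :: ('a, 'b) laurent)"
      unfolding T(2,3) using T(6,7) by (simp_all add: esign_insert)
    have "w < v \<longleftrightarrow> \<not> v < w" using that(3) by auto
    then show ?thesis
      unfolding F_def T(4) U_def[symmetric] e1 e2 e3 by (simp add: mult.left_commute)
  qed
  have "(\<Sum>v\<in>T. \<Sum>w\<in>T - {v}. F v w) = 0" by (rule antisymmetric_sum_0[OF finite anti])
  then show "cdiff (cdiff c) T = 0 T" by (simp add: cdiff_def F_def sum_distrib_left)
qed

lemma homotopy_identity: "cdiff (homotopy v c) + homotopy v (cdiff c) = c"
proof
  fix T :: "'a set"
  show "(cdiff (homotopy v c) + homotopy v (cdiff c)) T = c T"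
  proof (cases "v \<in> T")
    case True
    have "cdiff (homotopy v c) T = (\<Sum>w\<in>T. if w = v then c T else 0)"
      unfolding cdiff_def
    proof (intro sum.cong refl)
      fix w assume "w \<in> T"
      show "esign w T * homotopy v c (T - {w}) = (if w = v then c T else 0)"
      proof (cases "w = v")
        case True
        have "esign v T = (esign v (T - {v}) :: ('a, 'b) laurent)"
          using esign_insert[of v "T - {v}" v] \<open>v \<in> T\<close> by (simp add: insert_absorb)
        then show ?thesis using True \<open>v \<in> T\<close> by (simp add: homotopy_def insert_absorb esign_square)
      qed (use \<open>v \<in> T\<close> in \<open>simp add: homotopy_def\<close>)
    qed
    then show ?thesis using True by (simp add: homotopy_def)
  next
    case False
    \<comment> \<open>Inserting \<open>v\<close> flips the sign of \<open>w\<close> if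
      \<open>v < w\<close>, removing \<open>w\<close> flips that of \<open>v\<close> if
      \<open>w < v\<close>; exactly one of the two happens. What survives is the term that inserts
      and then removes \<open>v\<close>.\<close>
    have cancel: "esign w T * (esign v (T - {w}) * c (insert v (T - {w}))) +
       esign v T * (esign w (insert v T) * c (insert v T - {w})) = 0" if "w \<in> T" for w
    proof -
      define U where "U = T - {w}"
      have T: "T = insert w U" "w \<notin> U" "v \<notin> U" "v \<noteq> w" using that False by (auto simp: U_def)
      have "insert v T - {w} = insert v U" using T by auto
      moreover have "esign w T = (esign w U :: ('a, 'b) laurent)"
        "esign v T = (if w < v then - esign v U else esign v U :: ('a, 'b) laurent)"
        unfolding T(1) using T(2) by (simp_all add: esign_insert)
      moreover have "esign w (insert v T) = (if v < w then - esign w T else esign w T :: ('a, 'b) laurent)"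
        using esign_insert[OF False, of w] by simp
      moreover have "w < v \<longleftrightarrow> \<not> v < w" using T(4) by auto
      ultimately show ?thesis unfolding U_def[symmetric] by (simp add: mult.left_commute)
    qed
    have "cdiff (homotopy v c) T = (\<Sum>w\<in>T. esign w T * (esign v (T - {w}) * c (insert v (T - {w}))))"
      using False by (simp add: cdiff_def homotopy_def)
    moreover have "homotopy v (cdiff c) T = c T + (\<Sum>w\<in>T. esign v T * (esign w (insert v T) * c (insert v T - {w})))"
    proof -
      have "insert v T - {v} = T" using False by auto
      then show ?thesis
        using False by (simp add: homotopy_def cdiff_def esign_insert distrib_left sum_distrib_left esign_square)
    qed
    ultimately have "(cdiff (homotopy v c) + homotopy v (cdiff c)) T = c T +
      (\<Sum>w\<in>T. esign w T * (esign v (T - {w}) * c (insert v (T - {w}))) + esign v T * (esign w (insert v T) * c (insert v T - {w})))"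
      by (simp add: sum.distrib)
    also have "\<dots> = c T" using cancel by simp
    finally show ?thesis .
  qed
qed

lemma cdiff_add: "cdiff (c + c') = cdiff c + cdiff c'"
  by (rule ext) (simp add: cdiff_def distrib_left sum.distrib)

lemma act_cdiff: "act r (cdiff c) = cdiff (act r c)"
  by (rule ext) (simp add: act_def cdiff_def sum_distrib_left mult.left_commute)

lemma act_add: "act r (c + c') = act r c + act r c'"
  by (rule ext) (simp add: act_def distrib_left)

lemma act_add_left: "act (r + s) c = act r c + act s c"
  by (rule ext) (simp add: act_def laurent_of_add distrib_right)

lemma act_act: "act r (act s c) = act (r * s) c"
  by (rule ext) (simp add: act_def laurent_of_mult mult.assoc)

lemma act_1 [simp]: "act 1 c = c" by (simp add: act_def)

lemma act_0_left [simp]: "act 0 c = 0" by (simp add: act_def fun_eq_iff)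

lemma const_add: "const (a + b) = const a + const b" by (simp add: const_def single_add)

lemma const_mult: "const (a * b) = const a * const b" by (simp add: const_def mult_single)

lemma const_1 [simp]: "const 1 = 1" by (simp add: const_def)

lemma vector_space_mpoly: "vector_space (\<lambda>c f. const c * f)"
  by unfold_locales (auto simp: const_add const_mult algebra_simps)

interpretation R: vector_space "\<lambda>c f. const c * f" by (rule vector_space_mpoly)

interpretation V: cochain "\<lambda>c. act (const c)" cdiff
  by unfold_locales
    (auto simp: act_add act_add_left act_act const_add const_mult cdiff_add act_cdiff cdiff_cdiff)

text \<open>The degree is an integer, so that degree \<open>- 1\<close> exists and is zero;
  \<open>cocyc\<close> and \<open>cobd\<close> then need no separate clause at 0.\<close>

definition cech_ideal :: "('n::{finite,linorder}, 'k::field) mpoly set \<Rightarrow> int \<Rightarrow> ('n, 'k) cochains set" where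
  "cech_ideal N p = {c. \<forall>S. c S \<in> loc_ideal N S \<and> (c S \<noteq> 0 \<longrightarrow> int (card S) = p)}"

abbreviation acyclic_at :: "('n::{finite,linorder}, 'k::field) mpoly set \<Rightarrow> ('n, 'k) mpoly set \<Rightarrow> int \<Rightarrow> bool" where
  "acyclic_at N1 N2 p \<equiv> V.cocyc (cech_ideal N1) (cech_ideal N2) p \<subseteq> V.cobd (cech_ideal N1) (cech_ideal N2) p"

definition hpart_cochain :: "int \<Rightarrow> ('n::{finite,linorder}, 'k::field) cochains \<Rightarrow> ('n, 'k) cochains" where
  "hpart_cochain j c = (\<lambda>S. hpart ldeg j (c S))"

definition cech_graded :: "int \<Rightarrow> ('n::{finite,linorder}, 'k::field) mpoly set \<Rightarrow> int \<Rightarrow> ('n, 'k) cochains set" where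
  "cech_graded j N p = {c \<in> cech_ideal N p. hpart_cochain j c = c}"

lemma cech_ideal_mono: "N \<subseteq> N' \<Longrightarrow> cech_ideal N p \<subseteq> cech_ideal N' p"
  using loc_ideal_mono[of N N'] by (fastforce simp: cech_ideal_def)

lemma cech_graded_mono: "N \<subseteq> N' \<Longrightarrow> cech_graded j N p \<subseteq> cech_graded j N' p"
  using cech_ideal_mono[of N N' p] by (auto simp: cech_graded_def)

lemma cech_ideal_0: "is_ideal N \<Longrightarrow> 0 \<in> cech_ideal N p"
  by (simp add: cech_ideal_def loc_ideal_0)

lemma cech_ideal_add:
  assumes "is_ideal N" "c \<in> cech_ideal N p" "c' \<in> cech_ideal N p"
  shows "c + c' \<in> cech_ideal N p"
proof -
  have "(c + c') S \<in> loc_ideal N S" for S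
    using assms by (auto simp: cech_ideal_def intro: loc_ideal_add)
  moreover have "int (card S) = p" if "(c + c') S \<noteq> 0" for S
  proof -
    have "c S \<noteq> 0 \<or> c' S \<noteq> 0" using that by auto
    then show ?thesis using assms by (auto simp: cech_ideal_def)
  qed
  ultimately show ?thesis by (auto simp: cech_ideal_def)
qed

lemma cech_ideal_act: "is_ideal N \<Longrightarrow> c \<in> cech_ideal N p \<Longrightarrow> act r c \<in> cech_ideal N p"
  by (auto simp: cech_ideal_def act_def loc_ideal_mult)

lemma cech_ideal_cdiff:
  assumes "is_ideal N" "c \<in> cech_ideal N p"
  shows "cdiff c \<in> cech_ideal N (p + 1)"
proof -
  have cl: "c S \<in> loc_ideal N S" and cp: "c S \<noteq> 0 \<Longrightarrow> int (card S) = p" for S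
    using assms by (auto simp: cech_ideal_def)
  have "cdiff c T \<in> loc_ideal N T" for T
  proof -
    have "esign v T * c (T - {v}) \<in> loc_ideal N T" for v
      using loc_ideal_mult[OF assms(1)] cl[of "T - {v}"] loc_ideal_mono[of N N "T - {v}" T]
      by (subst laurent_of_esign) blast
    then have "(\<Sum>v\<in>A. esign v T * c (T - {v})) \<in> loc_ideal N T" for A
      by (induction A rule: infinite_finite_induct) (auto simp: loc_ideal_0 loc_ideal_add assms(1))
    then show ?thesis by (simp add: cdiff_def)
  qed
  moreover have "int (card T) = p + 1" if "cdiff c T \<noteq> 0" for T
  proof -
    have "\<exists>v\<in>T. c (T - {v}) \<noteq> 0"
    proof (rule ccontr)
      assume "\<not> (\<exists>v\<in>T. c (T - {v}) \<noteq> 0)"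
      then show False using that by (simp add: cdiff_def)
    qed
    then obtain v where v: "v \<in> T" "c (T - {v}) \<noteq> 0" by blast
    have "card T = card (T - {v}) + 1" using card.remove[of T v] v(1) by simp
    then show ?thesis using cp[OF v(2)] by linarith
  qed
  ultimately show ?thesis by (auto simp: cech_ideal_def)
qed

lemma hpart_cochain_add: "hpart_cochain j (c + c') = hpart_cochain j c + hpart_cochain j c'"
  by (rule ext) (simp add: hpart_cochain_def hpart_add)

lemma hpart_cochain_0 [simp]: "hpart_cochain j 0 = 0"
  by (rule ext) (simp add: hpart_cochain_def)

lemma hpart_ldeg_single0_mult:
  fixes f :: "('n::{finite,linorder}, 'k::field) laurent"
  shows "hpart ldeg j (Poly_Mapping.single 0 c * f) = Poly_Mapping.single 0 c * hpart ldeg j f"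
  using hpart_single_mult[of ldeg j 0 c f] by (simp add: ldeg_add) (simp add: ldeg_def)

lemma hpart_cochain_act_const: "hpart_cochain j (act (const k) c) = act (const k) (hpart_cochain j c)"
  by (rule ext) (simp add: hpart_cochain_def act_def const_def laurent_of_single hpart_ldeg_single0_mult)

lemma hpart_cochain_act_var: "hpart_cochain j (act (var v) c) = act (var v) (hpart_cochain (j - 1) c)"
  by (rule ext) (simp add: hpart_cochain_def act_def var_def laurent_of_mon hpart_lmon_mult ldeg_int_exp mdeg_single)

lemma hpart_esign_mult: "hpart ldeg j (esign v T * f) = esign v T * hpart ldeg j f"
proof -
  have "hpart ldeg j ((- 1) ^ k * f) = (- 1) ^ k * hpart ldeg j f" for k
  proof (induction k)
    case (Suc k)
    have "hpart ldeg j (- g) = - hpart ldeg j g" for g :: "('a, 'b) laurent"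
      using hpart_diff[of ldeg j 0 g] by simp
    then show ?case using Suc by simp
  qed simp
  then show ?thesis by (simp add: esign_def)
qed

lemma hpart_cochain_cdiff: "hpart_cochain j (cdiff c) = cdiff (hpart_cochain j c)"
  by (rule ext) (simp add: hpart_cochain_def cdiff_def hpart_sum hpart_esign_mult)

lemma hpart_cochain_mem:
  assumes "graded_ideal N" "c \<in> cech_ideal N p"
  shows "hpart_cochain j c \<in> cech_graded j N p"
proof -
  have "hpart_cochain j c \<in> cech_ideal N p"
    using assms by (auto simp: cech_ideal_def hpart_cochain_def intro: loc_ideal_hpart) (metis hpart_0)
  moreover have "hpart_cochain j (hpart_cochain j c) = hpart_cochain j c"
    by (rule ext) (simp add: hpart_cochain_def hpart_hpart)
  ultimately show ?thesis by (simp add: cech_graded_def)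
qed

lemma subcomplex_cech_ideal: "is_ideal N \<Longrightarrow> V.subcomplex (cech_ideal N)"
  unfolding V.subcomplex_def V.subspace_def
  by (auto simp: cech_ideal_0 cech_ideal_add cech_ideal_act cech_ideal_cdiff)

lemma subcomplex_cech_graded: "is_ideal N \<Longrightarrow> V.subcomplex (cech_graded j N)"
  unfolding V.subcomplex_def V.subspace_def cech_graded_def
  by (auto simp: cech_ideal_0 cech_ideal_add cech_ideal_act cech_ideal_cdiff
      hpart_cochain_add hpart_cochain_act_const hpart_cochain_cdiff)

lemma cech_ideal_out_of_range:
  assumes "is_ideal N" "p < 0 \<or> p > int (card (UNIV :: 'n set))"
  shows "cech_ideal (N :: ('n::{finite,linorder}, 'k::field) mpoly set) p = {0}"
proof -
  have "c = 0" if "c \<in> cech_ideal N p" for c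
  proof
    fix S show "c S = 0 S"
      using that assms(2) card_mono[of UNIV S] by (fastforce simp: cech_ideal_def)
  qed
  then show ?thesis using cech_ideal_0[OF assms(1)] by blast
qed

lemma cech_graded_out_of_range:
  assumes "is_ideal N" "p < 0 \<or> p > int (card (UNIV :: 'n set))"
  shows "cech_graded j (N :: ('n::{finite,linorder}, 'k::field) mpoly set) p = {0}"
proof -
  have eq: "cech_ideal N p = {0}" by (rule cech_ideal_out_of_range[OF assms])
  have "0 \<in> cech_graded j N p" using cech_ideal_0[OF assms(1)] by (simp add: cech_graded_def)
  moreover have "cech_graded j N p \<subseteq> {0}" unfolding eq[symmetric] cech_graded_def by blast
  ultimately show ?thesis by blast
qed

text \<open>Localisation commutes with the sum N + rM: a common denominator serves both summands.
  This supplies the hypothesis on \<open>N\<close> in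
  \<open>injective_on_cohomology\<close>.\<close>

lemma cech_ideal_add_multiples:
  assumes N: "is_ideal N" "is_ideal M"
  shows "cech_ideal (add_multiples N r M) p = {w + act r u |w u. w \<in> cech_ideal N p \<and> u \<in> cech_ideal M p}"
    (is "?L = ?R")
proof (intro equalityI subsetI)
  fix c assume c: "c \<in> ?L"
  \<comment> \<open>Where \<open>c\<close> vanishes, both summands are taken to be 0, so that they
    keep the support of \<open>c\<close> and hence its degree.\<close>
  have "\<exists>w u. w \<in> loc_ideal N S \<and> u \<in> loc_ideal M S \<and> (c S = 0 \<longrightarrow> w = 0 \<and> u = 0) \<and> c S = w + laurent_of r * u" for S
  proof (cases "c S = 0")
    case True
    then show ?thesis using N loc_ideal_0 by (metis add_0 mult_zero_right)
  next
    case False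
    obtain x y a where "c S = lfrac (x + r * y) a" "x \<in> N" "y \<in> M" "Poly_Mapping.keys a \<subseteq> S"
      using c by (force simp: cech_ideal_def loc_ideal_def add_multiples_def)
    then show ?thesis using False lfrac_mem_loc_ideal
      by (metis lfrac_add_same laurent_of_mult_lfrac)
  qed
  then obtain w u where wu: "\<And>S. w S \<in> loc_ideal N S \<and> u S \<in> loc_ideal M S \<and>
      (c S = 0 \<longrightarrow> w S = 0 \<and> u S = 0) \<and> c S = w S + laurent_of r * u S"
    by metis
  have cp: "c S \<noteq> 0 \<Longrightarrow> int (card S) = p" for S using c by (simp add: cech_ideal_def)
  have "w \<in> cech_ideal N p" "u \<in> cech_ideal M p" unfolding cech_ideal_def using wu cp by blast+
  moreover have "c S = (w + act r u) S" for S using wu[of S] unfolding act_def plus_fun_def by blast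
  then have "c = w + act r u" by blast
  ultimately show "c \<in> ?R" by blast
next
  fix c assume "c \<in> ?R"
  then obtain w u where c: "c = w + act r u" "w \<in> cech_ideal N p" "u \<in> cech_ideal M p" by blast
  let ?P = "add_multiples N r M"
  have P: "is_ideal ?P" using N ideal_add_multiples by blast
  have "w \<in> ?L" using c cech_ideal_mono[OF add_multiples_superset[OF N(2)]] by blast
  moreover have "act r u \<in> ?L"
  proof -
    have "laurent_of r * x \<in> loc_ideal ?P S" if "x \<in> loc_ideal M S" for x S
      using that N add_multiples_mult[OF N(1)] unfolding loc_ideal_def
      by (auto simp: laurent_of_mult_lfrac) blast
    then show ?thesis using c(3) by (auto simp: cech_ideal_def act_def)
  qed
  ultimately show "c \<in> ?L" using c P cech_ideal_add by blast
qed

lemma cech_graded_add_multiples: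
  assumes N: "graded_ideal N" "graded_ideal M"
  shows "cech_graded j (add_multiples N (var v) M) p =
    {w + act (var v) u |w u. w \<in> cech_graded j N p \<and> u \<in> cech_graded (j - 1) M p}" (is "?L = ?R")
proof (intro equalityI subsetI)
  fix c assume c: "c \<in> ?L"
  then obtain w u where wu: "c = w + act (var v) u" "w \<in> cech_ideal N p" "u \<in> cech_ideal M p"
    using cech_ideal_add_multiples[of N M "var v" p] N graded_is_ideal by (auto simp: cech_graded_def)
  have "c = hpart_cochain j c" using c by (simp add: cech_graded_def)
  also have "\<dots> = hpart_cochain j w + act (var v) (hpart_cochain (j - 1) u)"
    by (simp add: wu(1) hpart_cochain_add hpart_cochain_act_var)
  finally show "c \<in> ?R" using hpart_cochain_mem N wu by blast
next
  fix c assume "c \<in> ?R"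
  then obtain w u where c: "c = w + act (var v) u" "w \<in> cech_graded j N p" "u \<in> cech_graded (j - 1) M p" by blast
  then have "c \<in> cech_ideal (add_multiples N (var v) M) p"
    using cech_ideal_add_multiples[of N M "var v" p] N graded_is_ideal by (auto simp: cech_graded_def)
  then show "c \<in> ?L" using c by (simp add: cech_graded_def hpart_cochain_add hpart_cochain_act_var)
qed

definition nonzerodivisor_on :: "('n::{finite,linorder}, 'k::field) mpoly \<Rightarrow> ('n, 'k) mpoly set \<Rightarrow> ('n, 'k) mpoly set \<Rightarrow> bool" where
  "nonzerodivisor_on r N1 N2 \<longleftrightarrow> (\<forall>x\<in>N1. r * x \<in> N2 \<longrightarrow> x \<in> N2)"

text \<open>Exactness of localisation, applied componentwise: the monomial that clears the product
  \<open>r * y\<close> is moved onto \<open>y\<close> before \<open>r\<close> is cancelled.\<close>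

lemma nonzerodivisor_on_cech:
  assumes "is_ideal N1" "is_ideal N2" "nonzerodivisor_on r N1 N2"
    and "c \<in> cech_ideal N1 p" "act r c \<in> cech_ideal N2 p"
  shows "c \<in> cech_ideal N2 p"
proof -
  have "x \<in> loc_ideal N2 S" if x: "x \<in> loc_ideal N1 S" "laurent_of r * x \<in> loc_ideal N2 S" for x S
  proof -
    obtain y a where y: "x = lfrac y a" "y \<in> N1" "Poly_Mapping.keys a \<subseteq> S" using x by (auto simp: loc_ideal_def)
    then obtain b where b: "Poly_Mapping.keys b \<subseteq> S" "mon b * (r * y) \<in> N2"
      using x(2) lfrac_mem_loc_ideal_iff[OF assms(2) y(3)] by (auto simp: laurent_of_mult_lfrac)
    have "mon b * y \<in> N2"
      using assms(3) b y(2) ideal_mult[OF assms(1)] unfolding nonzerodivisor_on_def by (metis mult.left_commute)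
    then show ?thesis using lfrac_mem_loc_ideal_iff[OF assms(2) y(3)] b y(1) by blast
  qed
  then show ?thesis using assms(4,5) by (auto simp: cech_ideal_def act_def)
qed

section \<open>Torsion of Cech cohomology, and its passage to homogeneous parts\<close>

lemma var_power: "var v ^ k = mon (Poly_Mapping.single v k)"
proof (induction k)
  case (Suc k)
  have "Poly_Mapping.single v (Suc k) = Poly_Mapping.single v 1 + Poly_Mapping.single v k"
    by (simp add: single_add[symmetric])
  then show ?case using Suc by (simp add: mon_add var_def)
qed (simp add: mon_0)

text \<open>The threshold is the exponent of x_v in the denominator. All larger exponents are
  included so that a common one can be chosen for finitely many components.\<close>

lemma loc_ideal_insert:
  assumes "is_ideal N" "x \<in> loc_ideal N (insert v S)"
  shows "\<exists>K. \<forall>k\<ge>K. laurent_of (var v ^ k) * x \<in> loc_ideal N S"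
proof -
  obtain r a where x: "x = lfrac r a" "r \<in> N" "Poly_Mapping.keys a \<subseteq> insert v S"
    using assms by (auto simp: loc_ideal_def)
  define m where "m = Poly_Mapping.lookup a v"
  define b where "b = Poly_Mapping.update v 0 a"
  have a: "a = Poly_Mapping.single v m + b"
    by (rule poly_mapping_eqI) (auto simp: b_def m_def lookup_add lookup_single lookup_update when_def)
  have b: "Poly_Mapping.keys b \<subseteq> S"
  proof
    fix u assume "u \<in> Poly_Mapping.keys b"
    then have "u \<noteq> v" "u \<in> Poly_Mapping.keys a"
      by (auto simp: b_def in_keys_iff lookup_update split: if_splits)
    then show "u \<in> S" using x(3) by blast
  qed
  have "laurent_of (var v ^ m) * x = lfrac r b"
    using lfrac_expand[of "Poly_Mapping.single v m" r b] x(1) a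
    by (simp add: laurent_of_mult_lfrac var_power)
  then have *: "laurent_of (var v ^ m) * x \<in> loc_ideal N S" using lfrac_mem_loc_ideal x b by metis
  have "laurent_of (var v ^ k) * x \<in> loc_ideal N S" if "k \<ge> m" for k
  proof -
    have "var v ^ k = var v ^ (k - m) * (var v ^ m :: ('a, 'b) mpoly)" using that by (simp flip: power_add)
    then show ?thesis using loc_ideal_mult[OF assms(1) *] by (simp add: laurent_of_mult mult.assoc)
  qed
  then show ?thesis by blast
qed

lemma homotopy_mem:
  assumes N: "is_ideal N" and c: "c \<in> cech_ideal N (p + 1)"
  shows "\<exists>K. \<forall>k\<ge>K. act (var v ^ k) (homotopy v c) \<in> cech_ideal N p"
proof -
  have "\<exists>K. \<forall>k\<ge>K. laurent_of (var v ^ k) * homotopy v c S \<in> loc_ideal N S" for S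
  proof (cases "v \<in> S")
    case True
    then show ?thesis using loc_ideal_0[OF N] by (auto simp: homotopy_def)
  next
    case False
    have "c (insert v S) \<in> loc_ideal N (insert v S)" using c by (simp add: cech_ideal_def)
    then have "esign v S * c (insert v S) \<in> loc_ideal N (insert v S)"
      by (subst laurent_of_esign) (rule loc_ideal_mult[OF N])
    from loc_ideal_insert[OF N this] show ?thesis using False by (simp add: homotopy_def)
  qed
  then obtain K where K: "\<And>S k. k \<ge> K S \<Longrightarrow> laurent_of (var v ^ k) * homotopy v c S \<in> loc_ideal N S" by metis
  have "act (var v ^ k) (homotopy v c) \<in> cech_ideal N p" if k: "k \<ge> Max (range K)" for k
  proof -
    have "laurent_of (var v ^ k) * homotopy v c S \<in> loc_ideal N S" for S
      using K k Max_ge[of "range K" "K S"] by force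
    moreover have "int (card S) = p" if "laurent_of (var v ^ k) * homotopy v c S \<noteq> 0" for S
    proof -
      have "v \<notin> S" "c (insert v S) \<noteq> 0" using that by (auto simp: homotopy_def split: if_splits)
      then show ?thesis using c by (fastforce simp: cech_ideal_def)
    qed
    ultimately show ?thesis by (auto simp: cech_ideal_def act_def)
  qed
  then show ?thesis by blast
qed

lemma cobd_act:
  assumes "is_ideal N1" "is_ideal N2" "z \<in> V.cobd (cech_ideal N1) (cech_ideal N2) p"
  shows "act r z \<in> V.cobd (cech_ideal N1) (cech_ideal N2) p"
  using assms unfolding V.cobd_def by (auto simp: act_add act_cdiff) (metis cech_ideal_act)

text \<open>For large \<open>k\<close>, x_v^k times the homotopy preserves the complexes of both
  \<open>N1\<close> and \<open>N2\<close>. Multiplying the homotopy identity by x_v^k therefore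
  writes x_v^k z as an element of the \<open>N2\<close> complex plus the differential of a cochain
  of \<open>N1\<close>.\<close>

lemma cohomology_var_torsion:
  assumes N: "is_ideal N1" "is_ideal N2" and z: "z \<in> V.cocyc (cech_ideal N1) (cech_ideal N2) p"
  shows "\<exists>k. act (var v ^ k) z \<in> V.cobd (cech_ideal N1) (cech_ideal N2) p"
proof -
  have z': "z \<in> cech_ideal N1 (p - 1 + 1)" "cdiff z \<in> cech_ideal N2 (p + 1)" using z by (auto simp: V.cocyc_def)
  obtain K1 where K1: "\<And>k. k \<ge> K1 \<Longrightarrow> act (var v ^ k) (homotopy v z) \<in> cech_ideal N1 (p - 1)"
    using homotopy_mem[OF N(1) z'(1)] by blast
  obtain K2 where K2: "\<And>k. k \<ge> K2 \<Longrightarrow> act (var v ^ k) (homotopy v (cdiff z)) \<in> cech_ideal N2 p"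
    using homotopy_mem[OF N(2) z'(2)] by blast
  let ?k = "max K1 K2"
  have "act (var v ^ ?k) z = act (var v ^ ?k) (homotopy v (cdiff z) + cdiff (homotopy v z))"
    using homotopy_identity[of v z] by (simp add: add.commute)
  also have "\<dots> = act (var v ^ ?k) (homotopy v (cdiff z)) + cdiff (act (var v ^ ?k) (homotopy v z))"
    by (simp add: act_add act_cdiff)
  finally show ?thesis using K1[of ?k] K2[of ?k] unfolding V.cobd_def by auto
qed

text \<open>Homogeneous parts commute with \<open>cdiff\<close>, so a primitive may be replaced by
  its part of degree \<open>j\<close>. In this way ungraded vanishing yields vanishing in every
  degree.\<close>

lemma hpart_cobd:
  assumes N: "graded_ideal N1" "graded_ideal N2" and z: "z \<in> V.cobd (cech_ideal N1) (cech_ideal N2) p"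
  shows "hpart_cochain j z \<in> V.cobd (cech_graded j N1) (cech_graded j N2) p"
proof -
  obtain w u where "z = w + cdiff u" "w \<in> cech_ideal N2 p" "u \<in> cech_ideal N1 (p - 1)"
    using z unfolding V.cobd_def by blast
  moreover from this have "hpart_cochain j z = hpart_cochain j w + cdiff (hpart_cochain j u)"
    by (simp add: hpart_cochain_add hpart_cochain_cdiff)
  ultimately show ?thesis using hpart_cochain_mem[OF N(1)] hpart_cochain_mem[OF N(2)]
    unfolding V.cobd_def by blast
qed

lemma graded_acyclic:
  assumes N: "graded_ideal N1" "graded_ideal N2"
    and van: "acyclic_at N1 N2 p"
  shows "V.cocyc (cech_graded j N1) (cech_graded j N2) p \<subseteq> V.cobd (cech_graded j N1) (cech_graded j N2) p"
proof
  fix z assume z: "z \<in> V.cocyc (cech_graded j N1) (cech_graded j N2) p"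
  then have "z \<in> V.cobd (cech_ideal N1) (cech_ideal N2) p" "hpart_cochain j z = z"
    using van by (auto simp: V.cocyc_def cech_graded_def)
  then show "z \<in> V.cobd (cech_graded j N1) (cech_graded j N2) p" using hpart_cobd[OF N] by metis
qed

section \<open>Prime ideals and dimension\<close>

definition is_prime :: "'a::comm_ring_1 set \<Rightarrow> bool" where
  "is_prime P \<longleftrightarrow> is_ideal P \<and> 1 \<notin> P \<and> (\<forall>x y. x * y \<in> P \<longrightarrow> x \<in> P \<or> y \<in> P)"

lemma prime_is_ideal: "is_prime P \<Longrightarrow> is_ideal P"
  by (simp add: is_prime_def)

lemma prime_mult_iff: "is_prime P \<Longrightarrow> x * y \<in> P \<longleftrightarrow> x \<in> P \<or> y \<in> P"
  unfolding is_prime_def using ideal_mult ideal_mult2 by blast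

lemma prime_power: "is_prime P \<Longrightarrow> x ^ k \<in> P \<Longrightarrow> x \<in> P"
  by (induction k) (auto simp: is_prime_def)

lemma prime_prod:
  assumes "is_prime P" "finite A" "(\<Prod>i\<in>A. f i) \<in> P"
  shows "\<exists>i\<in>A. f i \<in> P"
  using assms(2,3) by (induction A rule: finite_induct) (use assms(1) in \<open>auto simp: is_prime_def\<close>)

lemma ideal_prod_dvd: "is_ideal N \<Longrightarrow> finite A \<Longrightarrow> i \<in> A \<Longrightarrow> f i \<in> N \<Longrightarrow> (\<Prod>i\<in>A. f i) \<in> N"
  by (simp add: prod.remove ideal_mult2)

text \<open>Krull's argument: an ideal maximal among those above \<open>J\<close> and disjoint from
  the multiplicative set \<open>S\<close> is prime.\<close>

lemma exists_prime_avoiding: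
  fixes J :: "'a::comm_ring_1 set"
  assumes J: "is_ideal J" and S: "1 \<in> S" "\<And>x y. x \<in> S \<Longrightarrow> y \<in> S \<Longrightarrow> x * y \<in> S" "J \<inter> S = {}"
  shows "\<exists>P. is_prime P \<and> J \<subseteq> P \<and> P \<inter> S = {}"
proof -
  define F where "F = {N. is_ideal N \<and> J \<subseteq> N \<and> N \<inter> S = {}}"
  have "\<exists>M\<in>F. \<forall>N\<in>F. M \<subseteq> N \<longrightarrow> N = M"
  proof (rule subset_Zorn_nonempty)
    show "F \<noteq> {}" using J S by (auto simp: F_def)
    fix C assume C: "C \<noteq> {}" "subset.chain F C"
    then have CF: "\<And>N. N \<in> C \<Longrightarrow> is_ideal N \<and> J \<subseteq> N \<and> N \<inter> S = {}"
      and tot: "\<And>N N'. N \<in> C \<Longrightarrow> N' \<in> C \<Longrightarrow> N \<subseteq> N' \<or> N' \<subseteq> N"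
      unfolding subset_chain_def F_def by blast+
    have "is_ideal (\<Union>C)"
      unfolding is_ideal_def
    proof (intro conjI ballI allI)
      show "0 \<in> \<Union>C" using C(1) CF ideal_0 by blast
      fix x assume "x \<in> \<Union>C"
      then obtain N where N: "N \<in> C" "x \<in> N" by blast
      show "r * x \<in> \<Union>C" for r using N CF ideal_mult by blast
      fix y assume "y \<in> \<Union>C"
      then obtain N' where N': "N' \<in> C" "y \<in> N'" by blast
      show "x + y \<in> \<Union>C" using tot[OF N(1) N'(1)] N N' CF ideal_add by blast
    qed
    moreover have "J \<subseteq> \<Union>C" "\<Union>C \<inter> S = {}" using C(1) CF by blast+
    ultimately show "\<Union>C \<in> F" by (simp add: F_def)
  qed
  then obtain M where MF: "M \<in> F" and maxF: "\<forall>N\<in>F. M \<subseteq> N \<longrightarrow> N = M" by (elim bexE)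
  have M: "is_ideal M" "J \<subseteq> M" "M \<inter> S = {}" using MF by (simp_all add: F_def)
  have max: "N = M" if "is_ideal N" "J \<subseteq> N" "N \<inter> S = {}" "M \<subseteq> N" for N
    using maxF that by (simp add: F_def)
  have hit: "\<exists>s\<in>S. \<exists>m\<in>M. \<exists>r. s = m + x * r" if x: "x \<notin> M" for x
  proof (rule ccontr)
    assume no: "\<not> ?thesis"
    let ?N = "add_multiples M x UNIV"
    have "M \<subseteq> ?N" using add_multiples_superset[OF ideal_UNIV] .
    moreover have "?N \<inter> S = {}" using no by (auto simp: add_multiples_def)
    moreover have "is_ideal ?N" using ideal_add_multiples[OF M(1) ideal_UNIV] .
    ultimately have "?N = M" using max M(2) by blast
    moreover have "x * 1 \<in> ?N" using add_multiples_mult[OF M(1)] by blast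
    ultimately show False using x by simp
  qed
  have "x \<in> M \<or> y \<in> M" if xy: "x * y \<in> M" for x y
  proof (rule ccontr)
    assume "\<not> (x \<in> M \<or> y \<in> M)"
    then obtain s m r s' m' r' where s: "s \<in> S" "m \<in> M" "s = m + x * r" "s' \<in> S" "m' \<in> M" "s' = m' + y * r'"
      using hit by metis
    have "s * s' = m * s' + (x * r) * m' + (x * y) * (r * r')" using s by (simp add: algebra_simps)
    moreover have "m * s' + (x * r) * m' + (x * y) * (r * r') \<in> M"
      using s xy M(1) by (intro ideal_add) (auto simp: ideal_mult ideal_mult2)
    ultimately show False using S(2)[OF s(1,4)] M(3) by auto
  qed
  then have "is_prime M" using M S(1) by (auto simp: is_prime_def)
  then show ?thesis using M by blast
qed

text \<open>The dimension of R/J is at least \<open>k\<close>, expressed by primes of R above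
  \<open>J\<close> instead of primes of the quotient ring.\<close>

definition prime_chain :: "'a::comm_ring_1 set \<Rightarrow> nat \<Rightarrow> bool" where
  "prime_chain J k \<longleftrightarrow> (\<exists>P :: nat \<Rightarrow> 'a set. (\<forall>j\<le>k. is_prime (P j) \<and> J \<subseteq> P j) \<and> (\<forall>j<k. P j \<subset> P (Suc j)))"

text \<open>The assumption \<open>no\<close> says that \<open>f\<close> is not nilpotent in the
  localisation of R/J at \<open>P\<close>. A prime avoiding all products of a power of
  \<open>f\<close> with an element outside \<open>P\<close> then lies strictly below
  \<open>P\<close>.\<close>

lemma exists_smaller_prime:
  assumes P: "is_prime P" and J: "is_ideal J" "J \<subseteq> P"
    and no: "\<And>s k. s * f ^ k \<in> J \<Longrightarrow> s \<in> P" and f: "f \<in> P"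
  shows "\<exists>P'. is_prime P' \<and> J \<subseteq> P' \<and> P' \<subset> P"
proof -
  define S where "S = {s * f ^ k |s k. s \<notin> P}"
  have one: "1 \<notin> P" using P by (simp add: is_prime_def)
  have "\<exists>P'. is_prime P' \<and> J \<subseteq> P' \<and> P' \<inter> S = {}"
  proof (rule exists_prime_avoiding[OF J(1)])
    have "1 * f ^ 0 \<in> S" unfolding S_def using one by blast
    then show "1 \<in> S" by simp
    show "J \<inter> S = {}" using no unfolding S_def by blast
    fix x y assume "x \<in> S" "y \<in> S"
    then obtain s k t l where "x = s * f ^ k" "y = t * f ^ l" "s \<notin> P" "t \<notin> P" unfolding S_def by blast
    then have "x * y = (s * t) * f ^ (k + l)" "s * t \<notin> P"
      using prime_mult_iff[OF P] by (auto simp: power_add algebra_simps)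
    then show "x * y \<in> S" unfolding S_def by blast
  qed
  then obtain P' where P': "is_prime P'" "J \<subseteq> P'" "P' \<inter> S = {}" by blast
  have "s * f ^ 0 \<in> S" if "s \<notin> P" for s unfolding S_def using that by blast
  then have "P' \<subseteq> P" using P'(3) by auto
  moreover have "1 * f ^ 1 \<in> S" unfolding S_def using one by blast
  then have "f \<notin> P'" using P'(3) by auto
  ultimately show ?thesis using P' f by blast
qed

definition ann :: "'a::comm_ring_1 set \<Rightarrow> 'a set \<Rightarrow> 'a set" where
  "ann N1 N2 = {r. \<forall>x\<in>N1. r * x \<in> N2}"

lemma ideal_ann: "is_ideal N2 \<Longrightarrow> is_ideal (ann N1 N2)"
  unfolding is_ideal_def ann_def by (auto simp: distrib_right mult.assoc)

text \<open>The inequality dim M/fM + 1 <= dim M. Every prime of the chain contains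
  \<open>f\<close>, which annihilates M/fM. Powers of \<open>f\<close> can be cancelled modulo the
  annihilator of M, so \<open>exists_smaller_prime\<close> finds a prime below the bottom
  one.\<close>

lemma prime_chain_quotient_by_nonzerodivisor:
  assumes N: "is_ideal N1" "is_ideal N2" and f: "nonzerodivisor_on f N1 N2"
    and ch: "prime_chain (ann N1 (add_multiples N2 f N1)) k"
  shows "prime_chain (ann N1 N2) (Suc k)"
proof -
  let ?J' = "ann N1 (add_multiples N2 f N1)"
  obtain P where P: "\<And>j. j \<le> k \<Longrightarrow> is_prime (P j)" "\<And>j. j \<le> k \<Longrightarrow> ?J' \<subseteq> P j"
    "\<And>j. j < k \<Longrightarrow> P j \<subset> P (Suc j)"
    using ch unfolding prime_chain_def by blast
  have sub: "ann N1 N2 \<subseteq> ?J'"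
    using add_multiples_superset[OF N(1), of N2 f] unfolding ann_def by blast
  have "f \<in> ?J'" using add_multiples_mult[OF N(2)] unfolding ann_def by blast
  then have fP: "f \<in> P 0" using P(2)[of 0] by blast
  have "s \<in> P 0" if s: "s * f ^ k \<in> ann N1 N2" for s k
  proof -
    have "s * x \<in> N2" if x: "x \<in> N1" for x
    proof -
      have "s * x \<in> N2" if "f ^ k * (s * x) \<in> N2"
        using that
      proof (induction k)
        case (Suc k)
        have "f * (f ^ k * (s * x)) \<in> N2" using Suc.prems by (simp add: mult.assoc)
        moreover have "f ^ k * (s * x) \<in> N1" using ideal_mult[OF N(1)] x by blast
        ultimately show ?case using f Suc.IH unfolding nonzerodivisor_on_def by blast
      qed simp
      moreover have "f ^ k * (s * x) \<in> N2"
        using s x unfolding ann_def by (auto simp: ac_simps)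
      ultimately show ?thesis by blast
    qed
    then have "s \<in> ann N1 N2" by (simp add: ann_def)
    then show ?thesis using sub P(2)[of 0] by blast
  qed
  then have "\<exists>P'. is_prime P' \<and> ann N1 N2 \<subseteq> P' \<and> P' \<subset> P 0"
    by (intro exists_smaller_prime[OF P(1)[of 0] ideal_ann[OF N(2)] _ _ fP] subset_trans[OF sub P(2)[of 0]])
      (simp_all)
  then obtain P' where P': "is_prime P'" "ann N1 N2 \<subseteq> P'" "P' \<subset> P 0" by (elim exE conjE)
  have "is_prime (case_nat P' P j) \<and> ann N1 N2 \<subseteq> case_nat P' P j" if "j \<le> Suc k" for j
  proof (cases j)
    case 0
    then show ?thesis using P'(1,2) by simp
  next
    case (Suc i)
    then have i: "i \<le> k" using that by simp
    then show ?thesis using P(1)[OF i] subset_trans[OF sub P(2)[OF i]] Suc by simp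
  qed
  moreover have "case_nat P' P j \<subset> case_nat P' P (Suc j)" if "j < Suc k" for j
  proof (cases j)
    case 0
    then show ?thesis using P'(3) by simp
  next
    case (Suc i)
    then show ?thesis using P(3)[of i] that by simp
  qed
  ultimately show ?thesis unfolding prime_chain_def by (intro exI[of _ "case_nat P' P"]) (intro conjI allI impI; blast)
qed

section \<open>Vanishing of local cohomology\<close>

text \<open>For a cocycle \<open>z\<close> this is the annihilator of its cohomology class, to which
  prime avoidance is applied below.\<close>

lemma ideal_multipliers_into_cobd:
  assumes N: "is_ideal N1" "is_ideal N2"
  shows "is_ideal {r. act r z \<in> V.cobd (cech_ideal N1) (cech_ideal N2) p}"
proof -
  have "V.subspace (V.cobd (cech_ideal N1) (cech_ideal N2) p)"
    using V.subspace_cobd subcomplex_cech_ideal N by blast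
  then show ?thesis unfolding is_ideal_def
    using V.subspace_0 V.subspace_add cobd_act[OF N] by (auto simp: act_add_left simp flip: act_act)
qed

lemma cech_ideal_subset_cobd:
  assumes "is_ideal N1"
  shows "cech_ideal N2 p \<subseteq> V.cobd (cech_ideal N1) (cech_ideal N2) p"
proof
  fix w assume "w \<in> cech_ideal N2 p"
  then have "w + cdiff 0 \<in> V.cobd (cech_ideal N1) (cech_ideal N2) p"
    unfolding V.cobd_def using cech_ideal_0[OF assms] by blast
  then show "w \<in> V.cobd (cech_ideal N1) (cech_ideal N2) p" by (simp add: V.d_0)
qed

text \<open>If no power of \<open>f\<close> killed the class, some prime would contain its
  annihilator and avoid all powers of \<open>f\<close>. That prime contains a power of each
  variable, hence each variable, hence \<open>f\<close>. No expression of \<open>f\<close> in the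
  variables is involved.\<close>

lemma cohomology_torsion:
  assumes N: "is_ideal N1" "is_ideal N2" and z: "z \<in> V.cocyc (cech_ideal N1) (cech_ideal N2) p"
    and f: "\<And>P. is_prime P \<Longrightarrow> range var \<subseteq> P \<Longrightarrow> f \<in> P"
  shows "\<exists>k. act (f ^ k) z \<in> V.cobd (cech_ideal N1) (cech_ideal N2) p"
proof (rule ccontr)
  let ?a = "{r. act r z \<in> V.cobd (cech_ideal N1) (cech_ideal N2) p}"
  assume "\<not> ?thesis"
  then have disj: "?a \<inter> range (\<lambda>k. f ^ k) = {}" by blast
  have "\<exists>P. is_prime P \<and> ?a \<subseteq> P \<and> P \<inter> range (\<lambda>k. f ^ k) = {}"
  proof (rule exists_prime_avoiding[OF ideal_multipliers_into_cobd[OF N] _ _ disj])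
    show "1 \<in> range (\<lambda>k. f ^ k)" by (metis power_0 rangeI)
    show "x * y \<in> range (\<lambda>k. f ^ k)" if "x \<in> range (\<lambda>k. f ^ k)" "y \<in> range (\<lambda>k. f ^ k)" for x y
      using that by (auto simp flip: power_add)
  qed
  then obtain P where P: "is_prime P" "?a \<subseteq> P" "P \<inter> range (\<lambda>k. f ^ k) = {}" by blast
  have "var v \<in> P" for v
    using cohomology_var_torsion[OF N z, of v] P(2) prime_power[OF P(1)] by blast
  then have "f \<in> P" using f P(1) by blast
  then have "f ^ 1 \<in> P" by simp
  then show False using P(3) by blast
qed

text \<open>In positive degree every component inverts some variable x_v, and there annihilation by
  r x_v^k amounts to annihilation by \<open>r\<close>.\<close>

lemma cech_ideal_kill:
  assumes N: "is_ideal N2" and c: "c \<in> cech_ideal N1 p" "p \<ge> 1"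
    and kill: "\<And>v. \<exists>k. r * var v ^ k \<in> ann N1 N2"
  shows "act r c \<in> cech_ideal N2 p"
proof -
  have "laurent_of r * c S \<in> loc_ideal N2 S" for S
  proof (cases "c S = 0")
    case True
    then show ?thesis using loc_ideal_0[OF N] by simp
  next
    case False
    then have "int (card S) = p" using c by (simp add: cech_ideal_def)
    then have "S \<noteq> {}" using c(2) by auto
    then obtain v where v: "v \<in> S" by blast
    have "c S \<in> loc_ideal N1 S" using c by (simp add: cech_ideal_def)
    then obtain x a where x: "c S = lfrac x a" "x \<in> N1" "Poly_Mapping.keys a \<subseteq> S"
      unfolding loc_ideal_def by blast
    obtain k where "r * var v ^ k \<in> ann N1 N2" using kill by blast
    then have "mon (Poly_Mapping.single v k) * (r * x) \<in> N2"
      using x(2) by (auto simp: ann_def var_power mult.assoc mult.left_commute)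
    moreover have "Poly_Mapping.keys (Poly_Mapping.single v k) \<subseteq> S" using v by simp
    ultimately show ?thesis
      using lfrac_mem_loc_ideal_iff[OF N x(3), of "r * x"] x(1) by (auto simp: laurent_of_mult_lfrac)
  qed
  then show ?thesis using c by (auto simp: cech_ideal_def act_def)
qed

text \<open>Suppose a prime \<open>P\<close> contains the annihilator of a class. It contains all
  variables and the annihilator of N1/N2, and in dimension 0 it is minimal above the latter. So each
  x_v is nilpotent in the localisation at \<open>P\<close>: s_v x_v^(k_v) annihilates N1/N2 with s_v
  outside \<open>P\<close>. The product of the s_v kills all cochains of positive degree but lies
  outside \<open>P\<close>, a contradiction.\<close>

lemma acyclic_of_dim_0:
  fixes N1 :: "('n::{finite,linorder}, 'k::field) mpoly set"
  assumes N: "is_ideal N1" "is_ideal N2" and dim: "\<not> prime_chain (ann N1 N2) 1" and p: "p \<ge> 1"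
  shows "acyclic_at N1 N2 p"
proof
  fix z assume z: "z \<in> V.cocyc (cech_ideal N1) (cech_ideal N2) p"
  let ?a = "{r. act r z \<in> V.cobd (cech_ideal N1) (cech_ideal N2) p}"
  have zC: "z \<in> cech_ideal N1 p" using z by (simp add: V.cocyc_def)
  show "z \<in> V.cobd (cech_ideal N1) (cech_ideal N2) p"
  proof (rule ccontr)
    assume "z \<notin> V.cobd (cech_ideal N1) (cech_ideal N2) p"
    then have "?a \<inter> {1} = {}" by simp
    then have "\<exists>P. is_prime P \<and> ?a \<subseteq> P \<and> P \<inter> {1} = {}"
      by (intro exists_prime_avoiding[OF ideal_multipliers_into_cobd[OF N]]) auto
    then obtain P where P: "is_prime P" "?a \<subseteq> P" by (elim exE conjE)
    have var: "var v \<in> P" for v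
      using cohomology_var_torsion[OF N z, of v] P(2) prime_power[OF P(1)] by blast
    have "ann N1 N2 \<subseteq> ?a"
    proof
      fix r assume "r \<in> ann N1 N2"
      then have "r * var v ^ 0 \<in> ann N1 N2" for v by simp
      then have "act r z \<in> cech_ideal N2 p" using cech_ideal_kill[OF N(2) zC p] by blast
      then show "r \<in> ?a" using cech_ideal_subset_cobd[OF N(1)] by blast
    qed
    then have annP: "ann N1 N2 \<subseteq> P" using P(2) by blast
    have "\<exists>s k. s * var v ^ k \<in> ann N1 N2 \<and> s \<notin> P" for v
    proof (rule ccontr)
      assume "\<not> ?thesis"
      then have "\<exists>P'. is_prime P' \<and> ann N1 N2 \<subseteq> P' \<and> P' \<subset> P"
        by (intro exists_smaller_prime[OF P(1) ideal_ann[OF N(2)] annP _ var]) blast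
      then obtain P' where P': "is_prime P'" "ann N1 N2 \<subseteq> P'" "P' \<subset> P" by (elim exE conjE)
      have "prime_chain (ann N1 N2) 1"
        unfolding prime_chain_def
        by (rule exI[of _ "\<lambda>j. if j = 0 then P' else P"]) (use P P' annP in auto)
      then show False using dim by blast
    qed
    then obtain s k where s: "\<And>v. s v * var v ^ (k v) \<in> ann N1 N2" "\<And>v. s v \<notin> P" by metis
    define r where "r = (\<Prod>v\<in>UNIV. s v)"
    have "r * var v ^ k v \<in> ann N1 N2" for v
    proof -
      have "r * var v ^ k v = (\<Prod>u\<in>UNIV - {v}. s u) * (s v * var v ^ k v)"
        unfolding r_def by (simp add: prod.remove[of UNIV v] ac_simps)
      then show ?thesis by (simp only: ideal_mult[OF ideal_ann[OF N(2)] s(1)])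
    qed
    then have "act r z \<in> cech_ideal N2 p" using cech_ideal_kill[OF N(2) zC p] by blast
    then have "r \<in> ?a" using cech_ideal_subset_cobd[OF N(1)] by blast
    then have "r \<in> P" using P(2) by blast
    then show False using prime_prod[OF P(1), of UNIV s] s(2) unfolding r_def by auto
  qed
qed

lemma acyclic_of_nonzerodivisor:
  assumes N: "is_ideal N1" "is_ideal N2"
    and f: "\<And>P. is_prime P \<Longrightarrow> range var \<subseteq> P \<Longrightarrow> f \<in> P" and nzd: "nonzerodivisor_on f N1 N2"
    and van: "acyclic_at N1 (add_multiples N2 f N1) (p - 1)"
  shows "acyclic_at N1 N2 p"
proof
  fix z assume z: "z \<in> V.cocyc (cech_ideal N1) (cech_ideal N2) p"
  then have zC: "z \<in> cech_ideal N1 p" by (simp add: V.cocyc_def)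
  obtain k where "act (f ^ k) z \<in> V.cobd (cech_ideal N1) (cech_ideal N2) p"
    using cohomology_torsion[OF N z f] by blast
  then show "z \<in> V.cobd (cech_ideal N1) (cech_ideal N2) p"
  proof (induction k)
    case (Suc k)
    have "act (f ^ k) z \<in> V.cobd (cech_ideal N1) (cech_ideal N2) p"
    proof (rule V.injective_on_cohomology[OF subcomplex_cech_ideal[OF N(1)] subcomplex_cech_ideal[OF N(2)]
          act_add act_cdiff _ cech_ideal_add_multiples[OF N(2,1)] subcomplex_cech_ideal[OF N(1)] van])
      show "y \<in> cech_ideal N2 p" if "y \<in> cech_ideal N1 p" "act f y \<in> cech_ideal N2 p" for y
        using nonzerodivisor_on_cech[OF N nzd that] .
      show "act (f ^ k) z \<in> cech_ideal N1 p" using cech_ideal_act[OF N(1) zC] .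
      show "act f (act (f ^ k) z) \<in> V.cobd (cech_ideal N1) (cech_ideal N2) p"
        using Suc.prems by (simp add: act_act)
    qed
    then show ?case by (rule Suc.IH)
  qed simp
qed

text \<open>Each element enlarges the denominator \<open>N2\<close> and keeps the numerator
  \<open>N1\<close>, so that M/fM is again a pair of ideals.\<close>

fun regular_on :: "('n::{finite,linorder}, 'k::field) mpoly set \<Rightarrow> ('n, 'k) mpoly set \<Rightarrow> ('n, 'k) mpoly list \<Rightarrow> bool" where
  "regular_on N1 N2 [] \<longleftrightarrow> True"
| "regular_on N1 N2 (f # fs) \<longleftrightarrow> nonzerodivisor_on f N1 N2 \<and> regular_on N1 (add_multiples N2 f N1) fs"

text \<open>Along the sequence the degree \<open>p\<close>, the length and the bound on the
  dimension all drop by one, so \<open>p\<close> never meets the length. What remains at the empty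
  sequence is dimension 0 in positive degree, or a negative degree.\<close>

lemma acyclic_of_regular_sequence:
  assumes N: "is_ideal N1" "is_ideal N2" and reg: "regular_on N1 N2 fs"
    and fs: "\<And>P f. f \<in> set fs \<Longrightarrow> is_prime P \<Longrightarrow> range var \<subseteq> P \<Longrightarrow> f \<in> P"
    and dim: "\<not> prime_chain (ann N1 N2) (Suc (length fs))" and p: "p \<noteq> int (length fs)"
  shows "acyclic_at N1 N2 p"
  using N(2) reg fs dim p
proof (induction fs arbitrary: N2 p)
  case Nil
  show ?case
  proof (cases "p \<ge> 1")
    case True
    then show ?thesis using acyclic_of_dim_0[OF N(1) Nil(1)] Nil by simp
  next
    case False
    then have "V.cocyc (cech_ideal N1) (cech_ideal N2) p \<subseteq> {0}"
      using Nil(5) cech_ideal_out_of_range[OF N(1), of p] by (auto simp: V.cocyc_def)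
    then show ?thesis
      using V.subspace_0 V.subspace_cobd[OF subcomplex_cech_ideal[OF N(1)] subcomplex_cech_ideal[OF Nil(1)]] by blast
  qed
next
  case (Cons f fs)
  let ?N = "add_multiples N2 f N1"
  have nzd: "nonzerodivisor_on f N1 N2" and reg: "regular_on N1 ?N fs" using Cons.prems by auto
  have "\<not> prime_chain (ann N1 ?N) (Suc (length fs))"
    using prime_chain_quotient_by_nonzerodivisor[OF N(1) Cons.prems(1) nzd] Cons.prems(4) by auto
  then have "V.cocyc (cech_ideal N1) (cech_ideal ?N) (p - 1) \<subseteq> V.cobd (cech_ideal N1) (cech_ideal ?N) (p - 1)"
    using Cons.prems(3,5) by (intro Cons.IH[OF ideal_add_multiples[OF Cons.prems(1) N(1)] reg]) auto
  then show ?case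
    using Cons.prems(3) by (intro acyclic_of_nonzerodivisor[OF N(1) Cons.prems(1) _ nzd]) auto
qed

section \<open>Ideals of the structure \<open>ring_of_type_algebra\<close>\<close>

lemma ring_of_type_algebra_simps [simp]:
  "carrier (ring_of_type_algebra :: 'a::ring_1 ring) = UNIV"
  "x \<otimes>\<^bsub>ring_of_type_algebra\<^esub> y = x * y"
  "x \<oplus>\<^bsub>ring_of_type_algebra\<^esub> y = x + (y :: 'a::ring_1)"
  "\<zero>\<^bsub>ring_of_type_algebra\<^esub> = (0 :: 'a::ring_1)"
  "\<one>\<^bsub>ring_of_type_algebra\<^esub> = (1 :: 'a::ring_1)"
  by (simp_all add: ring_of_type_algebra_def)

lemma cring_of_type: "cring (ring_of_type_algebra :: 'a::comm_ring_1 ring)"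
  by (rule cring_from_type_algebra)

lemma a_inv_of_type: "\<ominus>\<^bsub>ring_of_type_algebra\<^esub> x = - (x :: 'a::comm_ring_1)"
proof -
  interpret cring "ring_of_type_algebra :: 'a ring" by (rule cring_of_type)
  show ?thesis by (rule minus_equality) auto
qed

lemma ideal_iff: "ideal N (ring_of_type_algebra :: 'a::comm_ring_1 ring) \<longleftrightarrow> is_ideal N"
proof
  assume "ideal N (ring_of_type_algebra :: 'a ring)"
  then interpret ideal N "ring_of_type_algebra :: 'a ring" .
  show "is_ideal N"
    unfolding is_ideal_def
  proof (intro conjI ballI allI)
    show "0 \<in> N" using additive_subgroup.zero_closed[OF is_additive_subgroup] by simp
    show "x + y \<in> N" if "x \<in> N" "y \<in> N" for x y using additive_subgroup.a_closed[OF is_additive_subgroup that] by simp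
    show "r * x \<in> N" if "x \<in> N" for x r using I_l_closed[OF that, of r] by simp
  qed
next
  assume N: "is_ideal N"
  interpret R: cring "ring_of_type_algebra :: 'a ring" by (rule cring_of_type)
  show "ideal N (ring_of_type_algebra :: 'a ring)"
  proof (rule idealI)
    show "ring (ring_of_type_algebra :: 'a ring)" by (rule R.ring_axioms)
    show "subgroup N (add_monoid (ring_of_type_algebra :: 'a ring))"
    proof (rule R.add.subgroupI)
      show "N \<noteq> {}" using ideal_0[OF N] by blast
      show "\<ominus>\<^bsub>ring_of_type_algebra\<^esub> a \<in> N" if "a \<in> N" for a
        using ideal_neg[OF N that] by (simp add: a_inv_of_type)
    qed (use ideal_add[OF N] in auto)
  qed (use ideal_mult[OF N] ideal_mult2[OF N] in auto)
qed

lemma primeideal_iff: "primeideal P (ring_of_type_algebra :: 'a::comm_ring_1 ring) \<longleftrightarrow> is_prime P"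
proof
  assume "primeideal P (ring_of_type_algebra :: 'a ring)"
  then interpret primeideal P "ring_of_type_algebra :: 'a ring" .
  have P: "is_ideal P" using is_ideal by (simp add: ideal_iff)
  have "1 \<notin> P"
  proof
    assume "1 \<in> P"
    then have "x \<in> P" for x using ideal_mult[OF P, of 1 x] by simp
    then show False using I_notcarr by auto
  qed
  moreover have "x \<in> P \<or> y \<in> P" if "x * y \<in> P" for x y using I_prime[of x y] that by simp
  ultimately show "is_prime P" using P by (simp add: is_prime_def)
next
  assume P: "is_prime P"
  show "primeideal P (ring_of_type_algebra :: 'a ring)"
  proof (rule primeidealI)
    show "ideal P (ring_of_type_algebra :: 'a ring)" using P by (simp add: ideal_iff is_prime_def)
    show "carrier (ring_of_type_algebra :: 'a ring) \<noteq> P" using P by (auto simp: is_prime_def)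
  qed (use P cring_of_type in \<open>auto simp: is_prime_def\<close>)
qed

lemma radical_iff: "f \<in> radical (ring_of_type_algebra :: 'a::comm_ring_1 ring) J \<longleftrightarrow> (\<exists>k. f ^ k \<in> J)"
proof -
  interpret R: cring "ring_of_type_algebra :: 'a ring" by (rule cring_of_type)
  have "f [^]\<^bsub>ring_of_type_algebra\<^esub> k = f ^ k" for k :: nat
    by (induction k) (auto simp: mult.commute)
  then show ?thesis by (simp add: radical_def)
qed

lemma genideal_ideal: "is_ideal (Idl\<^bsub>ring_of_type_algebra\<^esub> (F :: 'a::comm_ring_1 set))"
proof -
  interpret R: cring "ring_of_type_algebra :: 'a ring" by (rule cring_of_type)
  show ?thesis using R.genideal_ideal[of F] by (simp add: ideal_iff)
qed

lemma genideal_subset: "is_ideal N \<Longrightarrow> F \<subseteq> N \<Longrightarrow> Idl\<^bsub>ring_of_type_algebra\<^esub> (F :: 'a::comm_ring_1 set) \<subseteq> N"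
proof -
  interpret R: cring "ring_of_type_algebra :: 'a ring" by (rule cring_of_type)
  show "is_ideal N \<Longrightarrow> F \<subseteq> N \<Longrightarrow> Idl\<^bsub>ring_of_type_algebra\<^esub> F \<subseteq> N"
    using R.genideal_minimal[of N F] by (simp add: ideal_iff)
qed

lemma genideal_superset: "F \<subseteq> Idl\<^bsub>ring_of_type_algebra\<^esub> (F :: 'a::comm_ring_1 set)"
proof -
  interpret R: cring "ring_of_type_algebra :: 'a ring" by (rule cring_of_type)
  show ?thesis using R.genideal_self[of F] by simp
qed

text \<open>The correspondence of primes: chains are pulled back along the projection by preimages
  and pushed forward by images.\<close>

lemma krull_dim_Quot:
  fixes J :: "'a::comm_ring_1 set"
  assumes J: "is_ideal J"
  shows "krull_dim (ring_of_type_algebra Quot J) = (SUP k\<in>{k. prime_chain J k}. ereal (real k))"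
proof -
  let ?R = "ring_of_type_algebra :: 'a ring" and ?Q = "ring_of_type_algebra Quot J"
  interpret R: cring ?R by (rule cring_of_type)
  interpret J: ideal J ?R using J by (simp add: ideal_iff)
  interpret h: ring_hom_ring ?R ?Q "(+>\<^bsub>?R\<^esub>) J" by (rule J.rcos_ring_hom_ring)
  have cQ: "cring ?Q" by (rule J.quotient_is_cring[OF cring_of_type])
  have carr: "carrier ?Q = range ((+>\<^bsub>?R\<^esub>) J)"
    by (auto simp: FactRing_def A_RCOSETS_def')
  have zero: "J +>\<^bsub>?R\<^esub> x = \<zero>\<^bsub>?Q\<^esub> \<longleftrightarrow> x \<in> J" for x
    using J.rcos_const_imp_mem[of x] R.a_coset_join2[of x J] J.a_subgroup by (auto simp: FactRing_def)
  have mem: "x \<in> P" if P: "is_ideal P" "J \<subseteq> P" and e: "J +>\<^bsub>?R\<^esub> x = J +>\<^bsub>?R\<^esub> y" "y \<in> P" for x y P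
  proof -
    have "x \<in> J +>\<^bsub>?R\<^esub> x" using ideal_0[OF J] by (auto simp: a_r_coset_def')
    then obtain j where "j \<in> J" "x = j + y" unfolding e(1) by (auto simp: a_r_coset_def')
    then show ?thesis using P e(2) ideal_add[OF P(1)] by auto
  qed
  have up: "prime_chain J k" if P: "\<forall>j\<le>k. primeideal (P j) ?Q" "\<forall>j<k. P j \<subset> P (Suc j)" for P k
  proof -
    define p where "p j = {x. J +>\<^bsub>?R\<^esub> x \<in> P j}" for j
    have "is_prime (p j)" if "j \<le> k" for j
      using h.primeideal_vimage[OF cring_of_type, of "P j"] P(1) that
      by (simp add: p_def primeideal_iff)
    moreover have "J \<subseteq> p j" if "j \<le> k" for j
    proof
      interpret P: primeideal "P j" ?Q using P(1) that by blast
      fix x assume "x \<in> J"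
      then have "J +>\<^bsub>?R\<^esub> x = \<zero>\<^bsub>?Q\<^esub>" by (simp add: zero)
      then show "x \<in> p j" using P.zero_closed by (simp add: p_def)
    qed
    moreover have "p j \<subset> p (Suc j)" if "j < k" for j
    proof -
      interpret P: primeideal "P (Suc j)" ?Q using P(1) that by auto
      have ss: "P j \<subset> P (Suc j)" using P(2) that by simp
      then obtain C where C: "C \<in> P (Suc j)" "C \<notin> P j" using psubset_imp_ex_mem[OF ss] by auto
      have "C \<in> carrier ?Q" using P.a_subset C(1) by (rule subsetD)
      then obtain x where x: "C = J +>\<^bsub>?R\<^esub> x" unfolding carr by (elim rangeE)
      have "P j \<subseteq> P (Suc j)" using ss by (rule psubset_imp_subset)
      then have "p j \<subseteq> p (Suc j)" unfolding p_def by blast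
      moreover have "x \<in> p (Suc j)" "x \<notin> p j" using C x by (auto simp: p_def)
      ultimately show ?thesis by blast
    qed
    ultimately show ?thesis unfolding prime_chain_def by (intro exI[of _ p] conjI allI impI)
  qed
  have down: "\<exists>Q. (\<forall>j\<le>k. primeideal (Q j) ?Q) \<and> (\<forall>j<k. Q j \<subset> Q (Suc j))" if pc: "prime_chain J k" for k
  proof -
    obtain p where p: "\<And>j. j \<le> k \<Longrightarrow> is_prime (p j)" "\<And>j. j \<le> k \<Longrightarrow> J \<subseteq> p j" "\<And>j. j < k \<Longrightarrow> p j \<subset> p (Suc j)"
      using pc unfolding prime_chain_def by blast
    define Q where "Q j = (+>\<^bsub>?R\<^esub>) J ` p j" for j
    have iff: "J +>\<^bsub>?R\<^esub> x \<in> Q j \<longleftrightarrow> x \<in> p j" if "j \<le> k" for x j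
      using mem[OF prime_is_ideal[OF p(1)[OF that]] p(2)[OF that]] unfolding Q_def by blast
    have "primeideal (Q j) ?Q" if j: "j \<le> k" for j
    proof (rule primeidealI)
      have "ideal (p j) ?R" using p(1)[OF j] by (simp add: ideal_iff prime_is_ideal)
      then show "ideal (Q j) ?Q"
        unfolding Q_def using R.ring_ideal_imp_quot_ideal[OF J.ideal_axioms] by blast
      show "cring ?Q" by (rule cQ)
      have "1 \<notin> p j" using p(1)[OF j] by (simp add: is_prime_def)
      then have "J +>\<^bsub>?R\<^esub> 1 \<notin> Q j" using iff[OF j] by simp
      then show "carrier ?Q \<noteq> Q j" using carr by blast
      fix a b assume "a \<in> carrier ?Q" "b \<in> carrier ?Q" and ab: "a \<otimes>\<^bsub>?Q\<^esub> b \<in> Q j"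
      then obtain x y where xy: "a = J +>\<^bsub>?R\<^esub> x" "b = J +>\<^bsub>?R\<^esub> y" unfolding carr by blast
      have "a \<otimes>\<^bsub>?Q\<^esub> b = J +>\<^bsub>?R\<^esub> (x * y)" using h.hom_mult[of x y] xy by simp
      then have "x * y \<in> p j" using ab iff[OF j] by simp
      then have "x \<in> p j \<or> y \<in> p j" using p(1)[OF j] prime_mult_iff by blast
      then show "a \<in> Q j \<or> b \<in> Q j" using iff[OF j] xy by simp
    qed
    moreover have "Q j \<subset> Q (Suc j)" if j: "j < k" for j
    proof -
      obtain x where "x \<in> p (Suc j)" "x \<notin> p j" using psubset_imp_ex_mem[OF p(3)[OF j]] by auto
      then have "J +>\<^bsub>?R\<^esub> x \<in> Q (Suc j)" "J +>\<^bsub>?R\<^esub> x \<notin> Q j" using iff j by auto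
      moreover have "Q j \<subseteq> Q (Suc j)"
        unfolding Q_def using psubset_imp_subset[OF p(3)[OF j]] by (rule image_mono)
      ultimately show ?thesis by blast
    qed
    ultimately show ?thesis by (intro exI[of _ Q] conjI allI impI)
  qed
  have "{k. \<exists>P :: nat \<Rightarrow> 'a set set. (\<forall>j\<le>k. primeideal (P j) ?Q) \<and> (\<forall>j<k. P j \<subset> P (Suc j))} = {k. prime_chain J k}"
    using up down by blast
  then show ?thesis unfolding krull_dim_def by simp
qed

lemma prime_chain_le_krull_dim:
  assumes "is_ideal J" "prime_chain J k"
  shows "ereal (real k) \<le> krull_dim (ring_of_type_algebra Quot J)"
  unfolding krull_dim_Quot[OF assms(1)] by (rule SUP_upper) (use assms(2) in simp)

lemma krull_dim_Quot_antimono: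
  assumes "is_ideal J" "is_ideal J'" "J \<subseteq> J'"
  shows "krull_dim (ring_of_type_algebra Quot J') \<le> krull_dim (ring_of_type_algebra Quot J)"
proof -
  have "prime_chain J k" if "prime_chain J' k" for k
    using that assms(3) unfolding prime_chain_def by blast
  then show ?thesis unfolding krull_dim_Quot[OF assms(1)] krull_dim_Quot[OF assms(2)]
    by (intro SUP_subset_mono) auto
qed

lemma primary_ideal_type:
  assumes "primary_ideal (ring_of_type_algebra :: 'a::comm_ring_1 ring) q"
  shows "is_ideal q" "is_prime (radical ring_of_type_algebra q)" "q \<subseteq> radical ring_of_type_algebra q"
    "\<And>f g. f * g \<in> q \<Longrightarrow> g \<notin> radical ring_of_type_algebra q \<Longrightarrow> f \<in> q"
proof -
  let ?P = "radical (ring_of_type_algebra :: 'a ring) q"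
  show q: "is_ideal q" and pr: "\<And>f g. f * g \<in> q \<Longrightarrow> g \<notin> ?P \<Longrightarrow> f \<in> q"
    using assms by (auto simp: primary_ideal_def ideal_iff)
  have "q \<noteq> UNIV" using assms by (simp add: primary_ideal_def)
  then have one: "1 \<notin> q" using ideal_mult[OF q, of 1] by auto
  show sub: "q \<subseteq> ?P"
  proof
    fix x assume "x \<in> q"
    then have "x ^ 1 \<in> q" by simp
    then show "x \<in> ?P" unfolding radical_iff by blast
  qed
  have "is_prime ?P"
    unfolding is_prime_def is_ideal_def
  proof (intro conjI ballI allI impI)
    show "0 \<in> ?P" using sub ideal_0[OF q] by blast
    show "1 \<notin> ?P" using one by (simp add: radical_iff)
    fix x y
    show "y * x \<in> ?P" if "x \<in> ?P"
      using that ideal_mult[OF q] by (auto simp: radical_iff power_mult_distrib)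
    show "x \<in> ?P \<or> y \<in> ?P" if "x * y \<in> ?P"
    proof (rule disjCI)
      assume y: "y \<notin> ?P"
      obtain k where k: "x ^ k * y ^ k \<in> q" using \<open>x * y \<in> ?P\<close> by (auto simp: radical_iff power_mult_distrib)
      have "y ^ k \<notin> ?P" using y unfolding radical_iff by (metis power_mult)
      then show "x \<in> ?P" using pr[OF k] unfolding radical_iff by blast
    qed
  next
    fix x y assume xy: "x \<in> ?P" "y \<in> ?P"
    \<comment> \<open>In place of a binomial expansion: a prime above \<open>q\<close> that avoids
      all powers of \<open>x + y\<close> would contain both \<open>x\<close> and
      \<open>y\<close>.\<close>
    show "x + y \<in> ?P"
    proof (rule ccontr)
      assume no: "x + y \<notin> ?P"
      have "q \<inter> range (\<lambda>k. (x + y) ^ k) = {}" using no unfolding radical_iff by blast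
      moreover have "1 \<in> range (\<lambda>k. (x + y) ^ k)" by (metis power_0 rangeI)
      moreover have "a * b \<in> range (\<lambda>k. (x + y) ^ k)" if "a \<in> range (\<lambda>k. (x + y) ^ k)" "b \<in> range (\<lambda>k. (x + y) ^ k)" for a b
        using that by (auto simp flip: power_add)
      ultimately obtain P where P: "is_prime P" "q \<subseteq> P" "P \<inter> range (\<lambda>k. (x + y) ^ k) = {}"
        using exists_prime_avoiding[OF q] by metis
      have "x \<in> P" "y \<in> P" using xy P(2) prime_power[OF P(1)] unfolding radical_iff by blast+
      then have "(x + y) ^ 1 \<in> P" using ideal_add[OF prime_is_ideal[OF P(1)]] by simp
      then show False using P(3) by blast
    qed
  qed
  then show "is_prime ?P" .
qed

section \<open>Homogeneity of the ideals in the dimension filtration\<close>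

lemma graded_ideal_of_homogeneous_ideal:
  assumes "homogeneous_ideal I"
  shows "graded_ideal I"
proof -
  obtain F where F: "F \<subseteq> (\<Union>j. homogeneous_part j)" "I = Idl\<^bsub>mpoly_ring\<^esub> F"
    using assms by (auto simp: homogeneous_ideal_def)
  have I: "is_ideal I" using genideal_ideal F by blast
  \<comment> \<open>The elements all of whose parts lie in \<open>I\<close>. They form an ideal, by
    reduction to multiplication by monomials, and it contains the homogeneous generators of
    \<open>I\<close>.\<close>
  define N where "N = {f. \<forall>j. hpart pdeg j f \<in> I}"
  have "is_ideal N"
    unfolding is_ideal_def
  proof (intro conjI ballI allI)
    show "0 \<in> N" using ideal_0[OF I] by (simp add: N_def)
    show "x + y \<in> N" if "x \<in> N" "y \<in> N" for x y
      using that ideal_add[OF I] by (simp add: N_def hpart_add)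
    fix x r assume x: "x \<in> N"
    show "r * x \<in> N"
    proof (induction r rule: poly_mapping_single_induct)
      case (single k c)
      have "hpart pdeg j (Poly_Mapping.single k c * x) = Poly_Mapping.single k c * hpart pdeg (j - pdeg k) x" for j
        by (rule hpart_single_mult) (simp add: mdeg_add)
      then show ?case using x ideal_mult[OF I] by (simp add: N_def)
    next
      case (add f g)
      then show ?case using ideal_add[OF I] by (simp add: N_def hpart_add distrib_right)
    qed
  qed
  moreover have "F \<subseteq> N"
  proof
    fix f assume f: "f \<in> F"
    then have fI: "f \<in> I" using F genideal_superset by blast
    obtain i where "hpart pdeg i f = f" using f F(1) by (auto simp: mem_homogeneous_part_iff)
    then have "hpart pdeg j f = (if i = j then f else 0)" for j by (metis hpart_hpart)
    then show "f \<in> N" using fI ideal_0[OF I] by (simp add: N_def)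
  qed
  ultimately have "I \<subseteq> N" using genideal_subset F by blast
  then show ?thesis using I by (auto simp: graded_ideal_def N_def)
qed

lemma sum_singles: "(\<Sum>k\<in>Poly_Mapping.keys f. Poly_Mapping.single k (Poly_Mapping.lookup f k)) = f"
  by (rule poly_mapping_eqI) (auto simp: lookup_sum lookup_single when_def in_keys_iff)

lemma hpart_homogeneous_mult:
  fixes f g :: "('n::{finite,linorder}, 'k::field) mpoly"
  assumes "hpart pdeg b g = g"
  shows "hpart pdeg a (g * f) = g * hpart pdeg (a - b) f"
proof -
  have "hpart pdeg a (Poly_Mapping.single k c * f) = Poly_Mapping.single k c * hpart pdeg (a - b) f"
    if "k \<in> Poly_Mapping.keys g" for k c
  proof -
    have "pdeg k = b" by (rule assms[unfolded hpart_eq_self_iff, rule_format, OF that])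
    then show ?thesis using hpart_single_mult[of pdeg a k c f] by (simp add: mdeg_add)
  qed
  then have "hpart pdeg a ((\<Sum>k\<in>Poly_Mapping.keys g. Poly_Mapping.single k (Poly_Mapping.lookup g k)) * f)
      = (\<Sum>k\<in>Poly_Mapping.keys g. Poly_Mapping.single k (Poly_Mapping.lookup g k)) * hpart pdeg (a - b) f"
    unfolding sum_distrib_right hpart_sum by (intro sum.cong) auto
  then show ?thesis by (simp add: sum_singles)
qed

lemma ideal_of_hparts:
  assumes "is_ideal N" "\<And>j. hpart pdeg j f \<in> N"
  shows "f \<in> N"
proof -
  have "(\<Sum>j\<in>pdeg ` Poly_Mapping.keys f. hpart pdeg j f) \<in> N" by (rule ideal_sum[OF assms])
  then show ?thesis using sum_hpart[of "pdeg ` Poly_Mapping.keys f" pdeg f] by simp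
qed

lemma hpart_power_homogeneous:
  fixes f g :: "('n::{finite,linorder}, 'k::field) mpoly"
  assumes "hpart pdeg b g = g"
  shows "hpart pdeg a (g ^ m * f) = g ^ m * hpart pdeg (a - int m * b) f"
proof (induction m arbitrary: a)
  case (Suc m)
  have "hpart pdeg a (g ^ Suc m * f) = g * hpart pdeg (a - b) (g ^ m * f)"
    using hpart_homogeneous_mult[OF assms, of a "g ^ m * f"] by (simp add: mult.assoc)
  also have "\<dots> = g * (g ^ m * hpart pdeg (a - b - int m * b) f)" by (simp only: Suc)
  also have "a - b - int m * b = a - int (Suc m) * b" by (simp add: algebra_simps)
  finally show ?case by (simp add: mult.assoc)
qed simp

text \<open>Multiplication by a homogeneous element shifts all degrees by \<open>b\<close>; it may
  kill parts but creates none. This keeps the induction measure below under control.\<close>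

lemma card_degrees_homogeneous_mult:
  fixes f g :: "('n::{finite,linorder}, 'k::field) mpoly"
  assumes "\<And>a. hpart pdeg a f' = g * hpart pdeg (a - b) f"
  shows "card (pdeg ` Poly_Mapping.keys f') \<le> card (pdeg ` Poly_Mapping.keys f)"
proof -
  have deg_iff: "a \<in> pdeg ` Poly_Mapping.keys h \<longleftrightarrow> hpart pdeg a h \<noteq> 0" for a and h :: "('n, 'k) mpoly"
  proof -
    have "hpart pdeg a h = 0 \<longleftrightarrow> Poly_Mapping.keys (hpart pdeg a h) = {}" by auto
    then show ?thesis by (auto simp: keys_hpart)
  qed
  have "pdeg ` Poly_Mapping.keys f' \<subseteq> (\<lambda>a. a + b) ` (pdeg ` Poly_Mapping.keys f)"
  proof
    fix a assume "a \<in> pdeg ` Poly_Mapping.keys f'"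
    then have ne: "hpart pdeg a f' \<noteq> 0" using deg_iff by blast
    have "hpart pdeg (a - b) f \<noteq> 0"
    proof
      assume "hpart pdeg (a - b) f = 0"
      then show False using ne assms[of a] by simp
    qed
    then have "a - b \<in> pdeg ` Poly_Mapping.keys f" using deg_iff by blast
    then show "a \<in> (\<lambda>a. a + b) ` (pdeg ` Poly_Mapping.keys f)" by (intro image_eqI[of _ _ "a - b"]) auto
  qed
  then have "card (pdeg ` Poly_Mapping.keys f') \<le> card ((\<lambda>a. a + b) ` (pdeg ` Poly_Mapping.keys f))"
    by (intro card_mono) auto
  also have "\<dots> \<le> card (pdeg ` Poly_Mapping.keys f)" by (intro card_image_le) auto
  finally show ?thesis .
qed

text \<open>If \<open>g f \<in> I\<close>, then \<open>g\<^sub>b\<^sup>m f\<^sub>a \<in> I\<close> for all homogeneous parts and some \<open>m\<close>. With \<open>A\<close>, \<open>B\<close> the top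
  degrees, \<open>g\<^sub>B f\<^sub>A \<in> I\<close>, so that \<open>g\<^sub>B f\<close> has fewer parts modulo \<open>I\<close>, and then
  \<open>g - g\<^sub>B\<close> has fewer parts than \<open>g\<close>.\<close>

lemma homogeneous_parts_of_zero_divisor:
  assumes I: "graded_ideal I" and gf: "g * f \<in> I"
  shows "\<exists>m. \<forall>a. hpart pdeg b g ^ m * hpart pdeg a f \<in> I"
  using gf
proof (induction "card (pdeg ` Poly_Mapping.keys f) + card (pdeg ` Poly_Mapping.keys g)" arbitrary: f g rule: less_induct)
  case less
  note id = graded_is_ideal[OF I]
  define df where "df = pdeg ` Poly_Mapping.keys f"
  define dg where "dg = pdeg ` Poly_Mapping.keys g"
  have fin: "finite df" "finite dg" by (auto simp: df_def dg_def)
  show ?case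
  proof (cases "f = 0 \<or> g = 0")
    case True
    then have "hpart pdeg b g ^ 1 * hpart pdeg a f \<in> I" for a using ideal_0[OF id] by auto
    then show ?thesis by blast
  next
    case False
    then have "Poly_Mapping.keys f \<noteq> {}" "Poly_Mapping.keys g \<noteq> {}" by auto
    then have ne: "df \<noteq> {}" "dg \<noteq> {}" by (auto simp: df_def dg_def)
    define A where "A = Max df"
    define B where "B = Max dg"
    define gB where "gB = hpart pdeg B g"
    define f' where "f' = f - hpart pdeg A f"
    define g' where "g' = g - gB"
    have AB: "A \<in> df" "B \<in> dg" using fin ne by (auto simp: A_def B_def)
    have gBh: "hpart pdeg B gB = gB" by (simp add: gB_def hpart_hpart)
    have deg_f': "pdeg ` Poly_Mapping.keys f' \<subseteq> df - {A}"
    proof -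
      have "Poly_Mapping.keys f' \<subseteq> {k \<in> Poly_Mapping.keys f. pdeg k \<noteq> A}"
        by (auto simp: f'_def in_keys_iff lookup_minus lookup_hpart when_def split: if_splits)
      then show ?thesis by (auto simp: df_def)
    qed
    have deg_g': "pdeg ` Poly_Mapping.keys g' \<subseteq> dg - {B}"
    proof -
      have "Poly_Mapping.keys g' \<subseteq> {k \<in> Poly_Mapping.keys g. pdeg k \<noteq> B}"
        by (auto simp: g'_def gB_def in_keys_iff lookup_minus lookup_hpart when_def split: if_splits)
      then show ?thesis by (auto simp: dg_def)
    qed
    have card_f': "card (pdeg ` Poly_Mapping.keys f') < card df"
      using card_mono[OF _ deg_f'] fin AB card_Diff1_less[of df A] by (meson finite_Diff le_less_trans)
    have card_g': "card (pdeg ` Poly_Mapping.keys g') < card dg"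
      using card_mono[OF _ deg_g'] fin AB card_Diff1_less[of dg B] by (meson finite_Diff le_less_trans)
    \<comment> \<open>Comparison in degree \<open>A + B\<close>: a part of \<open>g'\<close> has
      degree less than \<open>B\<close> and would have to meet a part of \<open>f\<close> of degree
      above the maximum \<open>A\<close>.\<close>
    have top: "gB * hpart pdeg A f \<in> I"
    proof -
      have f: "f = f' + hpart pdeg A f" and g: "g = g' + gB" by (auto simp: f'_def g'_def)
      have "hpart pdeg (A + B) (gB * f) = gB * hpart pdeg A f"
        using hpart_homogeneous_mult[OF gBh, of "A + B" f] by simp
      moreover have "hpart pdeg (A + B) (g' * f) = 0"
      proof -
        have "hpart pdeg (A + B) (hpart pdeg j g' * f) = 0" for j
        proof (cases "j \<in> pdeg ` Poly_Mapping.keys g'")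
          case True
          then have "j < B" using deg_g' Max_ge[OF fin(2), of j] unfolding B_def by (metis Diff_iff insertI1 order_le_less subsetD)
          have "hpart pdeg (A + B - j) f = 0"
          proof (rule ccontr)
            assume "hpart pdeg (A + B - j) f \<noteq> 0"
            then have "Poly_Mapping.keys (hpart pdeg (A + B - j) f) \<noteq> {}" by simp
            then obtain k where "k \<in> Poly_Mapping.keys f" "pdeg k = A + B - j" by (auto simp: keys_hpart)
            then have "A + B - j \<in> df" unfolding df_def by (intro image_eqI[of _ _ k]) auto
            then have "A + B - j \<le> A" using fin by (simp add: A_def)
            then show False using \<open>j < B\<close> by simp
          qed
          then show ?thesis
            using hpart_homogeneous_mult[of j "hpart pdeg j g'" "A + B" f] by (simp add: hpart_hpart)
        next
          case False
          then have "Poly_Mapping.keys (hpart pdeg j g') = {}" by (auto simp: keys_hpart)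
          then show ?thesis by simp
        qed
        then have "hpart pdeg (A + B) ((\<Sum>j\<in>pdeg ` Poly_Mapping.keys g'. hpart pdeg j g') * f) = 0"
          by (simp add: sum_distrib_right hpart_sum)
        then show ?thesis by (simp add: sum_hpart)
      qed
      moreover have "hpart pdeg (A + B) (g * f) = hpart pdeg (A + B) (g' * f) + hpart pdeg (A + B) (gB * f)"
        unfolding hpart_add[symmetric] distrib_right[symmetric] using g by simp
      ultimately show ?thesis using graded_hpart[OF I less.prems, of "A + B"] by simp
    qed
    \<comment> \<open>By \<open>top\<close> this equals \<open>gB * f\<close> modulo
      \<open>I\<close>, so \<open>g\<close> still annihilates it, and it has fewer parts than
      \<open>f\<close>.\<close>
    define f1 where "f1 = gB * f'"
    have "g * f1 = gB * (g * f) - g * (gB * hpart pdeg A f)" by (simp add: f1_def f'_def algebra_simps)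
    then have gf1: "g * f1 \<in> I" using ideal_diff[OF id] ideal_mult[OF id] less.prems top by simp
    have hf1: "hpart pdeg a f1 = gB * hpart pdeg (a - B) f'" for a
      unfolding f1_def by (rule hpart_homogeneous_mult[OF gBh])
    have "card (pdeg ` Poly_Mapping.keys f1) < card df"
      using card_degrees_homogeneous_mult[of f1 gB B f', OF hf1] card_f' by simp
    then obtain m where m: "\<And>a. hpart pdeg b g ^ m * hpart pdeg a f1 \<in> I"
      using less.hyps[of f1 g, OF _ gf1] unfolding df_def by auto
    have m': "hpart pdeg b g ^ m * (gB * hpart pdeg a f) \<in> I" for a
    proof (cases "a = A")
      case True
      then show ?thesis using top ideal_mult[OF id] by simp
    next
      case False
      then have "hpart pdeg a f' = hpart pdeg a f" by (simp add: f'_def hpart_diff hpart_hpart)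
      then show ?thesis using m[of "a + B"] hf1[of "a + B"] by simp
    qed
    show ?thesis
    proof (cases "b = B")
      case True
      \<comment> \<open>For the top part the additional factor \<open>gB\<close> is absorbed by
        raising the exponent.\<close>
      then have "hpart pdeg b g ^ Suc m * hpart pdeg a f \<in> I" for a
        using m'[of a] by (simp add: gB_def ac_simps)
      then show ?thesis by blast
    next
      case False
      define gb where "gb = hpart pdeg b g"
      have gbh: "hpart pdeg b gb = gb" by (simp add: gb_def hpart_hpart)
      \<comment> \<open>By \<open>m'\<close> every part of \<open>gB * f2\<close> lies in
        \<open>I\<close>. Hence \<open>g' = g - gB\<close> annihilates \<open>f2\<close> too; it has
        fewer parts than \<open>g\<close> and, as \<open>b\<close> differs from \<open>B\<close>,
        the same part in degree \<open>b\<close>.\<close>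
      define f2 where "f2 = gb ^ m * f"
      have hf2: "hpart pdeg a f2 = gb ^ m * hpart pdeg (a - int m * b) f" for a
        unfolding f2_def by (rule hpart_power_homogeneous[OF gbh])
      have "hpart pdeg a (gB * f2) \<in> I" for a
        using m'[of "a - B - int m * b"] hpart_homogeneous_mult[OF gBh, of a f2]
        by (simp add: hf2 gb_def mult.left_commute)
      then have "gB * f2 \<in> I" using ideal_of_hparts[OF id] by blast
      moreover have "g * f2 \<in> I"
        using ideal_mult[OF id less.prems, of "gb ^ m"] by (simp add: f2_def mult.left_commute)
      ultimately have "g' * f2 \<in> I"
        using ideal_diff[OF id, of "g * f2" "gB * f2"] by (simp add: g'_def left_diff_distrib)
      moreover have "card (pdeg ` Poly_Mapping.keys f2) \<le> card df"
        unfolding df_def by (rule card_degrees_homogeneous_mult[of f2 "gb ^ m" "int m * b" f, OF hf2])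
      ultimately obtain k where k: "\<And>a. hpart pdeg b g' ^ k * hpart pdeg a f2 \<in> I"
        using less.hyps[of f2 g'] card_g' unfolding df_def dg_def by fastforce
      have "hpart pdeg b g' = gb" using False by (simp add: g'_def gB_def gb_def hpart_diff hpart_hpart)
      then have "gb ^ (k + m) * hpart pdeg a f \<in> I" for a
        using k[of "a + int m * b"] by (simp add: hf2 power_add mult.assoc)
      then show ?thesis unfolding gb_def by blast
    qed
  qed
qed

text \<open>For a large component \<open>q\<close>, some \<open>g\<close> outside its radical lies
  in all small components, so \<open>g * f\<close> is in \<open>I\<close> for every \<open>f\<close>
  in the intersection of the large ones. The homogeneity of \<open>I\<close> then enters through
  \<open>homogeneous_parts_of_zero_divisor\<close>.\<close>

lemma graded_dim_filtration_ideal: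
  fixes I :: "('n::{finite,linorder}, 'k::field) mpoly set"
  assumes I: "graded_ideal I" and Q: "reduced_primary_decomposition mpoly_ring I Q"
  shows "graded_ideal (dim_filtration_ideal Q i)"
proof -
  let ?rad = "radical mpoly_ring"
  let ?big = "\<lambda>q. krull_dim (mpoly_ring Quot ?rad q) > ereal (real_of_int i)"
  have prim: "primary_ideal mpoly_ring q" if "q \<in> Q" for q
    using Q that by (simp add: reduced_primary_decomposition_def)
  note pr = primary_ideal_type[OF prim]
  have fin: "finite Q" and IQ: "I = \<Inter>Q" using Q by (auto simp: reduced_primary_decomposition_def)
  have D: "dim_filtration_ideal Q i = \<Inter>{q \<in> Q. ?big q}" by (simp add: dim_filtration_ideal_def)
  have "hpart pdeg a f \<in> q" if f: "f \<in> dim_filtration_ideal Q i" and q: "q \<in> Q" "?big q" for f a q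
  proof -
    \<comment> \<open>If a small component lay in the radical of \<open>q\<close>, its own radical
      would too, and the dimension belonging to \<open>q\<close> could not be the larger
      one.\<close>
    have "\<exists>x. x \<in> q' \<and> x \<notin> ?rad q" if q': "q' \<in> Q" "\<not> ?big q'" for q'
    proof (rule ccontr)
      assume "\<not> ?thesis"
      then have sub: "q' \<subseteq> ?rad q" by blast
      have "?rad q' \<subseteq> ?rad q"
      proof
        fix x assume "x \<in> ?rad q'"
        then obtain k where "x ^ k \<in> q'" by (auto simp: radical_iff)
        then show "x \<in> ?rad q" using sub prime_power[OF pr(2)[OF q(1)]] by blast
      qed
      then have "krull_dim (mpoly_ring Quot ?rad q) \<le> krull_dim (mpoly_ring Quot ?rad q')"
        using pr(2) q(1) q'(1) prime_is_ideal by (intro krull_dim_Quot_antimono) auto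
      then show False using q(2) q'(2) by simp
    qed
    then obtain x where x: "\<And>q'. q' \<in> Q \<Longrightarrow> \<not> ?big q' \<Longrightarrow> x q' \<in> q' \<and> x q' \<notin> ?rad q" by metis
    define g where "g = (\<Prod>q'\<in>{q' \<in> Q. \<not> ?big q'}. x q')"
    have g: "g \<notin> ?rad q"
      using prime_prod[OF pr(2)[OF q(1)], of "{q' \<in> Q. \<not> ?big q'}" x] x fin unfolding g_def by auto
    have "g * f \<in> q'" if q': "q' \<in> Q" for q'
    proof (cases "?big q'")
      case True
      then show ?thesis using f q' ideal_mult[OF pr(1)[OF q']] unfolding D by blast
    next
      case False
      then have "g \<in> q'" unfolding g_def
        using fin q' x by (intro ideal_prod_dvd[OF pr(1)[OF q'], where i = q']) auto
      then show ?thesis using ideal_mult2[OF pr(1)[OF q']] by blast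
    qed
    then have gf: "g * f \<in> I" unfolding IQ by blast
    \<comment> \<open>The radical of \<open>q\<close> need not be homogeneous, but some part of
      \<open>g\<close> lies outside it. A power of this part carries every part of \<open>f\<close>
      into \<open>I\<close>, hence into \<open>q\<close>, and is cancelled because \<open>q\<close>
      is primary.\<close>
    have "\<exists>b. hpart pdeg b g \<notin> ?rad q"
      using ideal_of_hparts[OF prime_is_ideal[OF pr(2)[OF q(1)]]] g by blast
    then obtain b where b: "hpart pdeg b g \<notin> ?rad q" by blast
    obtain m where "hpart pdeg b g ^ m * hpart pdeg a f \<in> I"
      using homogeneous_parts_of_zero_divisor[OF I gf] by blast
    then have "hpart pdeg a f * hpart pdeg b g ^ m \<in> q" using q(1) unfolding IQ by (simp add: mult.commute)
    moreover have "hpart pdeg b g ^ m \<notin> ?rad q" using b prime_power[OF pr(2)[OF q(1)]] by blast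
    ultimately show ?thesis using pr(4)[OF q(1)] by blast
  qed
  moreover have "is_ideal (dim_filtration_ideal Q i)"
    unfolding D using pr(1) by (intro ideal_Inter) auto
  ultimately show ?thesis unfolding graded_ideal_def D by blast
qed

lemma dim_filtration_ideal_mono: "i \<le> j \<Longrightarrow> dim_filtration_ideal Q i \<subseteq> dim_filtration_ideal Q j"
  unfolding dim_filtration_ideal_def
proof (rule Inter_anti_mono, safe)
  fix x assume "i \<le> j" "ereal (real_of_int j) < krull_dim (mpoly_ring Quot radical mpoly_ring x)"
  moreover from this(1) have "ereal (real_of_int i) \<le> ereal (real_of_int j)" by simp
  ultimately show "ereal (real_of_int i) < krull_dim (mpoly_ring Quot radical mpoly_ring x)"
    by (rule_tac le_less_trans)
qed

text \<open>Radicals of primary ideals are prime, so their quotients have dimension at least 0 and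
  no component is left out.\<close>

lemma dim_filtration_ideal_bot:
  fixes I :: "('n::{finite,linorder}, 'k::field) mpoly set"
  assumes Q: "reduced_primary_decomposition mpoly_ring I Q"
  shows "dim_filtration_ideal Q (- 1) = I"
proof -
  have "ereal (real_of_int (- 1)) < krull_dim (mpoly_ring Quot radical mpoly_ring q)" if "q \<in> Q" for q
  proof -
    have "primary_ideal mpoly_ring q" using Q that by (simp add: reduced_primary_decomposition_def)
    then have P: "is_prime (radical mpoly_ring q)" by (rule primary_ideal_type)
    then have "prime_chain (radical mpoly_ring q) 0" by (auto simp: prime_chain_def)
    from prime_chain_le_krull_dim[OF prime_is_ideal[OF P] this]
    have "ereal 0 \<le> krull_dim (mpoly_ring Quot radical mpoly_ring q)" by simp
    moreover have "ereal (real_of_int (- 1)) < ereal 0" by simp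
    ultimately show ?thesis by (rule less_le_trans[rotated])
  qed
  then have "{q \<in> Q. ereal (real_of_int (- 1)) < krull_dim (mpoly_ring Quot radical mpoly_ring q)} = Q" by blast
  then show ?thesis using Q unfolding dim_filtration_ideal_def reduced_primary_decomposition_def by simp
qed

lemma dim_filtration_ideal_top:
  fixes I :: "('n::{finite,linorder}, 'k::field) mpoly set"
  assumes Q: "reduced_primary_decomposition mpoly_ring I Q" and I: "is_ideal I"
    and d: "krull_dim (mpoly_ring Quot I) = ereal (real d)"
  shows "dim_filtration_ideal Q (int d) = UNIV"
proof -
  have "\<not> ereal (real_of_int (int d)) < krull_dim (mpoly_ring Quot radical mpoly_ring q)" if q: "q \<in> Q" for q
  proof -
    have p: "primary_ideal mpoly_ring q" using Q q by (simp add: reduced_primary_decomposition_def)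
    have "I \<subseteq> q" using Q q unfolding reduced_primary_decomposition_def by blast
    then have "I \<subseteq> radical mpoly_ring q" using primary_ideal_type(3)[OF p] by blast
    then have "krull_dim (mpoly_ring Quot radical mpoly_ring q) \<le> krull_dim (mpoly_ring Quot I)"
      by (intro krull_dim_Quot_antimono I prime_is_ideal primary_ideal_type(2)[OF p])
    then show ?thesis using d by simp
  qed
  then have "{q \<in> Q. ereal (real_of_int (int d)) < krull_dim (mpoly_ring Quot radical mpoly_ring q)} = {}" by blast
  then show ?thesis unfolding dim_filtration_ideal_def by (simp only: Inter_empty)
qed

section \<open>Presentations of modules\<close>

text \<open>The module \<open>M\<close> is the quotient of the subgroup \<open>W\<close> of a type by \<open>K\<close>, through the map \<open>q\<close>.\<close>

locale presentation =
  fixes scal :: "'r \<Rightarrow> 'a::ab_group_add \<Rightarrow> 'a" and q :: "'a \<Rightarrow> 'm" and W K :: "'a set"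
    and M :: "('r, 'm, 'c) module_scheme"
  assumes zero_mem: "0 \<in> W" and diff_mem: "x \<in> W \<Longrightarrow> y \<in> W \<Longrightarrow> x - y \<in> W"
    and scal_mem: "x \<in> W \<Longrightarrow> scal r x \<in> W"
    and carrier: "carrier M = q ` W" and zero: "\<zero>\<^bsub>M\<^esub> = q 0"
    and plus: "x \<in> W \<Longrightarrow> y \<in> W \<Longrightarrow> q x \<oplus>\<^bsub>M\<^esub> q y = q (x + y)"
    and smult: "x \<in> W \<Longrightarrow> r \<odot>\<^bsub>M\<^esub> q x = q (scal r x)"
    and eq_iff: "x \<in> W \<Longrightarrow> y \<in> W \<Longrightarrow> q x = q y \<longleftrightarrow> x - y \<in> K"
begin

lemma add_mem: "x \<in> W \<Longrightarrow> y \<in> W \<Longrightarrow> x + y \<in> W"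
  using diff_mem[of x "0 - y"] diff_mem[of 0 y] zero_mem by simp

lemma sum_mem: "(\<And>i. i \<in> A \<Longrightarrow> g i \<in> W) \<Longrightarrow> sum g A \<in> W"
  by (induction A rule: infinite_finite_induct) (auto simp: zero_mem add_mem)

lemma eq_zero_iff: "x \<in> W \<Longrightarrow> q x = \<zero>\<^bsub>M\<^esub> \<longleftrightarrow> x \<in> K"
  using eq_iff[of x 0] zero_mem by (simp add: zero)

lemma is_abelian_monoid: "abelian_monoid M"
proof (rule abelian_monoidI)
  show "\<zero>\<^bsub>M\<^esub> \<in> carrier M" using zero_mem by (simp add: carrier zero)
  fix x y assume "x \<in> carrier M" "y \<in> carrier M"
  then obtain a b where ab: "x = q a" "y = q b" "a \<in> W" "b \<in> W" unfolding carrier by blast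
  show "x \<oplus>\<^bsub>M\<^esub> y \<in> carrier M" using ab add_mem by (simp add: plus carrier)
  show "x \<oplus>\<^bsub>M\<^esub> y = y \<oplus>\<^bsub>M\<^esub> x" using ab by (simp add: plus add.commute)
  show "\<zero>\<^bsub>M\<^esub> \<oplus>\<^bsub>M\<^esub> x = x" using ab zero_mem by (simp add: plus zero)
  fix z assume "z \<in> carrier M"
  then obtain c where c: "z = q c" "c \<in> W" unfolding carrier by blast
  show "x \<oplus>\<^bsub>M\<^esub> y \<oplus>\<^bsub>M\<^esub> z = x \<oplus>\<^bsub>M\<^esub> (y \<oplus>\<^bsub>M\<^esub> z)"
    using ab c add_mem by (simp add: plus add.assoc)
qed

lemma finsum_eq:
  assumes "finite A" "\<And>i. i \<in> A \<Longrightarrow> g i \<in> W" "\<And>i. i \<in> A \<Longrightarrow> f i = q (g i)"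
  shows "(\<Oplus>\<^bsub>M\<^esub>i\<in>A. f i) = q (sum g A)"
proof -
  interpret abelian_monoid M by (rule is_abelian_monoid)
  show ?thesis using assms
  proof (induction A rule: finite_induct)
    case empty
    then show ?case by (simp add: zero)
  next
    case (insert x A)
    have "f \<in> A \<rightarrow> carrier M" "f x \<in> carrier M" using insert.prems by (auto simp: carrier)
    then have "(\<Oplus>\<^bsub>M\<^esub>i\<in>insert x A. f i) = f x \<oplus>\<^bsub>M\<^esub> (\<Oplus>\<^bsub>M\<^esub>i\<in>A. f i)"
      using insert.hyps by (intro finsum_insert)
    also have "\<dots> = q (g x + sum g A)" using insert sum_mem[of A g] by (simp add: plus)
    finally show ?case using insert.hyps by simp
  qed
qed

end

text \<open>Passing to a quotient keeps the presenting group \<open>W\<close> and only enlarges the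
  kernel. Iterated coset constructions such as \<open>local_cohomology\<close> thus stay presented
  by cochains of Laurent polynomials.\<close>

lemma presentation_quot:
  fixes M :: "('r, 'm) graded_module"
  assumes "presentation scal q W K M"
    and Y: "K \<subseteq> Y" "Y \<subseteq> W" "\<And>x y. x \<in> Y \<Longrightarrow> y \<in> Y \<Longrightarrow> x - y \<in> Y" "\<And>r x. x \<in> Y \<Longrightarrow> scal r x \<in> Y"
    and scal_diff: "\<And>r x y. scal r (x - y) = scal r x - scal r y"
  shows "presentation scal (\<lambda>x. q ` Y +>\<^bsub>M\<^esub> q x) W Y (graded_quot M (q ` Y))"
proof -
  interpret presentation scal q W K M by fact
  define c where "c x = q ` Y +>\<^bsub>M\<^esub> q x" for x
  have K0: "0 \<in> K" using eq_iff[OF zero_mem zero_mem] by simp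
  have Y0: "0 \<in> Y" using K0 Y by blast
  have Y_add: "x + y \<in> Y" if "x \<in> Y" "y \<in> Y" for x y
    using Y(3)[OF that(1) Y(3)[OF Y0 that(2)]] by simp
  \<comment> \<open>Cosets in \<open>M\<close> become images of the cosets x + Y in
    \<open>W\<close>; since \<open>K\<close> is contained in \<open>Y\<close>, their equality can
    then be tested in \<open>W\<close>.\<close>
  have c_eq: "c x = q ` {z \<in> W. z - x \<in> Y}" if x: "x \<in> W" for x
  proof -
    have "c x = (\<lambda>y. q (y + x)) ` Y"
      using Y(2) x plus by (auto simp: c_def a_r_coset_def' image_iff subset_iff)
    also have "\<dots> = q ` {z \<in> W. z - x \<in> Y}"
    proof (intro equalityI subsetI)
      fix u assume "u \<in> (\<lambda>y. q (y + x)) ` Y"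
      then obtain y where "u = q (y + x)" "y \<in> Y" by blast
      then show "u \<in> q ` {z \<in> W. z - x \<in> Y}" using Y(2) x add_mem by (intro image_eqI[of _ _ "y + x"]) auto
    next
      fix u assume "u \<in> q ` {z \<in> W. z - x \<in> Y}"
      then obtain z where "u = q z" "z - x \<in> Y" by blast
      then show "u \<in> (\<lambda>y. q (y + x)) ` Y" by (intro image_eqI[of _ _ "z - x"]) auto
    qed
    finally show ?thesis .
  qed
  have c_iff: "c x = c y \<longleftrightarrow> x - y \<in> Y" if xy: "x \<in> W" "y \<in> W" for x y
  proof
    assume e: "c x = c y"
    have "q x \<in> c x" using c_eq[OF xy(1)] xy Y0 by auto
    then have "q x \<in> q ` {z \<in> W. z - y \<in> Y}" using e c_eq[OF xy(2)] by simp
    then obtain z where z: "q x = q z" "z \<in> W" "z - y \<in> Y" by blast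
    then have "x - z \<in> Y" using eq_iff[OF xy(1) z(2)] Y(1) by blast
    then have "(x - z) + (z - y) \<in> Y" using z(3) Y_add by blast
    then show "x - y \<in> Y" by simp
  next
    assume d: "x - y \<in> Y"
    have "z - x \<in> Y \<longleftrightarrow> z - y \<in> Y" for z
    proof
      show "z - y \<in> Y" if "z - x \<in> Y" using Y_add[OF that d] by simp
      show "z - x \<in> Y" if "z - y \<in> Y" using Y(3)[OF that d] by simp
    qed
    then show "c x = c y" by (simp add: c_eq xy)
  qed
  show ?thesis
    unfolding c_def[symmetric]
  proof
    show "carrier (graded_quot M (q ` Y)) = c ` W"
      by (auto simp: graded_quot_def A_RCOSETS_def' carrier c_def)
    have "c 0 = q ` Y" using c_eq[OF zero_mem] Y(2) by (auto intro!: arg_cong[where f = "image q"])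
    then show "\<zero>\<^bsub>graded_quot M (q ` Y)\<^esub> = c 0" by (simp add: graded_quot_def)
    fix x assume x: "x \<in> W"
    show "r \<odot>\<^bsub>graded_quot M (q ` Y)\<^esub> c x = c (scal r x)" for r
    proof -
      have "c (scal r z) = c (scal r x)" if "z \<in> W" "z - x \<in> Y" for z
        using c_iff[OF scal_mem[OF that(1)] scal_mem[OF x]] Y(4)[OF that(2)] by (simp add: scal_diff)
      then have "(\<Union>u\<in>c x. q ` Y +>\<^bsub>M\<^esub> (r \<odot>\<^bsub>M\<^esub> u)) = (\<Union>u\<in>c x. c (scal r x))"
        unfolding c_eq[OF x] by (auto simp: smult c_def)
      moreover have "q x \<in> c x" using c_eq[OF x] x Y0 by auto
      ultimately show ?thesis by (auto simp: graded_quot_def)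
    qed
    fix y assume y: "y \<in> W"
    show "c x \<oplus>\<^bsub>graded_quot M (q ` Y)\<^esub> c y = c (x + y)"
    proof -
      have "c x <+>\<^bsub>M\<^esub> c y = q ` {z \<in> W. z - (x + y) \<in> Y}"
      proof (intro equalityI subsetI)
        fix u assume "u \<in> c x <+>\<^bsub>M\<^esub> c y"
        then obtain z z' where z: "u = q z \<oplus>\<^bsub>M\<^esub> q z'" "z \<in> W" "z' \<in> W" "z - x \<in> Y" "z' - y \<in> Y"
          unfolding c_eq[OF x] c_eq[OF y] set_add_def' by blast
        have "z + z' - (x + y) \<in> Y" using Y_add[OF z(4,5)] by (simp add: algebra_simps)
        then show "u \<in> q ` {z \<in> W. z - (x + y) \<in> Y}" using z add_mem by (auto simp: plus)
      next
        fix u assume "u \<in> q ` {z \<in> W. z - (x + y) \<in> Y}"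
        then obtain z where z: "u = q z" "z \<in> W" "z - (x + y) \<in> Y" by blast
        have "q (z - y) \<in> c x" "q y \<in> c y"
          using z diff_mem[OF z(2) y] y Y0 by (auto simp: c_eq x y algebra_simps intro!: imageI)
        moreover have "u = q (z - y) \<oplus>\<^bsub>M\<^esub> q y" using z y diff_mem by (simp add: plus)
        ultimately show "u \<in> c x <+>\<^bsub>M\<^esub> c y" unfolding set_add_def' by blast
      qed
      then show ?thesis using x y add_mem by (simp add: graded_quot_def c_eq)
    qed
  qed (use zero_mem diff_mem scal_mem c_iff in auto)
qed

lemma presentation_sub:
  fixes M :: "('r, 'm) graded_module"
  assumes "presentation scal q W K M" "W' \<subseteq> W" "0 \<in> W'"
    "\<And>x y. x \<in> W' \<Longrightarrow> y \<in> W' \<Longrightarrow> x - y \<in> W'" "\<And>r x. x \<in> W' \<Longrightarrow> scal r x \<in> W'"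
  shows "presentation scal q W' K (graded_sub M (q ` W'))"
proof -
  interpret presentation scal q W K M by fact
  show ?thesis
  proof
    show "q x \<oplus>\<^bsub>graded_sub M (q ` W')\<^esub> q y = q (x + y)" if "x \<in> W'" "y \<in> W'" for x y
      using that assms(2) plus by (auto simp: graded_sub_def)
    show "r \<odot>\<^bsub>graded_sub M (q ` W')\<^esub> q x = q (scal r x)" if "x \<in> W'" for x r
      using that assms(2) smult by (auto simp: graded_sub_def)
    show "q x = q y \<longleftrightarrow> x - y \<in> K" if "x \<in> W'" "y \<in> W'" for x y
      using that assms(2) eq_iff by blast
    show "\<zero>\<^bsub>graded_sub M (q ` W')\<^esub> = q 0" using zero by (simp add: graded_sub_def)
    show "carrier (graded_sub M (q ` W')) = q ` W'" by (simp add: graded_sub_def)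
  qed (use assms in auto)
qed

text \<open>\<open>B\<close> has to agree with the kernel \<open>K\<close> on \<open>Y\<close> only:
  in the applications \<open>Y\<close> is a homogeneous piece and \<open>B\<close> the kernel in
  that degree. \<open>g\<close> lifts the elements of \<open>E1\<close>, and coefficients correspond
  because \<open>q\<close> undoes \<open>g\<close>.\<close>

lemma k_basis_iff:
  fixes M :: "('n::{finite,linorder}, 'k::field, 'm) gmod"
  assumes "presentation scal q W K M" and vs: "vector_space (\<lambda>c. scal (const c))"
    and Y: "module.subspace (\<lambda>c. scal (const c)) Y" "Y \<subseteq> W" "\<And>y. y \<in> Y \<Longrightarrow> y \<in> K \<longleftrightarrow> y \<in> B"
    and g: "\<And>b. b \<in> E1 \<Longrightarrow> g b \<in> Y \<and> q (g b) = b" and fin: "finite E1"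
  shows "k_basis M (q ` Y) E1 \<longleftrightarrow> rel_basis (\<lambda>c. scal (const c)) Y B (g ` E1)"
proof -
  interpret presentation scal q W K M by fact
  interpret vs: vector_space "\<lambda>c. scal (const c)" by fact
  have inj: "inj_on g E1" using g by (metis inj_onI)
  have memY: "(\<Sum>b\<in>E1. scal (const (c b)) (g b)) \<in> Y" for c
    using g Y(1) by (intro vs.subspace_sum vs.subspace_scale) auto
  have fs: "(\<Oplus>\<^bsub>M\<^esub>b\<in>E1. const (c b) \<odot>\<^bsub>M\<^esub> b) = q (\<Sum>b\<in>E1. scal (const (c b)) (g b))" for c
  proof (rule finsum_eq[OF fin])
    fix b assume b: "b \<in> E1"
    then have gb: "g b \<in> W" "q (g b) = b" using g Y(2) by auto
    then show "scal (const (c b)) (g b) \<in> W" by (rule_tac scal_mem)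
    show "const (c b) \<odot>\<^bsub>M\<^esub> b = q (scal (const (c b)) (g b))" using smult[OF gb(1)] gb(2) by simp
  qed
  have ri: "(\<Sum>x\<in>g ` E1. scal (const (c x)) x) = (\<Sum>b\<in>E1. scal (const (c (g b))) (g b))" for c
    by (simp add: sum.reindex[OF inj])
  have lin: "(\<forall>c. (\<Oplus>\<^bsub>M\<^esub>b\<in>E1. const (c b) \<odot>\<^bsub>M\<^esub> b) = \<zero>\<^bsub>M\<^esub> \<longrightarrow> (\<forall>b\<in>E1. c b = 0)) \<longleftrightarrow>
     (\<forall>c. (\<Sum>x\<in>g ` E1. scal (const (c x)) x) \<in> B \<longrightarrow> (\<forall>x\<in>g ` E1. c x = 0))" (is "?A \<longleftrightarrow> ?B")
  proof -
    have 1: "(\<Oplus>\<^bsub>M\<^esub>b\<in>E1. const (c b) \<odot>\<^bsub>M\<^esub> b) = \<zero>\<^bsub>M\<^esub> \<longleftrightarrow> (\<Sum>b\<in>E1. scal (const (c b)) (g b)) \<in> B" for c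
      unfolding fs using eq_zero_iff[of "\<Sum>b\<in>E1. scal (const (c b)) (g b)"] memY[of c] Y(2,3) by blast
    show ?thesis
    proof
      assume A: ?A
      show ?B
      proof (intro allI impI)
        fix c assume "(\<Sum>x\<in>g ` E1. scal (const (c x)) x) \<in> B"
        then have "(\<Oplus>\<^bsub>M\<^esub>b\<in>E1. const (c (g b)) \<odot>\<^bsub>M\<^esub> b) = \<zero>\<^bsub>M\<^esub>" unfolding 1 ri .
        from A[rule_format, OF this] show "\<forall>x\<in>g ` E1. c x = 0" by simp
      qed
    next
      assume B: ?B
      show ?A
      proof (intro allI impI)
        fix c assume "(\<Oplus>\<^bsub>M\<^esub>b\<in>E1. const (c b) \<odot>\<^bsub>M\<^esub> b) = \<zero>\<^bsub>M\<^esub>"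
        then have "(\<Sum>b\<in>E1. scal (const (c b)) (g b)) \<in> B" unfolding 1 .
        moreover have "(\<Sum>b\<in>E1. scal (const (c b)) (g b)) = (\<Sum>b\<in>E1. scal (const (c (q (g b)))) (g b))"
          using g by (intro sum.cong) auto
        ultimately have S: "(\<Sum>x\<in>g ` E1. scal (const (c (q x))) x) \<in> B"
          unfolding ri[of "\<lambda>x. c (q x)"] by simp
        have "c (q x) = 0" if "x \<in> g ` E1" for x using B[rule_format, of "\<lambda>x. c (q x)" x] S that by simp
        then have "c (q (g b)) = 0" if "b \<in> E1" for b using that by blast
        then show "\<forall>b\<in>E1. c b = 0" using g by simp
      qed
    qed
  qed
  have span: "(\<forall>x\<in>q ` Y. \<exists>c. x = (\<Oplus>\<^bsub>M\<^esub>b\<in>E1. const (c b) \<odot>\<^bsub>M\<^esub> b)) \<longleftrightarrow>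
     (\<forall>z\<in>Y. \<exists>c. z - (\<Sum>x\<in>g ` E1. scal (const (c x)) x) \<in> B)" (is "?A \<longleftrightarrow> ?B")
  proof -
    have 1: "q z = (\<Oplus>\<^bsub>M\<^esub>b\<in>E1. const (c b) \<odot>\<^bsub>M\<^esub> b) \<longleftrightarrow> z - (\<Sum>b\<in>E1. scal (const (c b)) (g b)) \<in> B"
      if "z \<in> Y" for z c
    proof -
      have "z - (\<Sum>b\<in>E1. scal (const (c b)) (g b)) \<in> Y" using that memY Y(1) vs.subspace_diff by blast
      then show ?thesis
        unfolding fs using eq_iff[of z "\<Sum>b\<in>E1. scal (const (c b)) (g b)"] that memY[of c] Y(2,3) by blast
    qed
    show ?thesis
    proof
      assume A: ?A
      show ?B
      proof
        fix z assume z: "z \<in> Y"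
        then obtain c where "q z = (\<Oplus>\<^bsub>M\<^esub>b\<in>E1. const (c b) \<odot>\<^bsub>M\<^esub> b)" using A by blast
        then have "z - (\<Sum>b\<in>E1. scal (const (c b)) (g b)) \<in> B" using 1[OF z] by blast
        moreover have "(\<Sum>b\<in>E1. scal (const (c b)) (g b)) = (\<Sum>b\<in>E1. scal (const (c (q (g b)))) (g b))"
          using g by (intro sum.cong) auto
        ultimately have "z - (\<Sum>x\<in>g ` E1. scal (const (c (q x))) x) \<in> B" unfolding ri[of "\<lambda>x. c (q x)"] by simp
        then show "\<exists>c. z - (\<Sum>x\<in>g ` E1. scal (const (c x)) x) \<in> B" by (rule exI[where x = "\<lambda>x. c (q x)"])
      qed
    next
      assume B: ?B
      show ?A
      proof
        fix x assume "x \<in> q ` Y"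
        then obtain z where z: "x = q z" "z \<in> Y" by blast
        then obtain c where "z - (\<Sum>x\<in>g ` E1. scal (const (c x)) x) \<in> B" using B by blast
        then have "x = (\<Oplus>\<^bsub>M\<^esub>b\<in>E1. const (c (g b)) \<odot>\<^bsub>M\<^esub> b)" unfolding ri z(1) 1[OF z(2)] .
        then show "\<exists>c. x = (\<Oplus>\<^bsub>M\<^esub>b\<in>E1. const (c b) \<odot>\<^bsub>M\<^esub> b)" by (rule exI[where x = "\<lambda>b. c (g b)"])
      qed
    qed
  qed
  have sub: "E1 \<subseteq> q ` Y" "g ` E1 \<subseteq> Y"
    using g by (force simp: image_iff)+
  show ?thesis unfolding k_basis_def rel_basis_def lin span using sub fin by blast
qed

text \<open>Finiteness makes some basis available, so the choice inside \<open>k_dim\<close> is a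
  genuine basis; any basis lifts to a relative basis, and those all have the same size.\<close>

lemma k_dim_eq_qd:
  fixes M :: "('n::{finite,linorder}, 'k::field, 'm) gmod"
  assumes pres: "presentation scal q W K M" and vs: "vector_space (\<lambda>c. scal (const c))"
    and Y: "module.subspace (\<lambda>c. scal (const c)) Y" "Y \<subseteq> W" "\<And>y. y \<in> Y \<Longrightarrow> y \<in> K \<longleftrightarrow> y \<in> B"
    and B: "module.subspace (\<lambda>c. scal (const c)) B" and fin: "qfin (\<lambda>c. scal (const c)) Y B"
  shows "k_dim M (q ` Y) = qd (\<lambda>c. scal (const c)) Y B"
proof -
  interpret presentation scal q W K M by fact
  interpret vs: vector_space "\<lambda>c. scal (const c)" by fact
  have iff: "k_basis M (q ` Y) E1 \<longleftrightarrow> rel_basis (\<lambda>c. scal (const c)) Y B (g ` E1)"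
    if "\<And>b. b \<in> E1 \<Longrightarrow> g b \<in> Y \<and> q (g b) = b" "finite E1" for g E1
    using that by (intro k_basis_iff[OF pres vs Y]) auto
  obtain E where E: "rel_basis (\<lambda>c. scal (const c)) Y B E" using fin by (auto simp: qfin_def)
  have EY: "E \<subseteq> Y" "finite E" using E by (auto simp: rel_basis_def)
  have injE: "inj_on q E"
  proof (rule inj_onI)
    fix x y assume xy: "x \<in> E" "y \<in> E" "q x = q y"
    have "x - y \<in> Y" using xy EY Y(1) vs.subspace_diff by blast
    then have "x - y \<in> B" using eq_iff[of x y] xy EY Y(2,3) by blast
    then show "x = y" using vs.rel_basis_inj[OF E xy(1,2)] by simp
  qed
  have "k_basis M (q ` Y) (q ` E)"
  proof -
    have inv: "inv_into E q ` q ` E = E" using injE by (simp add: image_image)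
    have "inv_into E q b \<in> Y \<and> q (inv_into E q b) = b" if "b \<in> q ` E" for b
      using that EY f_inv_into_f[OF that] inv_into_into[OF that] by blast
    then show ?thesis using iff[of "q ` E" "inv_into E q"] EY(2) E inv by simp
  qed
  then have ex: "k_basis M (q ` Y) (SOME B. k_basis M (q ` Y) B)" by (rule someI)
  define E1 where "E1 = (SOME B. k_basis M (q ` Y) B)"
  have E1_fin: "finite E1" and E1: "E1 \<subseteq> q ` Y" using ex unfolding E1_def[symmetric] by (auto simp: k_basis_def)
  have g: "inv_into Y q b \<in> Y \<and> q (inv_into Y q b) = b" if "b \<in> E1" for b
    using E1 that by (auto simp: f_inv_into_f inv_into_into subset_iff)
  have "rel_basis (\<lambda>c. scal (const c)) Y B (inv_into Y q ` E1)"
    using iff[of E1 "inv_into Y q", OF g E1_fin] ex unfolding E1_def[symmetric] by blast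
  then have "qd (\<lambda>c. scal (const c)) Y B = card (inv_into Y q ` E1)" using vs.qd_eq_card[OF Y(1) B] by blast
  also have "\<dots> = card E1" using g by (intro card_image) (metis inj_onI)
  finally show ?thesis unfolding k_dim_def E1_def by simp
qed

section \<open>Presentations of subquotients of the polynomial ring\<close>

lemma presentation_regular: "presentation (*) (\<lambda>x. x) UNIV {0} regular_module"
  by unfold_locales (auto simp: regular_module_def)

definition subquotient :: "('n::{finite,linorder}, 'k::field) mpoly set \<Rightarrow> ('n, 'k) mpoly set \<Rightarrow> ('n, 'k, ('n, 'k) mpoly set) gmod" where
  "subquotient N1 N2 = graded_quot (graded_sub regular_module N1) N2"

definition coset_in :: "('n::{finite,linorder}, 'k::field) mpoly set \<Rightarrow> ('n, 'k) mpoly set \<Rightarrow> ('n, 'k) mpoly \<Rightarrow> ('n, 'k) mpoly set" where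
  "coset_in N1 N2 x = N2 +>\<^bsub>graded_sub regular_module N1\<^esub> x"

lemma presentation_subquotient:
  assumes "is_ideal N1" "is_ideal N2" "N2 \<subseteq> N1"
  shows "presentation (*) (coset_in N1 N2) N1 N2 (subquotient N1 N2)"
proof -
  have 1: "presentation (*) (\<lambda>x. x) N1 {0} (graded_sub regular_module N1)"
    using presentation_sub[OF presentation_regular, of N1] assms
    by (simp add: ideal_0 ideal_diff ideal_mult)
  show ?thesis
    using presentation_quot[OF 1, of N2] assms
    by (simp add: ideal_0 ideal_diff ideal_mult subquotient_def coset_in_def[abs_def] right_diff_distrib)
qed

lemma quot_regular_module: "graded_quot regular_module I = subquotient UNIV I"
  by (simp add: subquotient_def graded_sub_def regular_module_def)

lemma piece_subquotient: "piece (subquotient N1 N2) j = coset_in N1 N2 ` (N1 \<inter> homogeneous_part j)"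
  by (simp add: subquotient_def graded_quot_def coset_in_def graded_sub_def regular_module_def a_r_coset_def')

lemma R_subspace_ideal: "is_ideal N \<Longrightarrow> R.subspace N"
  by (auto simp: R.subspace_def ideal_0 ideal_add ideal_mult)

lemma R_subspace_homogeneous_part: "R.subspace (homogeneous_part j)"
  by (auto simp: R.subspace_def mem_homogeneous_part_iff hpart_add hpart_const_mult)

lemma annihilator_subquotient:
  assumes N: "is_ideal N1" "is_ideal N2" "N2 \<subseteq> N1"
  shows "annihilator mpoly_ring (subquotient N1 N2) = ann N1 N2"
proof -
  interpret presentation "(*)" "coset_in N1 N2" N1 N2 "subquotient N1 N2"
    by (rule presentation_subquotient[OF N])
  have "(\<forall>x\<in>coset_in N1 N2 ` N1. r \<odot>\<^bsub>subquotient N1 N2\<^esub> x = \<zero>\<^bsub>subquotient N1 N2\<^esub>) \<longleftrightarrow> (\<forall>x\<in>N1. r * x \<in> N2)" for r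
    using smult eq_zero_iff[OF scal_mem] by auto
  then show ?thesis by (simp add: annihilator_def carrier ann_def)
qed

definition add_seq :: "('n::{finite,linorder}, 'k::field) mpoly set \<Rightarrow> ('n, 'k) mpoly list \<Rightarrow> ('n, 'k) mpoly set \<Rightarrow> ('n, 'k) mpoly set" where
  "add_seq N2 fs N1 = foldl (\<lambda>N f. add_multiples N f N1) N2 fs"

lemma add_seq_eq:
  "add_seq N2 fs N1 = {x + (\<Sum>j<length fs. fs ! j * y j) |x y. x \<in> N2 \<and> (\<forall>j<length fs. y j \<in> N1)}"
proof (induction fs rule: rev_induct)
  case Nil
  then show ?case by (simp add: add_seq_def)
next
  case (snoc f fs)
  have e: "(\<Sum>j<length (fs @ [f]). (fs @ [f]) ! j * y j) = (\<Sum>j<length fs. fs ! j * y j) + f * y (length fs)" for y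
    by (simp add: nth_append)
  have "add_seq N2 (fs @ [f]) N1 = add_multiples (add_seq N2 fs N1) f N1" by (simp add: add_seq_def)
  also have "\<dots> = {x + (\<Sum>j<length (fs @ [f]). (fs @ [f]) ! j * y j) |x y. x \<in> N2 \<and> (\<forall>j<length (fs @ [f]). y j \<in> N1)}"
    (is "?L = ?R")
  proof (intro equalityI subsetI)
    fix u assume "u \<in> ?L"
    then obtain x y z where u: "u = x + (\<Sum>j<length fs. fs ! j * y j) + f * z" "x \<in> N2" "\<forall>j<length fs. y j \<in> N1" "z \<in> N1"
      unfolding add_multiples_def snoc by blast
    let ?y = "y(length fs := z)"
    have "u = x + (\<Sum>j<length (fs @ [f]). (fs @ [f]) ! j * ?y j)" unfolding e using u(1) by (simp add: add.assoc)
    moreover have "\<forall>j<length (fs @ [f]). ?y j \<in> N1" using u by (auto simp: less_Suc_eq)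
    ultimately show "u \<in> ?R" using u(2) by blast
  next
    fix u assume "u \<in> ?R"
    then obtain x y where u: "u = x + (\<Sum>j<length (fs @ [f]). (fs @ [f]) ! j * y j)" "x \<in> N2" "\<forall>j<length (fs @ [f]). y j \<in> N1" by blast
    have "u = (x + (\<Sum>j<length fs. fs ! j * y j)) + f * y (length fs)" unfolding u(1) e by (simp add: add.assoc)
    moreover have "\<forall>j<length fs. y j \<in> N1" using u(3) by simp
    then have "x + (\<Sum>j<length fs. fs ! j * y j) \<in> add_seq N2 fs N1" unfolding snoc using u(2) by blast
    moreover have "y (length fs) \<in> N1" using u(3) by simp
    ultimately show "u \<in> ?L" unfolding add_multiples_def by blast
  qed
  finally show ?case .
qed

lemma mem_seq_multiples_subquotient:
  assumes N: "is_ideal N1" "is_ideal N2" "N2 \<subseteq> N1" and x: "x \<in> N1"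
  shows "coset_in N1 N2 x \<in> seq_multiples (subquotient N1 N2) fs \<longleftrightarrow> x \<in> add_seq N2 fs N1"
proof -
  interpret presentation "(*)" "coset_in N1 N2" N1 N2 "subquotient N1 N2"
    by (rule presentation_subquotient[OF N])
  let ?M = "subquotient N1 N2" and ?q = "coset_in N1 N2"
  have sumN: "(\<Sum>j<length fs. fs ! j * y j) \<in> N1" if "\<forall>j<length fs. y j \<in> N1" for y
    using that N(1) by (intro ideal_sum ideal_mult) auto
  have fs: "(\<Oplus>\<^bsub>?M\<^esub>j\<in>{..<length fs}. (fs ! j) \<odot>\<^bsub>?M\<^esub> z j) = ?q (\<Sum>j<length fs. fs ! j * y j)"
    if "\<forall>j<length fs. y j \<in> N1 \<and> z j = ?q (y j)" for y z
    using that by (intro finsum_eq) (auto simp: smult ideal_mult[OF N(1)])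
  have "?q x \<in> seq_multiples ?M fs \<longleftrightarrow> (\<exists>y. (\<forall>j<length fs. y j \<in> N1) \<and> x - (\<Sum>j<length fs. fs ! j * y j) \<in> N2)"
  proof
    assume "?q x \<in> seq_multiples ?M fs"
    then obtain z where z: "?q x = (\<Oplus>\<^bsub>?M\<^esub>j\<in>{..<length fs}. (fs ! j) \<odot>\<^bsub>?M\<^esub> z j)" "z \<in> {..<length fs} \<rightarrow> carrier ?M"
      unfolding seq_multiples_def by blast
    then have "\<forall>j. \<exists>y. j < length fs \<longrightarrow> y \<in> N1 \<and> z j = ?q y" unfolding carrier by (auto simp: Pi_def)
    then obtain y where y: "\<forall>j<length fs. y j \<in> N1 \<and> z j = ?q (y j)" by metis
    then have "?q x = ?q (\<Sum>j<length fs. fs ! j * y j)" using z(1) fs by simp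
    then have "x - (\<Sum>j<length fs. fs ! j * y j) \<in> N2" using eq_iff[OF x sumN] y by blast
    then show "\<exists>y. (\<forall>j<length fs. y j \<in> N1) \<and> x - (\<Sum>j<length fs. fs ! j * y j) \<in> N2" using y by blast
  next
    assume "\<exists>y. (\<forall>j<length fs. y j \<in> N1) \<and> x - (\<Sum>j<length fs. fs ! j * y j) \<in> N2"
    then obtain y where y: "\<forall>j<length fs. y j \<in> N1" "x - (\<Sum>j<length fs. fs ! j * y j) \<in> N2" by blast
    then have "?q x = ?q (\<Sum>j<length fs. fs ! j * y j)" using eq_iff[OF x sumN] by blast
    also have "\<dots> = (\<Oplus>\<^bsub>?M\<^esub>j\<in>{..<length fs}. (fs ! j) \<odot>\<^bsub>?M\<^esub> ?q (y j))" using fs[of y "\<lambda>j. ?q (y j)"] y(1) by simp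
    finally have "?q x = (\<Oplus>\<^bsub>?M\<^esub>j\<in>{..<length fs}. (fs ! j) \<odot>\<^bsub>?M\<^esub> ?q (y j))" .
    moreover have "(\<lambda>j. ?q (y j)) \<in> {..<length fs} \<rightarrow> carrier ?M" using y(1) by (auto simp: carrier)
    ultimately show "?q x \<in> seq_multiples ?M fs" unfolding seq_multiples_def
      by (intro CollectI exI[of _ "\<lambda>j. ?q (y j)"] conjI)
  qed
  also have "\<dots> \<longleftrightarrow> x \<in> add_seq N2 fs N1"
  proof
    assume "\<exists>y. (\<forall>j<length fs. y j \<in> N1) \<and> x - (\<Sum>j<length fs. fs ! j * y j) \<in> N2"
    then obtain y where y: "\<forall>j<length fs. y j \<in> N1" "x - (\<Sum>j<length fs. fs ! j * y j) \<in> N2" by blast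
    then have "(x - (\<Sum>j<length fs. fs ! j * y j)) + (\<Sum>j<length fs. fs ! j * y j) \<in> add_seq N2 fs N1"
      unfolding add_seq_eq by blast
    then show "x \<in> add_seq N2 fs N1" by simp
  next
    assume "x \<in> add_seq N2 fs N1"
    then obtain w y where "x = w + (\<Sum>j<length fs. fs ! j * y j)" "w \<in> N2" "\<forall>j<length fs. y j \<in> N1"
      unfolding add_seq_eq by blast
    then show "\<exists>y. (\<forall>j<length fs. y j \<in> N1) \<and> x - (\<Sum>j<length fs. fs ! j * y j) \<in> N2" by auto
  qed
  finally show ?thesis .
qed

lemma regular_on_of_steps:
  assumes "\<And>j. j < length fs \<Longrightarrow> nonzerodivisor_on (fs ! j) N1 (add_seq N2 (take j fs) N1)"
  shows "regular_on N1 N2 fs"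
  using assms
proof (induction fs arbitrary: N2)
  case (Cons f fs)
  have "nonzerodivisor_on f N1 N2" using Cons.prems[of 0] by (simp add: add_seq_def)
  moreover have "nonzerodivisor_on (fs ! j) N1 (add_seq (add_multiples N2 f N1) (take j fs) N1)" if "j < length fs" for j
    using Cons.prems[of "Suc j"] that by (simp add: add_seq_def)
  ultimately show ?case using Cons.IH by simp
qed simp

lemma regular_sequence_subquotient:
  assumes N: "is_ideal N1" "is_ideal N2" "N2 \<subseteq> N1" and reg: "regular_sequence (subquotient N1 N2) fs"
  shows "regular_on N1 N2 fs"
proof (rule regular_on_of_steps)
  interpret presentation "(*)" "coset_in N1 N2" N1 N2 "subquotient N1 N2"
    by (rule presentation_subquotient[OF N])
  fix j assume j: "j < length fs"
  show "nonzerodivisor_on (fs ! j) N1 (add_seq N2 (take j fs) N1)"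
    unfolding nonzerodivisor_on_def
  proof (intro ballI impI)
    fix x assume x: "x \<in> N1" and fx: "fs ! j * x \<in> add_seq N2 (take j fs) N1"
    let ?M = "subquotient N1 N2" and ?q = "coset_in N1 N2"
    have "?q (fs ! j * x) \<in> seq_multiples ?M (take j fs)"
      using mem_seq_multiples_subquotient[OF N scal_mem[OF x]] fx by blast
    then have "(fs ! j) \<odot>\<^bsub>?M\<^esub> ?q x \<in> seq_multiples ?M (take j fs)" by (simp add: smult x)
    moreover have "?q x \<in> carrier ?M" using x by (simp add: carrier)
    ultimately have "?q x \<in> seq_multiples ?M (take j fs)" using reg j unfolding regular_sequence_def by blast
    then show "x \<in> add_seq N2 (take j fs) N1" using mem_seq_multiples_subquotient[OF N x] by blast
  qed
qed

lemma acyclic_of_cohen_macaulay: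
  assumes N: "is_ideal N1" "is_ideal N2" "N2 \<subseteq> N1"
    and CM: "carrier (subquotient N1 N2) = {\<zero>\<^bsub>subquotient N1 N2\<^esub>} \<or> cohen_macaulay_of_dim (subquotient N1 N2) i"
    and p: "p \<noteq> int i"
  shows "acyclic_at N1 N2 p"
proof -
  interpret presentation "(*)" "coset_in N1 N2" N1 N2 "subquotient N1 N2"
    by (rule presentation_subquotient[OF N])
  let ?M = "subquotient N1 N2"
  from CM show ?thesis
  proof
    assume triv: "carrier ?M = {\<zero>\<^bsub>?M\<^esub>}"
    have "N1 \<subseteq> N2"
    proof
      fix x assume x: "x \<in> N1"
      then have "coset_in N1 N2 x \<in> carrier ?M" by (simp add: carrier)
      then have "coset_in N1 N2 x = \<zero>\<^bsub>?M\<^esub>" unfolding triv by (rule singletonD)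
      then show "x \<in> N2" using eq_zero_iff[OF x] by blast
    qed
    then have "cech_ideal N1 p \<subseteq> cech_ideal N2 p" by (rule cech_ideal_mono)
    then show ?thesis using cech_ideal_subset_cobd[OF N(1), of N2 p] unfolding V.cocyc_def by blast
  next
    assume "cohen_macaulay_of_dim ?M i"
    then have dim: "krull_dim (mpoly_ring Quot ann N1 N2) = ereal (real i)"
      and dep: "depth irrelevant_ideal ?M = ereal (real i)"
      by (auto simp: cohen_macaulay_of_dim_def module_dim_def annihilator_subquotient[OF N])
    let ?F = "{fs. set fs \<subseteq> irrelevant_ideal \<and> regular_sequence ?M fs}"
    have S: "(SUP fs\<in>?F. ereal (real (length fs))) = ereal (real i)" using dep by (simp add: depth_def)
    \<comment> \<open>The depth is only a supremum. As lengths are integers, a regular sequence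
      longer than \<open>i - 1/2\<close> already has length \<open>i\<close>.\<close>
    have "ereal (real i - 1/2) < (SUP fs\<in>?F. ereal (real (length fs)))" unfolding S by simp
    then obtain fs where fs: "fs \<in> ?F" "ereal (real i - 1/2) < ereal (real (length fs))"
      unfolding less_SUP_iff by (elim bexE)
    have "ereal (real (length fs)) \<le> ereal (real i)" unfolding S[symmetric] by (rule SUP_upper[OF fs(1)])
    then have len: "length fs = i" using fs(2) by simp
    have reg: "regular_on N1 N2 fs" using fs(1) regular_sequence_subquotient[OF N] by blast
    have "f \<in> P" if "f \<in> set fs" "is_prime P" "range var \<subseteq> P" for f P
    proof -
      have "irrelevant_ideal \<subseteq> P"
        unfolding irrelevant_ideal_def using that by (intro genideal_subset prime_is_ideal)
      then show ?thesis using fs(1) that(1) by blast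
    qed
    moreover have "\<not> prime_chain (ann N1 N2) (Suc (length fs))"
    proof
      assume "prime_chain (ann N1 N2) (Suc (length fs))"
      from prime_chain_le_krull_dim[OF ideal_ann[OF N(2)] this] show False using dim len by simp
    qed
    ultimately show ?thesis using p len by (intro acyclic_of_regular_sequence[OF N(1,2) reg]) auto
  qed
qed

section \<open>Local cohomology of a graded quotient ring\<close>

context
  fixes I :: "('n::{finite,linorder}, 'k::field) mpoly set"
  assumes I: "graded_ideal I"
begin

private abbreviation "A \<equiv> subquotient UNIV I"
private abbreviation "q \<equiv> coset_in UNIV I"

private lemma I_ideal: "is_ideal I" by (rule graded_is_ideal[OF I])

interpretation A: presentation "(*)" q UNIV I A
  by (rule presentation_subquotient) (auto simp: ideal_UNIV I_ideal)

text \<open>The equivalence class of \<open>loc_rel\<close> named by a Laurent polynomial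
  \<open>f\<close> instead of a chosen fraction; \<open>f\<close> matters only modulo
  \<open>loc_ideal I S\<close>.\<close>

definition loc_class :: "'n set \<Rightarrow> ('n, 'k) laurent \<Rightarrow> (('n, 'k) mpoly set \<times> ('n \<Rightarrow>\<^sub>0 nat)) set" where
  "loc_class S f = {(q r, a) |r a. Poly_Mapping.keys a \<subseteq> S \<and> lfrac r a - f \<in> loc_ideal I S}"

private lemma loc_diff: "x \<in> loc_ideal N S \<Longrightarrow> y \<in> loc_ideal N S \<Longrightarrow> is_ideal N \<Longrightarrow> x - y \<in> loc_ideal N S"
  using loc_ideal_add[of N x S "- y"] loc_ideal_mult[of N y S "- 1"] by (simp add: laurent_of_uminus)

private lemma loc_sym: "x - y \<in> loc_ideal I S \<Longrightarrow> y - x \<in> loc_ideal I S"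
  using loc_diff[OF loc_ideal_0[OF I_ideal], of "x - y" S] I_ideal by simp

private lemma loc_trans: "x - y \<in> loc_ideal I S \<Longrightarrow> y - z \<in> loc_ideal I S \<Longrightarrow> x - z \<in> loc_ideal I S"
  using loc_ideal_add[OF I_ideal, of "x - y" S "y - z"] by simp

lemma loc_rel_iff:
  "((q r, a), (q s, b)) \<in> loc_rel A S \<longleftrightarrow>
     Poly_Mapping.keys a \<subseteq> S \<and> Poly_Mapping.keys b \<subseteq> S \<and> lfrac r a - lfrac s b \<in> loc_ideal I S"
proof (cases "Poly_Mapping.keys a \<subseteq> S \<and> Poly_Mapping.keys b \<subseteq> S")
  case True
  have "mon (c + b) \<odot>\<^bsub>A\<^esub> q r = mon (c + a) \<odot>\<^bsub>A\<^esub> q s \<longleftrightarrow> mon c * (mon b * r - mon a * s) \<in> I" for c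
    by (simp add: A.smult A.eq_iff mon_add right_diff_distrib mult.assoc)
  moreover have "lfrac r a - lfrac s b \<in> loc_ideal I S \<longleftrightarrow>
      (\<exists>c. Poly_Mapping.keys c \<subseteq> S \<and> mon c * (mon b * r - mon a * s) \<in> I)"
    unfolding lfrac_diff using True keys_add_subset by (intro lfrac_mem_loc_ideal_iff[OF I_ideal]) blast
  moreover have "q r \<in> carrier A" for r by (simp add: A.carrier)
  ultimately show ?thesis using True unfolding loc_rel_def by simp
qed (auto simp: loc_rel_def)

lemma loc_rel_class:
  assumes "Poly_Mapping.keys a \<subseteq> S"
  shows "loc_rel A S `` {(q r, a)} = loc_class S (lfrac r a)"
proof (intro equalityI subsetI)
  fix u assume u: "u \<in> loc_rel A S `` {(q r, a)}"
  then have "fst u \<in> carrier A" by (auto simp: loc_rel_def)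
  then obtain s b where sb: "u = (q s, b)" unfolding A.carrier by (metis imageE prod.collapse)
  then show "u \<in> loc_class S (lfrac r a)" using u loc_sym by (auto simp: loc_rel_iff loc_class_def)
next
  fix u assume "u \<in> loc_class S (lfrac r a)"
  then obtain s b where "u = (q s, b)" "Poly_Mapping.keys b \<subseteq> S" "lfrac s b - lfrac r a \<in> loc_ideal I S"
    unfolding loc_class_def by blast
  then show "u \<in> loc_rel A S `` {(q r, a)}" using assms loc_sym by (simp add: loc_rel_iff)
qed

lemma loc_class_eqI: "x - y \<in> loc_ideal I S \<Longrightarrow> loc_class S x = loc_class S y"
  unfolding loc_class_def using loc_trans loc_sym by blast

lemma mem_loc_classE:
  assumes "x \<in> loc_ideal UNIV S"
  obtains r a where "(q r, a) \<in> loc_class S x" "Poly_Mapping.keys a \<subseteq> S" "x = lfrac r a"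
proof -
  obtain r a where ra: "x = lfrac r a" "Poly_Mapping.keys a \<subseteq> S" using assms unfolding loc_ideal_def by blast
  have "lfrac r a - x \<in> loc_ideal I S" using ra(1) loc_ideal_0[OF I_ideal] by simp
  then have "(q r, a) \<in> loc_class S x" unfolding loc_class_def using ra(2) by blast
  then show thesis using that ra by blast
qed

lemma UN_const_class: "(\<And>u. u \<in> C \<Longrightarrow> F u = D) \<Longrightarrow> C \<noteq> {} \<Longrightarrow> (\<Union>u\<in>C. F u) = D"
  by auto

lemma presentation_loc:
  "presentation (\<lambda>r f. laurent_of r * f) (loc_class S) (loc_ideal UNIV S) (loc_ideal I S) (loc A S)"
proof
  let ?L = "loc_ideal (UNIV :: ('n, 'k) mpoly set) S"
  show "0 \<in> ?L" by (rule loc_ideal_0[OF ideal_UNIV])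
  show "x - y \<in> ?L" if "x \<in> ?L" "y \<in> ?L" for x y using loc_diff[OF that ideal_UNIV] .
  show "laurent_of r * x \<in> ?L" if "x \<in> ?L" for x r using loc_ideal_mult[OF ideal_UNIV that] .
  have ne: "loc_class S x \<noteq> {}" if "x \<in> ?L" for x using mem_loc_classE[OF that] by blast
  show "carrier (loc A S) = loc_class S ` ?L"
  proof (intro equalityI subsetI)
    fix C assume "C \<in> carrier (loc A S)"
    then obtain m a where "C = loc_rel A S `` {(m, a)}" "m \<in> carrier A" "Poly_Mapping.keys a \<subseteq> S"
      by (auto simp: loc_def quotient_def)
    then obtain r where "C = loc_rel A S `` {(q r, a)}" "Poly_Mapping.keys a \<subseteq> S" unfolding A.carrier by blast
    then show "C \<in> loc_class S ` ?L" using lfrac_mem_loc_ideal[of r UNIV a S] by (auto simp: loc_rel_class)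
  next
    fix C assume "C \<in> loc_class S ` ?L"
    then obtain r a where C: "C = loc_class S (lfrac r a)" "Poly_Mapping.keys a \<subseteq> S" unfolding loc_ideal_def by blast
    then have "C = loc_rel A S `` {(q r, a)}" by (simp add: loc_rel_class)
    then show "C \<in> carrier (loc A S)" using C(2) by (auto simp: loc_def quotient_def A.carrier)
  qed
  show "\<zero>\<^bsub>loc A S\<^esub> = loc_class S 0"
    using loc_rel_class[of 0 S 0] by (simp add: loc_def A.zero lfrac_0_left)
  show "loc_class S x \<oplus>\<^bsub>loc A S\<^esub> loc_class S y = loc_class S (x + y)" if xy: "x \<in> ?L" "y \<in> ?L" for x y
  proof -
    have "loc_rel A S `` {(mon b \<odot>\<^bsub>A\<^esub> m \<oplus>\<^bsub>A\<^esub> mon a \<odot>\<^bsub>A\<^esub> m', a + b)} = loc_class S (x + y)"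
      if ma: "(m, a) \<in> loc_class S x" "(m', b) \<in> loc_class S y" for m a m' b
    proof -
      obtain r s where rs: "m = q r" "m' = q s" "Poly_Mapping.keys a \<subseteq> S" "Poly_Mapping.keys b \<subseteq> S"
        "lfrac r a - x \<in> loc_ideal I S" "lfrac s b - y \<in> loc_ideal I S"
        using ma unfolding loc_class_def by blast
      have "mon b \<odot>\<^bsub>A\<^esub> m \<oplus>\<^bsub>A\<^esub> mon a \<odot>\<^bsub>A\<^esub> m' = q (mon b * r + mon a * s)"
        by (simp add: rs A.smult A.plus)
      then have "loc_rel A S `` {(mon b \<odot>\<^bsub>A\<^esub> m \<oplus>\<^bsub>A\<^esub> mon a \<odot>\<^bsub>A\<^esub> m', a + b)} = loc_class S (lfrac r a + lfrac s b)"
        using loc_rel_class[OF keys_add_subset[OF rs(3,4)]] by (simp add: lfrac_add)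
      also have "\<dots> = loc_class S (x + y)"
        using loc_ideal_add[OF I_ideal rs(5,6)] by (intro loc_class_eqI) (simp add: algebra_simps)
      finally show ?thesis .
    qed
    then have "(\<Union>(m', b)\<in>loc_class S y.
        loc_rel A S `` {(mon b \<odot>\<^bsub>A\<^esub> m \<oplus>\<^bsub>A\<^esub> mon a \<odot>\<^bsub>A\<^esub> m', a + b)}) = loc_class S (x + y)"
      if "(m, a) \<in> loc_class S x" for m a
      using that by (intro UN_const_class[OF _ ne[OF xy(2)]]) (simp only: split_paired_all prod.case)
    then have "(\<Union>(m, a)\<in>loc_class S x. \<Union>(m', b)\<in>loc_class S y.
        loc_rel A S `` {(mon b \<odot>\<^bsub>A\<^esub> m \<oplus>\<^bsub>A\<^esub> mon a \<odot>\<^bsub>A\<^esub> m', a + b)}) = loc_class S (x + y)"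
      by (intro UN_const_class[OF _ ne[OF xy(1)]]) (simp only: split_paired_all prod.case)
    then show ?thesis by (simp add: loc_def)
  qed
  show "r \<odot>\<^bsub>loc A S\<^esub> loc_class S x = loc_class S (laurent_of r * x)" if x: "x \<in> ?L" for x r
  proof -
    have "loc_rel A S `` {(r \<odot>\<^bsub>A\<^esub> m, a)} = loc_class S (laurent_of r * x)" if m: "(m, a) \<in> loc_class S x" for m a
    proof -
      obtain s where s: "m = q s" "Poly_Mapping.keys a \<subseteq> S" "lfrac s a - x \<in> loc_ideal I S"
        using m unfolding loc_class_def by blast
      have "loc_rel A S `` {(r \<odot>\<^bsub>A\<^esub> m, a)} = loc_class S (laurent_of r * lfrac s a)"
        using loc_rel_class[OF s(2)] by (simp add: s A.smult laurent_of_mult_lfrac)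
      also have "\<dots> = loc_class S (laurent_of r * x)"
        using loc_ideal_mult[OF I_ideal s(3), of r] by (intro loc_class_eqI) (simp add: right_diff_distrib)
      finally show ?thesis .
    qed
    then have "(\<Union>(m, a)\<in>loc_class S x. loc_rel A S `` {(r \<odot>\<^bsub>A\<^esub> m, a)}) = loc_class S (laurent_of r * x)"
      using ne x by (intro UN_const_class) auto
    then show ?thesis by (simp add: loc_def)
  qed
  show "loc_class S x = loc_class S y \<longleftrightarrow> x - y \<in> loc_ideal I S" if xy: "x \<in> ?L" "y \<in> ?L" for x y
  proof
    assume e: "loc_class S x = loc_class S y"
    obtain r a where ra: "(q r, a) \<in> loc_class S x" "x = lfrac r a" by (rule mem_loc_classE[OF xy(1)])
    then have "(q r, a) \<in> loc_class S y" using e by simp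
    then obtain s where s: "q r = q s" "Poly_Mapping.keys a \<subseteq> S" "lfrac s a - y \<in> loc_ideal I S"
      unfolding loc_class_def by blast
    have "r - s \<in> I" using s(1) by (simp add: A.eq_iff)
    then have "lfrac r a - lfrac s a \<in> loc_ideal I S"
      using lfrac_mem_loc_ideal[of "r - s" I a S] s(2) by (simp add: lfrac_diff_same)
    then show "x - y \<in> loc_ideal I S" using loc_trans s(3) ra(2) by blast
  qed (rule loc_class_eqI)
qed

lemma piece_loc: "piece (loc A S) j = loc_class S ` {f \<in> loc_ideal UNIV S. hpart ldeg j f = f}"
proof (intro equalityI subsetI)
  fix C assume "C \<in> piece (loc A S) j"
  then obtain m a where ma: "C = loc_rel A S `` {(m, a)}" "Poly_Mapping.keys a \<subseteq> S" "m \<in> piece A (j + pdeg a)"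
    by (auto simp: loc_def)
  then obtain r where r: "m = q r" "r \<in> homogeneous_part (j + pdeg a)" unfolding piece_subquotient by blast
  have "hpart ldeg j (lfrac r a) = lfrac r a"
    using r(2) by (simp add: lfrac_def hpart_lmon_mult ldeg_uminus ldeg_int_exp mem_homogeneous_part_iff flip: laurent_of_hpart)
  moreover have "C = loc_class S (lfrac r a)" using ma(1) r(1) loc_rel_class[OF ma(2)] by simp
  ultimately show "C \<in> loc_class S ` {f \<in> loc_ideal UNIV S. hpart ldeg j f = f}"
    using lfrac_mem_loc_ideal[of r UNIV a S] ma(2) by blast
next
  fix C assume "C \<in> loc_class S ` {f \<in> loc_ideal UNIV S. hpart ldeg j f = f}"
  then obtain f where f: "C = loc_class S f" "f \<in> loc_ideal UNIV S" "hpart ldeg j f = f" by blast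
  then obtain r a where ra: "f = lfrac r a" "Poly_Mapping.keys a \<subseteq> S" unfolding loc_ideal_def by blast
  define s where "s = hpart pdeg (j + pdeg a) r"
  have "f = hpart ldeg j f" using f(3) by simp
  also have "\<dots> = lfrac s a"
    unfolding ra(1) s_def by (simp add: lfrac_def hpart_lmon_mult ldeg_uminus ldeg_int_exp laurent_of_hpart)
  finally have "f = lfrac s a" .
  then have "C = loc_rel A S `` {(q s, a)}" using loc_rel_class[OF ra(2)] f(1) by simp
  moreover have "q s \<in> piece A (j + pdeg a)"
    unfolding piece_subquotient s_def using hpart_mem_homogeneous_part by blast
  ultimately show "C \<in> piece (loc A S) j" using ra(2) unfolding loc_def by auto
qed

text \<open>Under \<open>loc_class\<close> the canonical maps between localisations become
  inclusions inside the Laurent ring.\<close>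

lemma loc_class_restrict:
  assumes "S \<subseteq> T" "f \<in> loc_ideal UNIV S"
  shows "loc_rel A T `` loc_class S f = loc_class T f"
proof -
  have "loc_rel A T `` {u} = loc_class T f" if u: "u \<in> loc_class S f" for u
  proof -
    obtain r a where ra: "u = (q r, a)" "Poly_Mapping.keys a \<subseteq> S" "lfrac r a - f \<in> loc_ideal I S"
      using u unfolding loc_class_def by blast
    have "Poly_Mapping.keys a \<subseteq> T" using ra(2) assms(1) by blast
    then have "loc_rel A T `` {u} = loc_class T (lfrac r a)" using ra(1) loc_rel_class by simp
    also have "\<dots> = loc_class T f" using ra(3) loc_ideal_mono[of I I S T] assms(1) by (intro loc_class_eqI) blast
    finally show ?thesis .
  qed
  moreover have "loc_class S f \<noteq> {}" using mem_loc_classE[OF assms(2)] by blast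
  ultimately have "(\<Union>u\<in>loc_class S f. loc_rel A T `` {u}) = loc_class T f" by (intro UN_const_class)
  then show ?thesis by (simp add: Image_eq_UN[symmetric])
qed

definition cech_class :: "nat \<Rightarrow> ('n, 'k) cochains \<Rightarrow> 'n set \<Rightarrow> (('n, 'k) mpoly set \<times> ('n \<Rightarrow>\<^sub>0 nat)) set" where
  "cech_class p c = (\<lambda>S\<in>{S. card S = p}. loc_class S (c S))"

private lemma cech_comp: "c \<in> cech_ideal N p \<Longrightarrow> c S \<in> loc_ideal N S"
  by (simp add: cech_ideal_def)

lemma cech_class_eq_iff:
  assumes "c \<in> cech_ideal UNIV (int p)" "c' \<in> cech_ideal UNIV (int p)"
  shows "cech_class p c = cech_class p c' \<longleftrightarrow> c - c' \<in> cech_ideal I (int p)"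
proof -
  have iff: "loc_class S (c S) = loc_class S (c' S) \<longleftrightarrow> c S - c' S \<in> loc_ideal I S" for S
    using presentation.eq_iff[OF presentation_loc] assms cech_comp by blast
  have out: "c S - c' S \<in> loc_ideal I S \<and> c S - c' S = 0" if "card S \<noteq> p" for S
  proof -
    have "c S = 0" "c' S = 0" using that assms unfolding cech_ideal_def by auto
    then show ?thesis using loc_ideal_0[OF I_ideal] by simp
  qed
  have "cech_class p c = cech_class p c' \<longleftrightarrow> (\<forall>S. card S = p \<longrightarrow> loc_class S (c S) = loc_class S (c' S))"
    unfolding cech_class_def restrict_def by (metis (mono_tags, lifting) mem_Collect_eq)
  also have "\<dots> \<longleftrightarrow> c - c' \<in> cech_ideal I (int p)"
    unfolding iff cech_ideal_def using out by (auto simp del: right_minus_eq)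
  finally show ?thesis .
qed

lemma presentation_cech: "presentation act (cech_class p) (cech_ideal UNIV (int p)) (cech_ideal I (int p)) (cech A p)"
proof
  let ?C = "cech_ideal (UNIV :: ('n, 'k) mpoly set) (int p)"
  show "0 \<in> ?C" by (rule cech_ideal_0[OF ideal_UNIV])
  show "x - y \<in> ?C" if "x \<in> ?C" "y \<in> ?C" for x y
    using V.subspace_diff[OF _ that] subcomplex_cech_ideal[OF ideal_UNIV] unfolding V.subcomplex_def by blast
  show "act r x \<in> ?C" if "x \<in> ?C" for x r using cech_ideal_act[OF ideal_UNIV that] .
  show "carrier (cech A p) = cech_class p ` ?C"
  proof (intro equalityI subsetI)
    fix c assume "c \<in> carrier (cech A p)"
    then have c: "c \<in> (\<Pi>\<^sub>E S\<in>{S. card S = p}. carrier (loc A S))" by (simp add: cech_def)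
    have "\<forall>S. \<exists>f. card S = p \<longrightarrow> f \<in> loc_ideal UNIV S \<and> c S = loc_class S f"
      using PiE_mem[OF c] presentation.carrier[OF presentation_loc] by blast
    then obtain f where f: "\<And>S. card S = p \<Longrightarrow> f S \<in> loc_ideal UNIV S \<and> c S = loc_class S (f S)" by metis
    define g where "g S = (if card S = p then f S else 0)" for S
    have "g \<in> ?C" using f loc_ideal_0[OF ideal_UNIV] by (auto simp: cech_ideal_def g_def)
    moreover have "c = cech_class p g"
      using f by (intro extensionalityI[of _ "{S. card S = p}"]) (use c in \<open>auto simp: cech_class_def g_def PiE_def\<close>)
    ultimately show "c \<in> cech_class p ` ?C" by blast
  next
    fix c assume "c \<in> cech_class p ` ?C"
    then obtain g where g: "c = cech_class p g" "g \<in> ?C" by blast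
    then have "loc_class S (g S) \<in> carrier (loc A S)" for S
      using presentation.carrier[OF presentation_loc, of S] cech_comp by blast
    then show "c \<in> carrier (cech A p)" by (simp add: cech_def g(1) cech_class_def)
  qed
  have "\<zero>\<^bsub>loc A S\<^esub> = loc_class S 0" for S by (rule presentation.zero[OF presentation_loc])
  then show "\<zero>\<^bsub>cech A p\<^esub> = cech_class p 0" by (simp add: cech_def cech_class_def)
  show "cech_class p x \<oplus>\<^bsub>cech A p\<^esub> cech_class p y = cech_class p (x + y)" if "x \<in> ?C" "y \<in> ?C" for x y
    using presentation.plus[OF presentation_loc cech_comp[OF that(1)] cech_comp[OF that(2)]]
    by (intro ext) (auto simp: cech_def cech_class_def restrict_def)
  show "r \<odot>\<^bsub>cech A p\<^esub> cech_class p x = cech_class p (act r x)" if "x \<in> ?C" for x r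
    using presentation.smult[OF presentation_loc cech_comp[OF that]]
    by (intro ext) (auto simp: cech_def cech_class_def restrict_def act_def)
qed (rule cech_class_eq_iff)

lemma piece_cech: "piece (cech A p) j = cech_class p ` cech_graded j UNIV (int p)"
proof (intro equalityI subsetI)
  fix c assume "c \<in> piece (cech A p) j"
  then have c: "c \<in> (\<Pi>\<^sub>E S\<in>{S. card S = p}. piece (loc A S) j)" by (simp add: cech_def)
  have "\<forall>S. \<exists>f. card S = p \<longrightarrow> f \<in> loc_ideal UNIV S \<and> hpart ldeg j f = f \<and> c S = loc_class S f"
    using PiE_mem[OF c] unfolding piece_loc by blast
  then obtain f where f: "\<And>S. card S = p \<Longrightarrow> f S \<in> loc_ideal UNIV S \<and> hpart ldeg j (f S) = f S \<and> c S = loc_class S (f S)"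
    by metis
  define g where "g S = (if card S = p then f S else 0)" for S
  have "hpart_cochain j g = g" using f by (auto simp: hpart_cochain_def g_def fun_eq_iff)
  then have "g \<in> cech_graded j UNIV (int p)"
    using f loc_ideal_0[OF ideal_UNIV] by (auto simp: cech_graded_def cech_ideal_def g_def)
  moreover have "c = cech_class p g"
    using f by (intro extensionalityI[of _ "{S. card S = p}"]) (use c in \<open>auto simp: cech_class_def g_def PiE_def\<close>)
  ultimately show "c \<in> cech_class p ` cech_graded j UNIV (int p)" by blast
next
  fix c assume "c \<in> cech_class p ` cech_graded j UNIV (int p)"
  then obtain g where g: "c = cech_class p g" "g \<in> cech_ideal UNIV (int p)" "hpart_cochain j g = g"
    by (auto simp: cech_graded_def)
  have "hpart ldeg j (g S) = g S" for S using fun_cong[OF g(3), of S] by (simp add: hpart_cochain_def)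
  then have "loc_class S (g S) \<in> piece (loc A S) j" for S unfolding piece_loc using cech_comp[OF g(2)] by blast
  then show "c \<in> piece (cech A p) j" by (simp add: cech_def g(1) cech_class_def)
qed

lemma cech_diff_class:
  assumes c: "c \<in> cech_ideal UNIV (int p)"
  shows "cech_diff A p (cech_class p c) = cech_class (Suc p) (cdiff c)"
proof -
  have "(\<Oplus>\<^bsub>loc A T\<^esub>v\<in>T. ((- 1) ^ card {u \<in> T. u < v}) \<odot>\<^bsub>loc A T\<^esub> (loc_rel A T `` cech_class p c (T - {v})))
     = loc_class T (cdiff c T)" if T: "card T = Suc p" for T
  proof -
    interpret L: presentation "\<lambda>r f. laurent_of r * f" "loc_class T" "loc_ideal UNIV T" "loc_ideal I T" "loc A T"
      by (rule presentation_loc)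
    have mem: "c (T - {v}) \<in> loc_ideal UNIV T" for v
      using cech_comp[OF c, of "T - {v}"] loc_ideal_mono[of UNIV UNIV "T - {v}" T] by blast
    have *: "loc_rel A T `` cech_class p c (T - {v}) = loc_class T (c (T - {v}))" if "v \<in> T" for v
    proof -
      have "card (T - {v}) = p" using T that by simp
      then show ?thesis using loc_class_restrict[of "T - {v}" T, OF _ cech_comp[OF c]] by (auto simp: cech_class_def)
    qed
    have "((- 1) ^ card {u \<in> T. u < v}) \<odot>\<^bsub>loc A T\<^esub> (loc_rel A T `` cech_class p c (T - {v}))
        = loc_class T (esign v T * c (T - {v}))" if "v \<in> T" for v
    proof -
      have "laurent_of ((- 1) ^ card {u \<in> T. u < v} :: ('n, 'k) mpoly) = esign v T"
        using laurent_of_esign[where 'n = 'n and 'k = 'k, of v T] by (simp add: esign_def)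
      then show ?thesis using that * L.smult[OF mem, of "(- 1) ^ card {u \<in> T. u < v}" v] by simp
    qed
    moreover have "esign v T * c (T - {v}) \<in> loc_ideal UNIV T" for v
      by (subst laurent_of_esign) (rule loc_ideal_mult[OF ideal_UNIV mem])
    ultimately have "(\<Oplus>\<^bsub>loc A T\<^esub>v\<in>T. ((- 1) ^ card {u \<in> T. u < v}) \<odot>\<^bsub>loc A T\<^esub> (loc_rel A T `` cech_class p c (T - {v})))
      = loc_class T (\<Sum>v\<in>T. esign v T * c (T - {v}))"
      by (intro L.finsum_eq) auto
    then show ?thesis by (simp add: cdiff_def)
  qed
  then show ?thesis
    by (intro ext) (simp add: cech_diff_def cech_class_def[of "Suc p"] restrict_def)
qed

lemma piece_graded_quot: "piece (graded_quot M N) j = (\<lambda>x. N +>\<^bsub>M\<^esub> x) ` piece M j"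
  by (simp add: graded_quot_def)

text \<open>\<open>local_cohomology\<close> divides ungraded cocycles by ungraded coboundaries and
  takes pieces afterwards, while the right-hand side is computed from cochains of degree
  \<open>j\<close> alone. Both agree because classes have homogeneous representatives and
  homogeneous coboundaries have homogeneous primitives.\<close>

lemma k_dim_local_cohomology:
  assumes fin: "V.hfin (cech_graded j UNIV) (cech_graded j I) (int (Suc p))"
  shows "k_dim (local_cohomology A (Suc p)) (piece (local_cohomology A (Suc p)) j) =
     V.hdim (cech_graded j UNIV) (cech_graded j I) (int (Suc p))"
proof -
  let ?p = "Suc p" and ?U = "UNIV :: ('n, 'k) mpoly set"
  let ?Z = "V.cocyc (cech_ideal ?U) (cech_ideal I) (int ?p)" and ?B = "V.cobd (cech_ideal ?U) (cech_ideal I) (int ?p)"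
  let ?Zj = "V.cocyc (cech_graded j ?U) (cech_graded j I) (int ?p)"
  let ?Bj = "V.cobd (cech_graded j ?U) (cech_graded j I) (int ?p)"
  have sc: "V.subcomplex (cech_ideal ?U)" "V.subcomplex (cech_ideal I)"
    "V.subcomplex (cech_graded j ?U)" "V.subcomplex (cech_graded j I)"
    using subcomplex_cech_ideal subcomplex_cech_graded ideal_UNIV I_ideal by blast+
  have sub: "V.subspace ?Z" "V.subspace ?B" "V.subspace ?Zj" "V.subspace ?Bj"
    using sc V.subspace_cocyc V.subspace_cobd by blast+
  have IU: "cech_ideal I m \<subseteq> cech_ideal ?U m" for m by (rule cech_ideal_mono) simp
  have BZ: "?B \<subseteq> ?Z" by (rule V.cobd_subset_cocyc[OF sc(1,2) IU])
  have ZC: "?Z \<subseteq> cech_ideal ?U (int ?p)" by (auto simp: V.cocyc_def)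
  have actZ: "act r x \<in> ?Z" if "x \<in> ?Z" for r x
    using that cech_ideal_act ideal_UNIV I_ideal by (auto simp: V.cocyc_def simp flip: act_cdiff)
  have cocycles: "cech_cocycles A ?p = cech_class ?p ` ?Z"
  proof -
    interpret P: presentation act "cech_class (Suc ?p)" "cech_ideal UNIV (int (Suc ?p))" "cech_ideal I (int (Suc ?p))" "cech A (Suc ?p)"
      by (rule presentation_cech)
    have "cech_diff A ?p (cech_class ?p c) = \<zero>\<^bsub>cech A (Suc ?p)\<^esub> \<longleftrightarrow> c \<in> ?Z" if c: "c \<in> cech_ideal ?U (int ?p)" for c
    proof -
      have "cdiff c \<in> cech_ideal ?U (int (Suc ?p))" using cech_ideal_cdiff[OF ideal_UNIV c] by (simp add: add.commute)
      then show ?thesis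
        using c P.eq_zero_iff unfolding cech_diff_class[OF c] by (simp add: V.cocyc_def add.commute)
    qed
    then show ?thesis
      using ZC unfolding cech_cocycles_def presentation.carrier[OF presentation_cech] by blast
  qed
  have coboundaries: "cech_coboundaries A ?p = cech_class ?p ` ?B"
  proof -
    have "cech_class ?p (w + cdiff u) = cech_diff A p (cech_class p u)"
      if w: "w \<in> cech_ideal I (int ?p)" and u: "u \<in> cech_ideal ?U (int p)" for w u
    proof -
      have du: "cdiff u \<in> cech_ideal ?U (int ?p)" using cech_ideal_cdiff[OF ideal_UNIV u] by (simp add: add.commute)
      then have "w + cdiff u \<in> cech_ideal ?U (int ?p)" using w IU cech_ideal_add[OF ideal_UNIV] by blast
      then have "cech_class ?p (w + cdiff u) = cech_class ?p (cdiff u)"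
        using cech_class_eq_iff[OF _ du] w by simp
      then show ?thesis by (simp add: cech_diff_class[OF u])
    qed
    note eq = this
    have i: "int ?p - 1 = int p" by simp
    show ?thesis
    proof (intro equalityI subsetI)
      fix x assume "x \<in> cech_coboundaries A ?p"
      then obtain u where u: "x = cech_diff A p (cech_class p u)" "u \<in> cech_ideal ?U (int p)"
        unfolding cech_coboundaries.simps presentation.carrier[OF presentation_cech] by blast
      have z: "0 \<in> cech_ideal I (int ?p)" by (rule cech_ideal_0[OF I_ideal])
      then have "0 + cdiff u \<in> ?B" unfolding V.cobd_def i using u(2) by blast
      moreover have "x = cech_class ?p (0 + cdiff u)" using eq[OF z u(2)] u(1) by simp
      ultimately show "x \<in> cech_class ?p ` ?B" by blast
    next
      fix x assume "x \<in> cech_class ?p ` ?B"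
      then obtain w u where wu: "x = cech_class ?p (w + cdiff u)" "w \<in> cech_ideal I (int ?p)" "u \<in> cech_ideal ?U (int p)"
        unfolding V.cobd_def i by blast
      then have "x = cech_diff A p (cech_class p u)" using eq by simp
      then show "x \<in> cech_coboundaries A ?p"
        unfolding cech_coboundaries.simps presentation.carrier[OF presentation_cech] using wu(3) by blast
    qed
  qed
  let ?G = "graded_sub (cech A ?p) (cech_class ?p ` ?Z)"
  let ?c = "\<lambda>x. cech_class ?p ` ?B +>\<^bsub>?G\<^esub> cech_class ?p x"
  have H: "local_cohomology A ?p = graded_quot ?G (cech_class ?p ` ?B)"
    by (simp only: local_cohomology_def cocycles coboundaries)
  have presG: "presentation act (cech_class ?p) ?Z (cech_ideal I (int ?p)) ?G"
    by (rule presentation_sub[OF presentation_cech ZC V.subspace_0[OF sub(1)] V.subspace_diff[OF sub(1)] actZ])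
  have act_diff: "act r (x - y) = act r x - act r y" for r x y
    using act_add[of r "x - y" y] by simp
  have presH: "presentation act ?c ?Z ?B (local_cohomology A ?p)"
    unfolding H
    by (rule presentation_quot[OF presG cech_ideal_subset_cobd[OF ideal_UNIV] BZ V.subspace_diff[OF sub(2)]
          cobd_act[OF ideal_UNIV I_ideal] act_diff])
  have ZjZ: "?Zj \<subseteq> ?Z" by (auto simp: V.cocyc_def cech_graded_def)
  \<comment> \<open>A class in the intersection has a representative that is a cocycle modulo
    \<open>I\<close> and another one of degree \<open>j\<close>. They differ by a cochain of
    \<open>I\<close>, so the latter is a cocycle modulo \<open>I\<close> as well.\<close>
  have pc: "piece ?G j = cech_class ?p ` ?Zj"
  proof -
    have "cech_class ?p ` ?Z \<inter> cech_class ?p ` cech_graded j ?U (int ?p) = cech_class ?p ` ?Zj"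
    proof (intro equalityI subsetI)
      fix x assume "x \<in> cech_class ?p ` ?Z \<inter> cech_class ?p ` cech_graded j ?U (int ?p)"
      then obtain z z' where z: "x = cech_class ?p z" "z \<in> ?Z" "x = cech_class ?p z'" "z' \<in> cech_graded j ?U (int ?p)" by blast
      have z'U: "z' \<in> cech_ideal ?U (int ?p)" "hpart_cochain j z' = z'" using z(4) by (auto simp: cech_graded_def)
      have "z - z' \<in> cech_ideal I (int ?p)"
        using z ZC cech_class_eq_iff[of z ?p z'] z'U(1) by auto
      then have "cdiff (z - z') \<in> cech_ideal I (int ?p + 1)" by (rule cech_ideal_cdiff[OF I_ideal])
      moreover have "cdiff z \<in> cech_ideal I (int ?p + 1)" using z(2) by (simp add: V.cocyc_def)
      ultimately have "cdiff z - cdiff (z - z') \<in> cech_ideal I (int ?p + 1)"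
        using V.subspace_diff sc(2) unfolding V.subcomplex_def by blast
      then have "cdiff z' \<in> cech_ideal I (int ?p + 1)" by (simp add: V.d_diff)
      then have "z' \<in> ?Zj" using z(4) z'U(2) by (simp add: V.cocyc_def cech_graded_def hpart_cochain_cdiff)
      then show "x \<in> cech_class ?p ` ?Zj" using z(3) by blast
    next
      fix x assume "x \<in> cech_class ?p ` ?Zj"
      then show "x \<in> cech_class ?p ` ?Z \<inter> cech_class ?p ` cech_graded j ?U (int ?p)"
        using ZjZ unfolding V.cocyc_def by blast
    qed
    then show ?thesis unfolding graded_sub_def by (simp add: piece_cech)
  qed
  have pH: "piece (local_cohomology A ?p) j = ?c ` ?Zj"
    unfolding H piece_graded_quot pc image_image ..
  have "y \<in> ?B \<longleftrightarrow> y \<in> ?Bj" if y: "y \<in> ?Zj" for y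
  proof
    assume "y \<in> ?B"
    then have "hpart_cochain j y \<in> ?Bj" by (rule hpart_cobd[OF graded_ideal_UNIV I])
    then show "y \<in> ?Bj" using y by (simp add: V.cocyc_def cech_graded_def)
  next
    assume "y \<in> ?Bj"
    then show "y \<in> ?B" by (auto simp: V.cobd_def cech_graded_def)
  qed
  then have "k_dim (local_cohomology A ?p) (?c ` ?Zj) = qd (\<lambda>c. act (const c)) ?Zj ?Bj"
    using fin unfolding V.hfin_def
    by (intro k_dim_eq_qd[OF presH V.vector_space_axioms sub(3) ZjZ _ sub(4)]) auto
  then show ?thesis unfolding pH V.hdim_def .
qed

end

section \<open>Ascending chains of graded ideals\<close>

lemma nat_seq_incseq_subseq:
  fixes s :: "nat \<Rightarrow> nat"
  shows "\<exists>h. strict_mono h \<and> incseq (\<lambda>i. s (h i))"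
proof -
  obtain h where h: "strict_mono h" "monoseq (\<lambda>i. s (h i))" using seq_monosub[of s] by blast
  show ?thesis
  proof (cases "incseq (\<lambda>i. s (h i))")
    case False
    then have dec: "decseq (\<lambda>i. s (h i))" using h(2) by (simp add: monoseq_iff)
    \<comment> \<open>A decreasing sequence of naturals is constant from the place where its minimum
      is attained, and a constant sequence is increasing.\<close>
    define m where "m = (LEAST x. x \<in> range (\<lambda>i. s (h i)))"
    have "m \<in> range (\<lambda>i. s (h i))" unfolding m_def by (rule LeastI[of _ "s (h 0)"]) simp
    then obtain N where N: "m = s (h N)" by blast
    have ge: "m \<le> s (h n)" for n unfolding m_def by (rule Least_le) simp
    have "s (h (N + n)) = m" for n
      using ge[of "N + n"] decseqD[OF dec, of N "N + n"] N by simp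
    moreover have "strict_mono (\<lambda>n. h (N + n))" using h(1) by (simp add: strict_mono_def)
    ultimately show ?thesis by (intro exI[of _ "\<lambda>n. h (N + n)"]) (simp add: incseq_def)
  qed (use h in blast)
qed

lemma dickson_subseq:
  fixes f :: "nat \<Rightarrow> ('n \<Rightarrow>\<^sub>0 nat)"
  assumes "finite V"
  shows "\<exists>g. strict_mono g \<and> (\<forall>v\<in>V. incseq (\<lambda>i. Poly_Mapping.lookup (f (g i)) v))"
  using assms
proof (induction V rule: finite_induct)
  case empty
  then show ?case using strict_mono_id by auto
next
  case (insert v V)
  then obtain g where g: "strict_mono g" "\<And>u. u \<in> V \<Longrightarrow> incseq (\<lambda>i. Poly_Mapping.lookup (f (g i)) u)" by blast
  obtain h where h: "strict_mono h" "incseq (\<lambda>i. Poly_Mapping.lookup (f (g (h i))) v)"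
    using nat_seq_incseq_subseq[of "\<lambda>i. Poly_Mapping.lookup (f (g i)) v"] by blast
  have "incseq (\<lambda>i. Poly_Mapping.lookup (f (g (h i))) u)" if "u \<in> V" for u
    using g(2)[OF that] strict_mono_leD[OF h(1)] by (simp add: incseq_def)
  then have "\<forall>u\<in>insert v V. incseq (\<lambda>i. Poly_Mapping.lookup (f ((g \<circ> h) i)) u)" using h(2) by simp
  moreover have "strict_mono (g \<circ> h)" using g(1) h(1) by (rule strict_mono_o)
  ultimately show ?case by blast
qed

lemma dickson:
  fixes f :: "nat \<Rightarrow> ('n::finite \<Rightarrow>\<^sub>0 nat)"
  obtains i j c where "i < j" "f j = c + f i"
proof -
  obtain g where g: "strict_mono g" "\<And>v. incseq (\<lambda>i. Poly_Mapping.lookup (f (g i)) v)"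
    using dickson_subseq[of UNIV f] by auto
  have le: "Poly_Mapping.lookup (f (g 0)) v \<le> Poly_Mapping.lookup (f (g 1)) v" for v
    using g(2)[of v] by (simp add: incseq_def)
  have "f (g 1) = (f (g 1) - f (g 0)) + f (g 0)"
    using le by (intro poly_mapping_eqI) (simp add: lookup_add lookup_minus)
  moreover have "g 0 < g 1" using g(1) by (simp add: strict_mono_def)
  ultimately show thesis using that by blast
qed

lemma lookup_mon_mult: "Poly_Mapping.lookup (mon c * f) (c + a) = Poly_Mapping.lookup f a"
  by (induction f rule: poly_mapping_single_induct)
    (auto simp: mon_def mult_single lookup_single lookup_add distrib_left when_def)

lemma keys_mon_mult: "Poly_Mapping.keys (mon c * f) \<subseteq> (+) c ` Poly_Mapping.keys f"
  using keys_mult[of "mon c" f] by (auto simp: mon_def split: if_splits)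

lemma finite_monomials_of_degree: "finite {a :: 'n::{finite,linorder} \<Rightarrow>\<^sub>0 nat. pdeg a = j}"
proof -
  have "inj_on Poly_Mapping.lookup {a :: 'n \<Rightarrow>\<^sub>0 nat. pdeg a = j}"
    by (rule inj_onI) (simp add: lookup_inject)
  moreover have "Poly_Mapping.lookup ` {a :: 'n \<Rightarrow>\<^sub>0 nat. pdeg a = j} \<subseteq> {f. \<forall>v. f v \<in> {..nat j}}"
  proof clarsimp
    fix a :: "'n \<Rightarrow>\<^sub>0 nat" and v
    have "Poly_Mapping.lookup a v \<le> mdeg a" unfolding mdeg_def by (rule member_le_sum) auto
    then show "Poly_Mapping.lookup a v \<le> mdeg a" .
  qed
  moreover have "finite {f :: 'n \<Rightarrow> nat. \<forall>v. f v \<in> {..nat j}}"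
    using finite_set_of_finite_funs[of "UNIV :: 'n set" "{..nat j}"] by simp
  ultimately show ?thesis by (meson finite_imageD finite_subset)
qed

text \<open>The order on exponents is the linear order of \<open>poly_mapping\<close>, which is
  compatible with addition. Minimal leading monomials are taken within one degree, where there are
  finitely many monomials.\<close>

definition lead_mon :: "('n::{finite,linorder}, 'k::field) mpoly \<Rightarrow> ('n \<Rightarrow>\<^sub>0 nat)" where
  "lead_mon f = Max (Poly_Mapping.keys f)"

lemma lead_mon_mem: "f \<noteq> 0 \<Longrightarrow> lead_mon f \<in> Poly_Mapping.keys f"
  unfolding lead_mon_def by (rule Max_in) auto

lemma lead_mon_ge: "a \<in> Poly_Mapping.keys f \<Longrightarrow> a \<le> lead_mon f"
  unfolding lead_mon_def by (rule Max_ge) auto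

text \<open>From each step one takes a new homogeneous element with smallest leading monomial in its
  degree. By Dickson's lemma a later leading monomial is a multiple of an earlier one; subtracting
  that multiple of the earlier element, which lies in the smaller ideal, gives a new element with a
  smaller leading monomial.\<close>

lemma no_strict_chain_of_graded_ideals:
  fixes N :: "nat \<Rightarrow> ('n::{finite,linorder}, 'k::field) mpoly set"
  assumes gr: "\<And>i. graded_ideal (N i)" and strict: "\<And>i. N i \<subset> N (Suc i)"
  shows False
proof -
  note idl = graded_is_ideal[OF gr]
  have mono: "N i \<subseteq> N j" if "i \<le> j" for i j
    by (rule lift_Suc_mono_le[of N, OF psubset_imp_subset[OF strict] that])
  have "\<exists>f d. f \<in> N (Suc i) - N i \<and> hpart pdeg d f = f \<and>
      (\<forall>g. g \<in> N (Suc i) - N i \<longrightarrow> hpart pdeg d g = g \<longrightarrow> lead_mon f \<le> lead_mon g)" for i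
  proof -
    obtain f0 where f0: "f0 \<in> N (Suc i)" "f0 \<notin> N i" using psubset_imp_ex_mem[OF strict[of i]] by auto
    then obtain d where d: "hpart pdeg d f0 \<notin> N i" using ideal_of_hparts[OF idl] by blast
    define S where "S = {f \<in> N (Suc i) - N i. hpart pdeg d f = f}"
    have "hpart pdeg d f0 \<in> S"
      using f0(1) d graded_hpart[OF gr] by (simp add: S_def hpart_hpart)
    then have ne: "lead_mon ` S \<noteq> {}" by blast
    have "lead_mon ` S \<subseteq> {a. pdeg a = d}"
    proof clarify
      fix f assume f: "f \<in> S"
      then have "f \<noteq> 0" using ideal_0[OF idl] by (auto simp: S_def)
      then show "pdeg (lead_mon f) = d"
        using lead_mon_mem f hpart_eq_self_iff[of pdeg d f] by (auto simp: S_def)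
    qed
    then have fin: "finite (lead_mon ` S)" using finite_monomials_of_degree finite_subset by blast
    obtain f where f: "f \<in> S" "lead_mon f = Min (lead_mon ` S)" using Min_in[OF fin ne] by force
    have "lead_mon f \<le> lead_mon g" if "g \<in> S" for g using f(2) fin that by simp
    then show ?thesis using f(1) unfolding S_def by blast
  qed
  then obtain f d where f: "\<And>i. f i \<in> N (Suc i) - N i" "\<And>i. hpart pdeg (d i) (f i) = f i"
    and min: "\<And>i g. g \<in> N (Suc i) - N i \<Longrightarrow> hpart pdeg (d i) g = g \<Longrightarrow> lead_mon (f i) \<le> lead_mon g"
    by metis
  have f0: "f i \<noteq> 0" for i using f(1)[of i] ideal_0[OF idl] by auto
  obtain i j c where ij: "i < j" "lead_mon (f j) = c + lead_mon (f i)"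
    using dickson[of "\<lambda>i. lead_mon (f i)"] by blast
  define g where "g = mon c * f i"
  \<comment> \<open>The quotient of the leading coefficients, so that the leading terms cancel in
    \<open>h\<close>.\<close>
  define r where "r = Poly_Mapping.lookup (f j) (lead_mon (f j)) / Poly_Mapping.lookup (f i) (lead_mon (f i))"
  define h where "h = f j - const r * g"
  have lc: "Poly_Mapping.lookup (f i) (lead_mon (f i)) \<noteq> 0"
    using lead_mon_mem[OF f0] by (simp add: in_keys_iff)
  have deg_lm: "pdeg (lead_mon (f k)) = d k" for k
    using lead_mon_mem[OF f0] f(2)[of k] hpart_eq_self_iff[of pdeg "d k" "f k"] by blast
  have gN: "g \<in> N j"
    unfolding g_def using ideal_mult[OF idl] f(1)[of i] mono[of "Suc i" j] ij(1) by auto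
  have "d j = pdeg c + d i" using deg_lm[of j] deg_lm[of i] ij(2) by (simp add: mdeg_add)
  then have gh: "hpart pdeg (d j) g = g" using f(2)[of i] by (simp add: g_def hpart_mon_mult)
  have hN: "h \<in> N (Suc j) - N j"
  proof -
    have g': "const r * g \<in> N j" using ideal_mult[OF idl gN] .
    have "h \<in> N (Suc j)" using f(1)[of j] g' mono[of j "Suc j"] ideal_diff[OF idl] unfolding h_def by auto
    moreover have "h \<notin> N j"
    proof
      assume "h \<in> N j"
      then have "h + const r * g \<in> N j" using g' ideal_add[OF idl] by blast
      then show False using f(1)[of j] by (simp add: h_def)
    qed
    ultimately show ?thesis by blast
  qed
  have "hpart pdeg (d j) h = h" by (simp add: h_def hpart_diff hpart_const_mult gh f(2))
  then have le: "lead_mon (f j) \<le> lead_mon h" using min hN by blast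
  have const_lookup: "Poly_Mapping.lookup (const r * p) a = r * Poly_Mapping.lookup p a" for p :: "('n, 'k) mpoly" and a
    using lookup_mon_mult[of 0] by (simp add: const_def flip: mult_map_scale_conv_mult) (simp add: map.rep_eq when_def)
  have "h \<noteq> 0" using hN ideal_0[OF idl] by auto
  then have mem: "lead_mon h \<in> Poly_Mapping.keys h" by (rule lead_mon_mem)
  have "Poly_Mapping.keys g \<subseteq> {a. a \<le> lead_mon (f j)}"
    using keys_mon_mult[of c "f i"] lead_mon_ge[of _ "f i"] by (auto simp: g_def ij(2) intro: add_left_mono)
  moreover have "Poly_Mapping.keys h \<subseteq> Poly_Mapping.keys (f j) \<union> Poly_Mapping.keys g"
    by (auto simp: h_def in_keys_iff lookup_minus const_lookup)
  ultimately have "lead_mon h \<le> lead_mon (f j)" using mem lead_mon_ge[of _ "f j"] by blast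
  then have "lead_mon h = lead_mon (f j)" using le by simp
  moreover have "Poly_Mapping.lookup h (lead_mon (f j)) = 0"
  proof -
    have "Poly_Mapping.lookup g (lead_mon (f j)) = Poly_Mapping.lookup (f i) (lead_mon (f i))"
      unfolding g_def ij(2) by (rule lookup_mon_mult)
    then show ?thesis unfolding h_def lookup_minus const_lookup using lc by (simp add: r_def)
  qed
  ultimately show False using mem by (simp add: in_keys_iff)
qed

lemma graded_chain_stops:
  assumes "\<And>i. graded_ideal (N i)" "\<And>i. N i \<subseteq> N (Suc i)"
  shows "\<exists>i. N (Suc i) = N i"
  using no_strict_chain_of_graded_ideals[of N] assms by blast

section \<open>Devissage of graded subquotients\<close>

text \<open>Induction on the number of variables that do not annihilate N1/N2. For such a variable,
  the x_v-torsion is filtered with layers killed by x_v; modulo the torsion x_v is a nonzerodivisor,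
  with cokernel killed by x_v. Layers and cokernel have fewer acting variables.\<close>

lemma graded_devissage:
  fixes P :: "('n::{finite,linorder}, 'k::field) mpoly set \<Rightarrow> ('n, 'k) mpoly set \<Rightarrow> bool"
  assumes base: "\<And>N1 N2. graded_ideal N1 \<Longrightarrow> graded_ideal N2 \<Longrightarrow> N2 \<subseteq> N1 \<Longrightarrow>
      (\<And>v x. x \<in> N1 \<Longrightarrow> var v * x \<in> N2) \<Longrightarrow> P N1 N2"
    and ext: "\<And>N1 N2 N3. graded_ideal N1 \<Longrightarrow> graded_ideal N2 \<Longrightarrow> graded_ideal N3 \<Longrightarrow> N3 \<subseteq> N2 \<Longrightarrow> N2 \<subseteq> N1 \<Longrightarrow>
      P N1 N2 \<Longrightarrow> P N2 N3 \<Longrightarrow> P N1 N3"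
    and nzd: "\<And>N1 N2 v. graded_ideal N1 \<Longrightarrow> graded_ideal N2 \<Longrightarrow> N2 \<subseteq> N1 \<Longrightarrow> nonzerodivisor_on (var v) N1 N2 \<Longrightarrow>
      P N1 (add_multiples N2 (var v) N1) \<Longrightarrow> P N1 N2"
    and N: "graded_ideal N1" "graded_ideal N2" "N2 \<subseteq> N1"
  shows "P N1 N2"
  using N
proof (induction "card {v. \<exists>x\<in>N1. var v * x \<notin> N2}" arbitrary: N1 N2 rule: less_induct)
  case less
  show ?case
  proof (cases "{v. \<exists>x\<in>N1. var v * x \<notin> N2} = {}")
    case True
    then show ?thesis using base less.prems by blast
  next
    case False
    then obtain v where v: "\<exists>x\<in>N1. var v * x \<notin> N2" by blast
    note idl = graded_is_ideal[OF less.prems(1)] graded_is_ideal[OF less.prems(2)]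
    have smaller: "P M1 M2" if M: "graded_ideal M1" "graded_ideal M2" "M2 \<subseteq> M1"
      and kill: "\<And>x. x \<in> M1 \<Longrightarrow> var v * x \<in> M2" and sub: "M1 \<subseteq> N1" "N2 \<subseteq> M2" for M1 M2
    proof (rule less.hyps[OF _ M])
      have "{u. \<exists>x\<in>M1. var u * x \<notin> M2} \<subset> {v. \<exists>x\<in>N1. var v * x \<notin> N2}"
      proof (rule psubsetI)
        show "{u. \<exists>x\<in>M1. var u * x \<notin> M2} \<subseteq> {v. \<exists>x\<in>N1. var v * x \<notin> N2}" using sub by blast
        show "{u. \<exists>x\<in>M1. var u * x \<notin> M2} \<noteq> {v. \<exists>x\<in>N1. var v * x \<notin> N2}" using v kill by blast
      qed
      then show "card {u. \<exists>x\<in>M1. var u * x \<notin> M2} < card {v. \<exists>x\<in>N1. var v * x \<notin> N2}"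
        by (intro psubset_card_mono) auto
    qed
    \<comment> \<open>The elements killed by x_v^l modulo \<open>N2\<close>. Once this chain stops,
      it contains the whole x_v-torsion.\<close>
    define G where "G l = N1 \<inter> ideal_quot N2 (var v ^ l)" for l
    have grG: "graded_ideal (G l)" for l
      unfolding G_def var_power using less.prems graded_ideal_quot_mon graded_ideal_Int by blast
    have G_Suc: "x \<in> G (Suc l) \<longleftrightarrow> x \<in> N1 \<and> var v * x \<in> G l" for x l
    proof -
      have e: "var v ^ Suc l * x = var v ^ l * (var v * x)" by (simp add: ac_simps)
      show ?thesis
        using ideal_mult[OF idl(1), of x "var v"] unfolding G_def ideal_quot_def Int_iff mem_Collect_eq e by blast
    qed
    have G0: "G 0 = N2" using less.prems(3) by (auto simp: G_def ideal_quot_def)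
    have inc: "G l \<subseteq> G (Suc l)" for l
      unfolding G_def ideal_quot_def using ideal_mult[OF idl(2)] by (auto simp: mult.assoc)
    have N2G: "N2 \<subseteq> G l" for l
      by (induction l) (use G0 inc in blast)+
    have GN1: "G l \<subseteq> N1" for l by (auto simp: G_def)
    obtain l where l: "G (Suc l) = G l" using graded_chain_stops[of G] grG inc by blast
    have "P (G m) N2" for m
    proof (induction m)
      case 0
      show ?case unfolding G0 using idl(2) less.prems(2,3) ideal_mult by (intro smaller) auto
    next
      case (Suc m)
      have "P (G (Suc m)) (G m)" using G_Suc GN1 N2G by (intro smaller grG inc) auto
      then show ?case using ext[OF grG grG less.prems(2) N2G inc] Suc by blast
    qed
    moreover have "P N1 (G l)"
    proof (rule nzd[OF less.prems(1) grG GN1])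
      show "nonzerodivisor_on (var v) N1 (G l)" unfolding nonzerodivisor_on_def using G_Suc l by blast
      show "P N1 (add_multiples (G l) (var v) N1)"
      proof (rule smaller)
        show "graded_ideal N1" by (rule less.prems(1))
        show "graded_ideal (add_multiples (G l) (var v) N1)" by (rule graded_add_multiples[OF grG less.prems(1)])
        show "add_multiples (G l) (var v) N1 \<subseteq> N1" by (rule add_multiples_subset[OF idl(1) GN1])
        show "N2 \<subseteq> add_multiples (G l) (var v) N1"
          using N2G add_multiples_superset[OF idl(1)] by blast
        show "var v * x \<in> add_multiples (G l) (var v) N1" if "x \<in> N1" for x
          by (rule add_multiples_mult[OF graded_is_ideal[OF grG] that])
      qed simp
    qed
    ultimately show ?thesis using ext[OF less.prems(1) grG less.prems(2) N2G GN1] by blast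
  qed
qed

section \<open>Hilbert functions\<close>

definition hilb_fun :: "('n::{finite,linorder}, 'k::field) mpoly set \<Rightarrow> ('n, 'k) mpoly set \<Rightarrow> int \<Rightarrow> nat" where
  "hilb_fun N1 N2 j = qd (\<lambda>c f. const c * f) (N1 \<inter> homogeneous_part j) (N2 \<inter> homogeneous_part j)"

definition coh_fun :: "('n::{finite,linorder}, 'k::field) mpoly set \<Rightarrow> ('n, 'k) mpoly set \<Rightarrow> int \<Rightarrow> int \<Rightarrow> nat" where
  "coh_fun N1 N2 p j = V.hdim (cech_graded j N1) (cech_graded j N2) p"

definition coh_fin :: "('n::{finite,linorder}, 'k::field) mpoly set \<Rightarrow> ('n, 'k) mpoly set \<Rightarrow> int \<Rightarrow> int \<Rightarrow> bool" where
  "coh_fin N1 N2 p j \<longleftrightarrow> V.hfin (cech_graded j N1) (cech_graded j N2) p"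

lemma R_subspace_Int: "is_ideal N \<Longrightarrow> R.subspace (N \<inter> homogeneous_part j)"
  by (intro R.subspace_inter R_subspace_ideal R_subspace_homogeneous_part)

lemma qfin_hilb:
  fixes N1 N2 :: "('n::{finite,linorder}, 'k::field) mpoly set"
  assumes "is_ideal N1" "is_ideal N2"
  shows "qfin (\<lambda>c f. const c * f) (N1 \<inter> homogeneous_part j) (N2 \<inter> homogeneous_part j)"
proof (rule R.qfinI[OF R_subspace_Int[OF assms(1)] R_subspace_Int[OF assms(2)]])
  let ?F = "(mon :: _ \<Rightarrow> ('n, 'k) mpoly) ` {a. pdeg a = j}"
  show "finite ?F" by (rule finite_imageI[OF finite_monomials_of_degree])
  show "N1 \<inter> homogeneous_part j \<subseteq> R.span (?F \<union> N2 \<inter> homogeneous_part j)"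
  proof
    fix f :: "('n, 'k) mpoly" assume f: "f \<in> N1 \<inter> homogeneous_part j"
    have "Poly_Mapping.single k c \<in> R.span (?F \<union> N2 \<inter> homogeneous_part j)" if "k \<in> Poly_Mapping.keys f" for k c
    proof -
      have "pdeg k = j" using f that by (auto simp: homogeneous_part_def)
      then have "const c * mon k \<in> R.span (?F \<union> N2 \<inter> homogeneous_part j)"
        by (intro R.span_scale R.span_base) auto
      then show ?thesis by (simp add: const_def mon_def mult_single)
    qed
    then have "(\<Sum>k\<in>Poly_Mapping.keys f. Poly_Mapping.single k (Poly_Mapping.lookup f k)) \<in> R.span (?F \<union> N2 \<inter> homogeneous_part j)"
      by (intro R.span_sum)
    then show "f \<in> R.span (?F \<union> N2 \<inter> homogeneous_part j)" by (simp add: sum_singles)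
  qed
qed

lemma hilb_fun_add:
  assumes "is_ideal N1" "is_ideal N2" "is_ideal N3" "N3 \<subseteq> N2" "N2 \<subseteq> N1"
  shows "hilb_fun N1 N3 j = hilb_fun N1 N2 j + hilb_fun N2 N3 j"
  unfolding hilb_fun_def using assms
  by (intro R.qd_trans R_subspace_Int qfin_hilb) auto

lemma homogeneous_part_negative: "j < 0 \<Longrightarrow> homogeneous_part j = {0}"
proof -
  assume "j < 0"
  then have "Poly_Mapping.keys f = {}" if "f \<in> homogeneous_part j" for f :: "('a, 'b) mpoly"
    using that by (force simp: homogeneous_part_def)
  then show ?thesis by (auto simp: homogeneous_part_def)
qed

lemma hilb_fun_negative:
  assumes "is_ideal N1" "is_ideal N2" "j < 0"
  shows "hilb_fun N1 N2 j = 0"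
  unfolding hilb_fun_def using assms ideal_0[of N2]
  by (intro R.qd_trivial R_subspace_Int) (auto simp: homogeneous_part_negative)

lemma hilb_fun_multiples:
  assumes N: "graded_ideal N1" "graded_ideal N2" "N2 \<subseteq> N1" and v: "nonzerodivisor_on (var v) N1 N2"
  shows "hilb_fun (add_multiples N2 (var v) N1) N2 j = hilb_fun N1 N2 (j - 1)"
proof -
  note idl = graded_is_ideal[OF N(1)] graded_is_ideal[OF N(2)]
  interpret vp: vector_space_pair "\<lambda>c f. const c * f" "\<lambda>c f. const c * f" ..
  let ?N = "add_multiples N2 (var v) N1"
  have N': "is_ideal ?N" using ideal_add_multiples[OF idl(2,1)] .
  have "hilb_fun N1 N2 (j - 1) = hilb_fun ?N N2 j"
    unfolding hilb_fun_def
  proof (rule vp.qd_transfer(2)[where f = "\<lambda>x. var v * x"])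
    show "(\<lambda>x. var v * x) ` (N1 \<inter> homogeneous_part (j - 1)) \<subseteq> ?N \<inter> homogeneous_part j"
      using add_multiples_mult[OF idl(2)] by (auto simp: mem_homogeneous_part_iff hpart_var_mult)
    show "var v * z \<in> N2 \<inter> homogeneous_part j \<longleftrightarrow> z \<in> N2 \<inter> homogeneous_part (j - 1)"
      if "z \<in> N1 \<inter> homogeneous_part (j - 1)" for z
      using that v ideal_mult[OF idl(2)] unfolding nonzerodivisor_on_def
      by (auto simp: mem_homogeneous_part_iff hpart_var_mult)
    show "\<exists>z\<in>N1 \<inter> homogeneous_part (j - 1). y - var v * z \<in> N2 \<inter> homogeneous_part j"
      if y: "y \<in> ?N \<inter> homogeneous_part j" for y
    proof -
      obtain a b where ab: "y = a + var v * b" "a \<in> N2" "b \<in> N1" using y unfolding add_multiples_def by blast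
      have "y = hpart pdeg j y" using y by (simp add: mem_homogeneous_part_iff)
      also have "\<dots> = hpart pdeg j a + var v * hpart pdeg (j - 1) b" by (simp add: ab(1) hpart_add hpart_var_mult)
      finally have "y - var v * hpart pdeg (j - 1) b = hpart pdeg j a" by simp
      then show ?thesis
        using graded_hpart[OF N(1) ab(3)] graded_hpart[OF N(2) ab(2)] hpart_mem_homogeneous_part
        by (intro bexI[of _ "hpart pdeg (j - 1) b"]) auto
    qed
  qed (use R_subspace_Int idl N' qfin_hilb in \<open>auto simp: distrib_left mult.left_commute\<close>)
  then show ?thesis by simp
qed

lemma cech_graded_0_iff_hilb:
  fixes N1 N2 :: "('n::{finite,linorder}, 'k::field) mpoly set"
  assumes N: "is_ideal N1" "is_ideal N2"
  shows "qfin (\<lambda>c. act (const c)) (cech_graded j N1 0) (cech_graded j N2 0)"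
    "qd (\<lambda>c. act (const c)) (cech_graded j N1 0) (cech_graded j N2 0) = hilb_fun N1 N2 j"
proof -
  interpret vp: vector_space_pair "\<lambda>c f. const c * f" "\<lambda>c. act (const c)" ..
  let ?f = "\<lambda>r S. if S = {} then laurent_of r else (0 :: ('n, 'k) laurent)"
  have loc0: "loc_ideal N {} = laurent_of ` N" for N :: "('n, 'k) mpoly set"
    by (auto simp: loc_ideal_def lfrac_0_right)
  have mem: "?f r \<in> cech_graded j N 0 \<longleftrightarrow> r \<in> N \<inter> homogeneous_part j" if "is_ideal N" for r N
  proof -
    have "?f r \<in> cech_ideal N 0 \<longleftrightarrow> r \<in> N"
      using loc_ideal_0[OF that] loc0[of N] by (auto simp: cech_ideal_def laurent_of_inject)
    moreover have "hpart_cochain j (?f r) = ?f r \<longleftrightarrow> hpart pdeg j r = r"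
    proof -
      have "hpart_cochain j (?f r) = ?f (hpart pdeg j r)"
        by (auto simp: hpart_cochain_def laurent_of_hpart)
      then show ?thesis by (metis laurent_of_inject)
    qed
    ultimately show ?thesis by (simp add: cech_graded_def mem_homogeneous_part_iff)
  qed
  have surj: "\<exists>r. c = ?f r" if c: "c \<in> cech_graded j N1 0" for c
  proof -
    have "c {} \<in> laurent_of ` N1" "\<And>S. S \<noteq> {} \<Longrightarrow> c S = 0"
      using c loc0[of N1] by (auto simp: cech_graded_def cech_ideal_def)
    then show ?thesis by (auto simp: fun_eq_iff)
  qed
  have subs: "V.subspace (cech_graded j N1 0)" "V.subspace (cech_graded j N2 0)"
    using subcomplex_cech_graded N unfolding V.subcomplex_def by blast+
  have "\<exists>z\<in>N1 \<inter> homogeneous_part j. c - ?f z \<in> cech_graded j N2 0" if c: "c \<in> cech_graded j N1 0" for c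
  proof -
    obtain r where r: "c = ?f r" using surj[OF c] by blast
    then have "r \<in> N1 \<inter> homogeneous_part j" using c mem[OF N(1)] by blast
    moreover have "c - ?f r \<in> cech_graded j N2 0" using r V.subspace_0[OF subs(2)] by simp
    ultimately show ?thesis by blast
  qed
  note tr = vp.qd_transfer[where f = ?f, OF R_subspace_Int[OF N(1)] R_subspace_Int[OF N(2)] _ _ subs _ _ this]
  have eq: "qfin (\<lambda>c f. const c * f) (N1 \<inter> homogeneous_part j) (N2 \<inter> homogeneous_part j) \<longleftrightarrow>
      qfin (\<lambda>c. act (const c)) (cech_graded j N1 0) (cech_graded j N2 0)"
    "qfin (\<lambda>c f. const c * f) (N1 \<inter> homogeneous_part j) (N2 \<inter> homogeneous_part j) \<Longrightarrow>
      qd (\<lambda>c f. const c * f) (N1 \<inter> homogeneous_part j) (N2 \<inter> homogeneous_part j) =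
      qd (\<lambda>c. act (const c)) (cech_graded j N1 0) (cech_graded j N2 0)"
    by (rule tr; use mem[OF N(1)] mem[OF N(2)] in
        \<open>auto simp: laurent_of_add laurent_of_mult act_def fun_eq_iff\<close>)+
  show "qfin (\<lambda>c. act (const c)) (cech_graded j N1 0) (cech_graded j N2 0)"
    using eq(1) qfin_hilb[OF N] by blast
  show "qd (\<lambda>c. act (const c)) (cech_graded j N1 0) (cech_graded j N2 0) = hilb_fun N1 N2 j"
    unfolding hilb_fun_def using eq(2) qfin_hilb[OF N] by simp
qed

lemma coh_trivial:
  assumes "is_ideal N1" "is_ideal N2"
    and "V.cocyc (cech_graded j N1) (cech_graded j N2) p \<subseteq> V.cobd (cech_graded j N1) (cech_graded j N2) p"
  shows "coh_fin N1 N2 p j" "coh_fun N1 N2 p j = 0"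
  using V.hdim_trivial[OF subcomplex_cech_graded[OF assms(1)] subcomplex_cech_graded[OF assms(2)] assms(3)]
  by (simp_all add: coh_fin_def coh_fun_def)

lemma coh_trivial_subset:
  assumes "is_ideal N1" "is_ideal N2" "cech_graded j N1 p \<subseteq> cech_graded j N2 p"
  shows "coh_fin N1 N2 p j" "coh_fun N1 N2 p j = 0"
proof -
  have "V.cocyc (cech_graded j N1) (cech_graded j N2) p \<subseteq> V.cobd (cech_graded j N1) (cech_graded j N2) p"
  proof
    fix z assume "z \<in> V.cocyc (cech_graded j N1) (cech_graded j N2) p"
    then have "z \<in> cech_graded j N2 p" using assms(3) by (auto simp: V.cocyc_def)
    moreover have "0 \<in> cech_graded j N1 (p - 1)"
      using subcomplex_cech_graded[OF assms(1)] V.subspace_0 unfolding V.subcomplex_def by blast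
    ultimately have "z + cdiff 0 \<in> V.cobd (cech_graded j N1) (cech_graded j N2) p" unfolding V.cobd_def by blast
    then show "z \<in> V.cobd (cech_graded j N1) (cech_graded j N2) p" by (simp add: V.d_0)
  qed
  from coh_trivial[OF assms(1,2) this] show "coh_fin N1 N2 p j" "coh_fun N1 N2 p j = 0" by blast+
qed

lemma coh_out_of_range:
  fixes N1 N2 :: "('n::{finite,linorder}, 'k::field) mpoly set"
  assumes "is_ideal N1" "is_ideal N2" "p < 0 \<or> p > int (card (UNIV :: 'n set))"
  shows "coh_fin N1 N2 p j" "coh_fun N1 N2 p j = 0"
  using coh_trivial_subset[OF assms(1,2)] cech_graded_out_of_range[OF assms(1,3)]
    cech_graded_out_of_range[OF assms(2,3)] by auto

text \<open>H^0 is a submodule of N1/N2, and that has no elements of negative degree. The growth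
  bound for H^1 starts from here.\<close>

lemma coh_0_negative:
  assumes N: "is_ideal N1" "is_ideal N2" "j < 0"
  shows "coh_fun N1 N2 0 j = 0"
proof (rule coh_trivial_subset[OF N(1,2)])
  have "hilb_fun N1 N2 j = 0" by (rule hilb_fun_negative[OF N])
  then show "cech_graded j N1 0 \<subseteq> cech_graded j N2 0"
    using V.qd_eq_0D cech_graded_0_iff_hilb[OF N(1,2)] by metis
qed

text \<open>Multiplication by x_v identifies M(-1) with x_v M, the latter being the pair with
  numerator \<open>add_multiples N2 (var v) N1\<close>.\<close>

lemma coh_shift:
  assumes N: "graded_ideal N1" "graded_ideal N2" "N2 \<subseteq> N1" and v: "nonzerodivisor_on (var v) N1 N2"
  shows "coh_fin (add_multiples N2 (var v) N1) N2 p j \<longleftrightarrow> coh_fin N1 N2 p (j - 1)"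
    "coh_fin N1 N2 p (j - 1) \<Longrightarrow> coh_fun (add_multiples N2 (var v) N1) N2 p j = coh_fun N1 N2 p (j - 1)"
proof -
  note idl = graded_is_ideal[OF N(1)] graded_is_ideal[OF N(2)]
  interpret vp: vector_space_pair "\<lambda>c. act (const c)" "\<lambda>c. act (const c)" ..
  let ?N = "add_multiples N2 (var v) N1" and ?x = "act (var v)"
  have N': "is_ideal ?N" using ideal_add_multiples[OF idl(2,1)] .
  have dec: "cech_graded j ?N p = {w + ?x u |w u. w \<in> cech_graded j N2 p \<and> u \<in> cech_graded (j - 1) N1 p}" for p
    by (rule cech_graded_add_multiples[OF N(2,1)])
  have sub0: "0 \<in> cech_graded j M p" if "is_ideal M" for M p j
    using subcomplex_cech_graded[OF that] V.subspace_0 unfolding V.subcomplex_def by blast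
  have subm: "a - b \<in> cech_graded j M p" if "is_ideal M" "a \<in> cech_graded j M p" "b \<in> cech_graded j M p" for M a b p j
    using subcomplex_cech_graded[OF that(1)] V.subspace_diff that(2,3) unfolding V.subcomplex_def by blast
  have suba: "a + b \<in> cech_graded j M p" if "is_ideal M" "a \<in> cech_graded j M p" "b \<in> cech_graded j M p" for M a b p j
    using subcomplex_cech_graded[OF that(1)] V.subspace_add that(2,3) unfolding V.subcomplex_def by blast
  have subd: "cdiff a \<in> cech_graded j M (p + 1)" if "is_ideal M" "a \<in> cech_graded j M p" for M a p j
    using subcomplex_cech_graded[OF that(1)] that(2) unfolding V.subcomplex_def by blast
  have xN2: "?x w \<in> cech_graded j N2 p" if "w \<in> cech_graded (j - 1) N2 p" for w p
    using that cech_ideal_act[OF idl(2)] by (simp add: cech_graded_def hpart_cochain_act_var)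
  have xN: "?x u \<in> cech_graded j ?N p" if "u \<in> cech_graded (j - 1) N1 p" for u p
  proof -
    have "0 + ?x u \<in> cech_graded j ?N p" unfolding dec using that sub0[OF idl(2)] by blast
    then show ?thesis by simp
  qed
  have xinj: "u \<in> cech_graded (j - 1) N2 p" if "u \<in> cech_graded (j - 1) N1 p" "?x u \<in> cech_graded j N2 p" for u p
    using that nonzerodivisor_on_cech[OF idl v] by (simp add: cech_graded_def)
  have x_diff: "?x (a - b) = ?x a - ?x b" for a b using act_add[of "var v" "a - b" b] by simp
  let ?Z = "V.cocyc (cech_graded (j - 1) N1) (cech_graded (j - 1) N2) p"
  let ?B = "V.cobd (cech_graded (j - 1) N1) (cech_graded (j - 1) N2) p"
  let ?Z' = "V.cocyc (cech_graded j ?N) (cech_graded j N2) p"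
  let ?B' = "V.cobd (cech_graded j ?N) (cech_graded j N2) p"
  have fZ: "?x ` ?Z \<subseteq> ?Z'"
    using xN xN2 by (auto simp: V.cocyc_def simp flip: act_cdiff)
  have ker: "?x z \<in> ?B' \<longleftrightarrow> z \<in> ?B" if z: "z \<in> ?Z" for z
  proof
    assume "z \<in> ?B"
    then obtain w u where "z = w + cdiff u" "w \<in> cech_graded (j - 1) N2 p" "u \<in> cech_graded (j - 1) N1 (p - 1)"
      unfolding V.cobd_def by blast
    moreover from this(1) have "?x z = ?x w + cdiff (?x u)" by (simp add: act_add act_cdiff)
    ultimately show "?x z \<in> ?B'" using xN xN2 unfolding V.cobd_def by blast
  next
    assume "?x z \<in> ?B'"
    then obtain w u where wu: "?x z = w + cdiff u" "w \<in> cech_graded j N2 p" "u \<in> cech_graded j ?N (p - 1)"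
      unfolding V.cobd_def by blast
    then obtain w' u' where wu': "u = w' + ?x u'" "w' \<in> cech_graded j N2 (p - 1)" "u' \<in> cech_graded (j - 1) N1 (p - 1)"
      unfolding dec by blast
    have "?x (z - cdiff u') = w + cdiff w'"
      unfolding x_diff wu(1) wu'(1) by (simp add: cdiff_add act_cdiff)
    moreover have "w + cdiff w' \<in> cech_graded j N2 p"
      using suba[OF idl(2) wu(2)] subd[OF idl(2) wu'(2)] by simp
    moreover have "z - cdiff u' \<in> cech_graded (j - 1) N1 p"
      using z subm[OF idl(1)] subd[OF idl(1) wu'(3)] by (simp add: V.cocyc_def)
    ultimately have "z - cdiff u' \<in> cech_graded (j - 1) N2 p" using xinj by simp
    then have "(z - cdiff u') + cdiff u' \<in> ?B" using wu'(3) unfolding V.cobd_def by blast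
    then show "z \<in> ?B" by simp
  qed
  have surj: "\<exists>z\<in>?Z. y - ?x z \<in> ?B'" if y: "y \<in> ?Z'" for y
  proof -
    obtain w u where wu: "y = w + ?x u" "w \<in> cech_graded j N2 p" "u \<in> cech_graded (j - 1) N1 p"
      using y unfolding V.cocyc_def dec by blast
    have "?x (cdiff u) = cdiff y - cdiff w" by (simp add: wu(1) cdiff_add act_cdiff)
    then have "?x (cdiff u) \<in> cech_graded j N2 (p + 1)"
      using y subm[OF idl(2) _ subd[OF idl(2) wu(2)]] by (simp add: V.cocyc_def)
    then have "u \<in> ?Z" using xinj[OF subd[OF idl(1) wu(3)]] wu(3) by (simp add: V.cocyc_def)
    moreover have "w + cdiff 0 \<in> ?B'" using wu(2) sub0[OF N'] unfolding V.cobd_def by blast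
    then have "y - ?x u \<in> ?B'" using wu(1) by (simp add: V.d_0)
    ultimately show ?thesis by blast
  qed
  have sc: "V.subcomplex (cech_graded k N1)" "V.subcomplex (cech_graded k N2)" "V.subcomplex (cech_graded k ?N)" for k
    using subcomplex_cech_graded idl N' by blast+
  note tr = vp.qd_transfer[where f = ?x, OF V.subspace_cocyc[OF sc(1,2)] V.subspace_cobd[OF sc(1,2)] _ _
      V.subspace_cocyc[OF sc(3,2)] V.subspace_cobd[OF sc(3,2)] fZ ker surj]
  have com: "act (var v) (act (const c) x) = act (const c) (act (var v) x)" for c x
    by (simp add: act_act mult.commute)
  show "coh_fin ?N N2 p j \<longleftrightarrow> coh_fin N1 N2 p (j - 1)"
    unfolding coh_fin_def V.hfin_def by (rule tr(1)[symmetric]) (simp_all add: act_add com)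
  show "coh_fun ?N N2 p j = coh_fun N1 N2 p (j - 1)" if "coh_fin N1 N2 p (j - 1)"
    unfolding coh_fun_def V.hdim_def
    by (rule tr(2)[symmetric]) (use that in \<open>simp_all add: act_add com coh_fin_def V.hfin_def\<close>)
qed

section \<open>Backward differences\<close>

definition nabla :: "(int \<Rightarrow> int) \<Rightarrow> int \<Rightarrow> int" where
  "nabla g = (\<lambda>j. g j - g (j - 1))"

lemma nabla_pow_add: "(nabla ^^ r) (\<lambda>j. f j + g j) = (\<lambda>j. (nabla ^^ r) f j + (nabla ^^ r) g j)"
  by (induction r) (simp_all add: nabla_def algebra_simps)

lemma nabla_pow_mult: "(nabla ^^ r) (\<lambda>j. c * g j) = (\<lambda>j. c * (nabla ^^ r) g j)"
  by (induction r) (simp_all add: nabla_def algebra_simps)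

lemma nabla_pow_0: "(nabla ^^ r) (\<lambda>_. 0) = (\<lambda>_. 0)"
  by (induction r) (simp_all add: nabla_def)

lemma nabla_pow_mono:
  assumes "(nabla ^^ r) g = (\<lambda>_. 0)" "r \<le> s"
  shows "(nabla ^^ s) g = (\<lambda>_. 0)"
proof -
  have "(nabla ^^ s) g = (nabla ^^ (s - r)) ((nabla ^^ r) g)"
    using assms(2) by (simp add: funpow_add[symmetric] flip: o_apply[of "nabla ^^ (s - r)"])
  then show ?thesis using assms(1) by (simp add: nabla_pow_0)
qed

lemma nabla_pow_zero_below:
  assumes "\<And>j. j < k \<Longrightarrow> g j = 0" "j < k"
  shows "(nabla ^^ r) g j = 0"
  using assms(2) by (induction r arbitrary: j) (simp_all add: nabla_def assms(1))

lemma nabla_pow_zero_above: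
  assumes "\<And>j. j \<ge> k \<Longrightarrow> g j = 0" "j \<ge> k + int r"
  shows "(nabla ^^ r) g j = 0"
  using assms(2) by (induction r arbitrary: j) (simp_all add: nabla_def assms(1))

text \<open>For a polynomial function of degree \<open>s\<close> the \<open>s\<close>-th difference
  with step \<open>K\<close> is \<open>K ^ s\<close> times the ordinary one, while it only sees
  values in a window of length \<open>s * K\<close>.\<close>

definition step_diff :: "nat \<Rightarrow> (int \<Rightarrow> int) \<Rightarrow> int \<Rightarrow> int" where
  "step_diff K g = (\<lambda>j. g j - g (j - int K))"

lemma nabla_step_diff_pow: "nabla ((step_diff K ^^ s) g) = (step_diff K ^^ s) (nabla g)"
proof (induction s arbitrary: g)
  case (Suc s)
  have "nabla (step_diff K h) = step_diff K (nabla h)" for h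
    by (rule ext) (simp add: nabla_def step_diff_def algebra_simps)
  then show ?case using Suc by simp
qed simp

lemma step_diff_of_constant_nabla:
  assumes "\<And>j. nabla g j = c"
  shows "step_diff K g j = int K * c"
proof -
  have "g j - g (j - int K) = int K * c"
  proof (induction K)
    case (Suc K)
    have "j - int (Suc K) = j - int K - 1" by simp
    then have "g (j - int K) - g (j - int (Suc K)) = c" using assms[of "j - int K"] by (simp only: nabla_def)
    then show ?case using Suc by (simp add: algebra_simps)
  qed simp
  then show ?thesis by (simp add: step_diff_def)
qed

lemma step_diff_pow_of_constant_nabla:
  assumes "\<And>j. (nabla ^^ s) g j = c"
  shows "(step_diff K ^^ s) g j = int K ^ s * c"
  using assms
proof (induction s arbitrary: g j)
  case (Suc s)
  have "(nabla ^^ s) (nabla g) j = c" for j using Suc.prems by (simp add: funpow_swap1)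
  then have "(step_diff K ^^ s) (nabla g) j = int K ^ s * c" for j using Suc.IH by blast
  then have "nabla ((step_diff K ^^ s) g) j = int K ^ s * c" for j by (simp add: nabla_step_diff_pow)
  from step_diff_of_constant_nabla[OF this] show ?case by (simp add: mult.assoc)
qed simp

lemma step_diff_pow_bound:
  assumes "\<And>t. t \<le> j \<Longrightarrow> t \<ge> j - int (s * K) \<Longrightarrow> \<bar>g t\<bar> \<le> b"
  shows "\<bar>(step_diff K ^^ s) g j\<bar> \<le> 2 ^ s * b"
  using assms
proof (induction s arbitrary: j)
  case (Suc s)
  have "\<bar>(step_diff K ^^ s) g j\<bar> \<le> 2 ^ s * b" by (rule Suc.IH) (use Suc.prems in auto)
  moreover have "\<bar>(step_diff K ^^ s) g (j - int K)\<bar> \<le> 2 ^ s * b"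
    by (rule Suc.IH) (use Suc.prems in auto)
  ultimately show ?case by (simp add: step_diff_def[of K "(step_diff K ^^ s) g"])
qed simp

text \<open>A function annihilated by some \<open>\<nabla>\<^sup>r\<close> is polynomial, and if it grows like \<open>\<bar>j\<bar>\<^sup>i\<close> as
  \<open>j \<rightarrow> -\<infinity>\<close>, its degree is at most \<open>i\<close>: otherwise the leading difference with step \<open>K\<close> grows faster
  in \<open>K\<close> than the bound allows.\<close>

lemma nabla_pow_zero_of_growth:
  fixes g :: "int \<Rightarrow> int" and C :: nat
  assumes r: "(nabla ^^ r) g = (\<lambda>_. 0)"
    and bound: "\<And>j. j < 0 \<Longrightarrow> \<bar>g j\<bar> \<le> int (C * nat (D - j) ^ i)"
  shows "(nabla ^^ Suc i) g = (\<lambda>_. 0)"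
proof -
  have descend: "(nabla ^^ m) g = (\<lambda>_. 0)" if m: "(nabla ^^ Suc m) g = (\<lambda>_. 0)" "m > i" for m
  proof -
    define c where "c = (nabla ^^ m) g 0"
    have const: "(nabla ^^ m) g j = c" for j
    proof -
      have e: "(nabla ^^ m) g j = (nabla ^^ m) g (j - 1)" for j
        using fun_cong[OF m(1), of j] by (simp add: nabla_def)
      show ?thesis
      proof (induction j rule: int_induct[where k = 0])
        case (step1 j)
        then show ?case using e[of "j + 1"] by simp
      next
        case (step2 j)
        then show ?case using e[of j] by simp
      qed (simp add: c_def)
    qed
    \<comment> \<open>The \<open>m\<close>-fold difference with step \<open>K\<close> at -1 involves
      \<open>t\<close> between \<open>- 1 - m * K\<close> and -1, and there \<open>D - t\<close> is
      at most \<open>D' + m * K\<close>, hence at most \<open>K * (D' + m)\<close>. The base point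
      -1 keeps the window in the negative range.\<close>
    define D' where "D' = nat D + 1"
    define E where "E = 2 ^ m * C * (D' + m) ^ i"
    \<comment> \<open>The difference equals \<open>K ^ m * c\<close> and is bounded by
      \<open>K ^ i * E\<close>. Dividing by \<open>K ^ i\<close> leaves at least one factor
      \<open>K\<close> on the left, since \<open>m > i\<close>.\<close>
    have main: "int K * \<bar>c\<bar> \<le> int E" if K: "K \<ge> 1" for K
    proof -
      have "\<bar>g t\<bar> \<le> int (C * (K * (D' + m)) ^ i)" if t: "t \<le> - 1" "t \<ge> - 1 - int (m * K)" for t
      proof -
        have "D - t \<le> int (D' + m * K)" using t by (simp add: D'_def)
        then have "nat (D - t) \<le> D' + m * K" by (simp only: nat_le_iff)
        also have "\<dots> \<le> K * (D' + m)" using K by (simp add: algebra_simps)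
        finally have "nat (D - t) ^ i \<le> (K * (D' + m)) ^ i" by (rule power_mono) simp
        then have "C * nat (D - t) ^ i \<le> C * (K * (D' + m)) ^ i" by (rule mult_le_mono2)
        then show ?thesis using bound[of t] t by linarith
      qed
      then have "\<bar>(step_diff K ^^ m) g (- 1)\<bar> \<le> 2 ^ m * int (C * (K * (D' + m)) ^ i)"
        by (rule step_diff_pow_bound)
      then have "int K ^ m * \<bar>c\<bar> \<le> 2 ^ m * int (C * (K * (D' + m)) ^ i)"
        by (simp add: step_diff_pow_of_constant_nabla[OF const] abs_mult)
      also have "\<dots> = int K ^ i * int E" by (simp add: E_def power_mult_distrib)
      finally have le: "int K ^ m * \<bar>c\<bar> \<le> int K ^ i * int E" .
      have "int K ^ m = int K ^ i * int K ^ (m - i)" using m(2) by (simp flip: power_add)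
      then have "int K ^ i * (int K ^ (m - i) * \<bar>c\<bar>) \<le> int K ^ i * int E" using le by (simp add: mult.assoc)
      then have le2: "int K ^ (m - i) * \<bar>c\<bar> \<le> int E" using K by simp
      have "int K ^ 1 \<le> int K ^ (m - i)" using K m(2) by (intro power_increasing) auto
      then have "int K * \<bar>c\<bar> \<le> int K ^ (m - i) * \<bar>c\<bar>" by (intro mult_right_mono) auto
      then show ?thesis using le2 by simp
    qed
    have "c = 0"
    proof (rule ccontr)
      assume "c \<noteq> 0"
      then have "1 \<le> \<bar>c\<bar>" by simp
      then have "int (Suc E) * 1 \<le> int (Suc E) * \<bar>c\<bar>" by (intro mult_left_mono) auto
      moreover have "int (Suc E) * \<bar>c\<bar> \<le> int E" by (rule main) simp
      ultimately have "int (Suc E) * 1 \<le> int E" by (rule order_trans)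
      then show False by simp
    qed
    then show ?thesis using const by auto
  qed
  have "(nabla ^^ (Suc i + k)) g = (\<lambda>_. 0) \<Longrightarrow> (nabla ^^ Suc i) g = (\<lambda>_. 0)" for k
  proof (induction k)
    case (Suc k)
    then show ?case using descend[of "Suc i + k"] by simp
  qed simp
  moreover have "(nabla ^^ (Suc i + r)) g = (\<lambda>_. 0)" using r by (rule nabla_pow_mono) simp
  ultimately show ?thesis by blast
qed

text \<open>Summation downwards from \<open>D\<close>: increments of order m^p add up to at most
  order m^(p+1). This is how the growth exponent rises with the cohomological degree.\<close>

lemma descending_bound:
  fixes h c :: "int \<Rightarrow> nat"
  assumes "\<And>j. j \<ge> D \<Longrightarrow> h j = 0" "\<And>j. h j \<le> h (j + 1) + c (j + 1)" "\<And>j. c j \<le> C * nat (D - j) ^ p"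
  shows "h j \<le> C * nat (D - j) ^ Suc p"
proof -
  have *: "h (D - int m) \<le> C * m ^ Suc p" for m
  proof (induction m)
    case (Suc m)
    have "h (D - int (Suc m)) \<le> h (D - int m) + c (D - int m)" using assms(2)[of "D - int (Suc m)"] by simp
    also have "\<dots> \<le> C * m ^ Suc p + C * m ^ p" using Suc assms(3)[of "D - int m"] by simp
    also have "\<dots> = C * m ^ p * Suc m" by (simp add: algebra_simps)
    also have "\<dots> \<le> C * Suc m ^ p * Suc m" by (intro mult_le_mono power_mono) auto
    finally show ?case by (simp add: ac_simps)
  qed (use assms(1)[of D] in simp)
  show ?thesis
  proof (cases "j \<ge> D")
    case False
    then show ?thesis using *[of "nat (D - j)"] by simp
  qed (use assms(1) in simp)
qed

text \<open>The start of the growth bounds: increments coming from H^0 of the cokernel vanish in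
  negative degrees, so only finitely many contribute.\<close>

lemma descending_bound_constant:
  fixes h c :: "int \<Rightarrow> nat"
  assumes "\<And>j. j \<ge> D \<Longrightarrow> h j = 0" "\<And>j. h j \<le> h (j + 1) + c (j + 1)" "\<And>j. j < 0 \<Longrightarrow> c j = 0"
  shows "h j \<le> (\<Sum>e\<in>{0..D}. c e)"
proof -
  have *: "h (D - int m) + (\<Sum>e\<in>{0..D - int m}. c e) \<le> (\<Sum>e\<in>{0..D}. c e)" for m
  proof (induction m)
    case (Suc m)
    have s: "c (D - int m) + (\<Sum>e\<in>{0..D - int (Suc m)}. c e) = (\<Sum>e\<in>{0..D - int m}. c e)"
    proof (cases "D - int m < 0")
      case False
      then have "{0..D - int m} = insert (D - int m) {0..D - int (Suc m)}" by auto
      then show ?thesis by simp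
    qed (simp add: assms(3))
    show ?case using assms(2)[of "D - int (Suc m)"] Suc s by simp
  qed (use assms(1)[of D] in simp)
  show ?thesis
  proof (cases "j \<ge> D")
    case False
    then show ?thesis using *[of "nat (D - j)"] by simp
  qed (use assms(1) in simp)
qed

section \<open>The Grothendieck-Serre formula\<close>

definition serre_diff :: "('n::{finite,linorder}, 'k::field) mpoly set \<Rightarrow> ('n, 'k) mpoly set \<Rightarrow> int \<Rightarrow> int" where
  "serre_diff N1 N2 = (\<lambda>j. int (hilb_fun N1 N2 j) -
     (\<Sum>p\<le>card (UNIV :: 'n set). (- 1) ^ p * int (coh_fun N1 N2 (int p) j)))"

text \<open>Four properties proved in one induction, since finiteness and top vanishing of the
  cokernel feed those of the module. The exponent is one less than the cohomological degree; at
  \<open>p = 0\<close> the bound is the constant \<open>C\<close>.\<close>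

definition tame :: "('n::{finite,linorder}, 'k::field) mpoly set \<Rightarrow> ('n, 'k) mpoly set \<Rightarrow> bool" where
  "tame N1 N2 \<longleftrightarrow> (\<forall>p j. coh_fin N1 N2 p j) \<and>
     (\<exists>D. \<forall>p j. j \<ge> D \<longrightarrow> coh_fun N1 N2 p j = 0) \<and>
     (\<forall>p. \<exists>C D. \<forall>j. coh_fun N1 N2 (int p + 1) j \<le> C * nat (D - j) ^ p) \<and>
     (\<exists>r. (nabla ^^ r) (serre_diff N1 N2) = (\<lambda>_. 0))"

lemma single_mult_kill:
  assumes N: "is_ideal N1" "is_ideal N2" and kill: "\<And>v x. x \<in> N1 \<Longrightarrow> var v * x \<in> N2"
    and x: "x \<in> N1" and k: "k \<noteq> 0"
  shows "Poly_Mapping.single k c * x \<in> N2"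
proof -
  have "Poly_Mapping.keys k \<noteq> {}" using k by simp
  then obtain v where "v \<in> Poly_Mapping.keys k" by blast
  then have v: "Poly_Mapping.lookup k v \<noteq> 0" by (simp add: in_keys_iff)
  define k' where "k' = k - Poly_Mapping.single v 1"
  have "k = Poly_Mapping.single v 1 + k'"
    using v by (intro poly_mapping_eqI) (auto simp: k'_def lookup_add lookup_minus lookup_single when_def)
  then have "Poly_Mapping.single k c * x = var v * (Poly_Mapping.single k' c * x)"
    by (simp add: var_def mon_def mult_single flip: mult.assoc)
  then show ?thesis by (simp only: kill[OF ideal_mult[OF N(1) x]])
qed

text \<open>Were N1/N2 nonzero in infinitely many degrees e_l, the elements of \<open>N1\<close>
  whose parts from degree e_l on lie in \<open>N2\<close> would form a strictly ascending chain of
  graded ideals.\<close>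

lemma killed_finite_length:
  assumes N: "graded_ideal N1" "graded_ideal N2" "N2 \<subseteq> N1" and kill: "\<And>v x. x \<in> N1 \<Longrightarrow> var v * x \<in> N2"
  shows "\<exists>D. \<forall>j\<ge>D. N1 \<inter> homogeneous_part j \<subseteq> N2"
proof -
  note idl = graded_is_ideal[OF N(1)] graded_is_ideal[OF N(2)]
  define J where "J = {j :: nat. \<not> N1 \<inter> homogeneous_part (int j) \<subseteq> N2}"
  have "finite J"
  proof (rule ccontr)
    assume inf: "infinite J"
    define e where "e = enumerate J"
    define M where "M l = {f \<in> N1. \<forall>j\<ge>int (e l). hpart pdeg j f \<in> N2}" for l
    have e_Suc: "e l < e (Suc l)" for l unfolding e_def by (rule enumerate_step[OF inf])
    have id_M: "is_ideal (M l)" for l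
      unfolding is_ideal_def
    proof (intro conjI ballI allI)
      show "0 \<in> M l" using ideal_0[OF idl(1)] ideal_0[OF idl(2)] by (simp add: M_def)
      show "x + y \<in> M l" if "x \<in> M l" "y \<in> M l" for x y
        using that ideal_add[OF idl(1)] ideal_add[OF idl(2)] by (simp add: M_def hpart_add)
      fix x r assume x: "x \<in> M l"
      then have xN: "x \<in> N1" by (simp add: M_def)
      show "r * x \<in> M l"
      proof (induction r rule: poly_mapping_single_induct)
        case (single k c)
        \<comment> \<open>A nonconstant monomial carries all of \<open>N1\<close> into
          \<open>N2\<close>, so multiplication cannot push a part into the forbidden
          degrees.\<close>
        have "hpart pdeg j (Poly_Mapping.single k c * x) \<in> N2" if j: "j \<ge> int (e l)" for j
        proof (cases "k = 0")
          case True
          then show ?thesis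
            using x j ideal_mult[OF idl(2)] hpart_const_mult[of j c x] by (simp add: M_def const_def)
        next
          case False
          then show ?thesis using graded_hpart[OF N(2)] single_mult_kill[OF idl kill xN] by blast
        qed
        then show ?case using ideal_mult[OF idl(1) xN] by (simp add: M_def)
      next
        case (add f g)
        then show ?case using ideal_add[OF idl(1)] ideal_add[OF idl(2)] by (simp add: M_def hpart_add distrib_right)
      qed
    qed
    have "graded_ideal (M l)" for l
      unfolding graded_ideal_def
      using id_M graded_hpart[OF N(1)] ideal_0[OF idl(2)] by (auto simp: M_def hpart_hpart)
    moreover have "M l \<subset> M (Suc l)" for l
    proof -
      have "e l \<in> J" unfolding e_def by (rule enumerate_in_set[OF inf])
      then obtain f where f: "f \<in> N1" "f \<in> homogeneous_part (int (e l))" "f \<notin> N2" unfolding J_def by blast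
      have hf: "hpart pdeg j f = (if int (e l) = j then f else 0)" for j
        using hpart_hpart[of pdeg j "int (e l)" f] unfolding f(2)[unfolded mem_homogeneous_part_iff] .
      have "f \<in> M (Suc l)" using f(1) e_Suc[of l] ideal_0[OF idl(2)] by (simp add: M_def hf)
      moreover have "f \<notin> M l" using f(3) hf[of "int (e l)"] by (auto simp: M_def)
      moreover have "M l \<subseteq> M (Suc l)" using e_Suc[of l] by (auto simp: M_def)
      ultimately show ?thesis by blast
    qed
    ultimately show False by (rule no_strict_chain_of_graded_ideals[of M])
  qed
  then obtain m where m: "\<forall>j\<in>J. j \<le> m" unfolding finite_nat_set_iff_bounded_le by (elim exE)
  have "N1 \<inter> homogeneous_part j \<subseteq> N2" if j: "j \<ge> int m + 1" for j
  proof -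
    have "\<not> nat j \<le> m" using j by simp
    then have "nat j \<notin> J" using m by blast
    then show ?thesis using j by (simp add: J_def)
  qed
  then show ?thesis by blast
qed

text \<open>Inverting a variable that annihilates the module gives 0, so the only component left is
  the one with \<open>S = {}\<close>. Hence H^0 is the module itself, the other groups vanish, and
  \<open>serre_diff\<close> is 0.\<close>

lemma tame_base:
  assumes N: "graded_ideal N1" "graded_ideal N2" "N2 \<subseteq> N1" and kill: "\<And>v x. x \<in> N1 \<Longrightarrow> var v * x \<in> N2"
  shows "tame N1 N2"
proof -
  note idl = graded_is_ideal[OF N(1)] graded_is_ideal[OF N(2)]
  have pos: "cech_graded j N1 p \<subseteq> cech_graded j N2 p" if p: "p \<ge> 1" for p j
  proof
    fix c assume c: "c \<in> cech_graded j N1 p"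
    have "1 * var v ^ 1 \<in> ann N1 N2" for v using kill by (simp add: ann_def)
    then have "act 1 c \<in> cech_ideal N2 p"
      using cech_ideal_kill[OF idl(2), of c N1 p 1] c p unfolding cech_graded_def by blast
    then show "c \<in> cech_graded j N2 p" using c by (simp add: cech_graded_def)
  qed
  have ne0: "coh_fin N1 N2 p j \<and> coh_fun N1 N2 p j = 0" if "p \<noteq> 0" for p j
  proof (cases "p \<ge> 1")
    case True
    then show ?thesis using coh_trivial_subset[OF idl pos] by blast
  next
    case False
    then show ?thesis using coh_out_of_range[OF idl, of p j] that by simp
  qed
  have "V.cocyc (cech_graded j N1) (cech_graded j N2) 0 = cech_graded j N1 0" for j
    using subcomplex_cech_graded[OF idl(1), of j] pos[of 1 j] unfolding V.subcomplex_def V.cocyc_def by force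
  moreover have "V.cobd (cech_graded j N1) (cech_graded j N2) 0 = cech_graded j N2 0" for j
    using cech_graded_out_of_range[OF idl(1), of "- 1" j] by (simp add: V.cobd_def V.d_0)
  ultimately have zero: "coh_fin N1 N2 0 j" "coh_fun N1 N2 0 j = hilb_fun N1 N2 j" for j
    using cech_graded_0_iff_hilb[OF idl] by (simp_all add: coh_fin_def coh_fun_def V.hfin_def V.hdim_def)
  obtain D where D: "\<And>j. j \<ge> D \<Longrightarrow> N1 \<inter> homogeneous_part j \<subseteq> N2"
    using killed_finite_length[OF N kill] by blast
  have hz: "hilb_fun N1 N2 j = 0" if "j \<ge> D" for j
    unfolding hilb_fun_def using D[OF that] by (intro R.qd_trivial R_subspace_Int idl) auto
  have "serre_diff N1 N2 = (\<lambda>_. 0)"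
  proof
    fix j
    have "(\<Sum>p\<le>card (UNIV :: 'a set). (- 1) ^ p * int (coh_fun N1 N2 (int p) j)) =
      (\<Sum>p\<le>card (UNIV :: 'a set). if p = 0 then int (hilb_fun N1 N2 j) else 0)"
      using ne0 zero(2) by (intro sum.cong) auto
    then show "serre_diff N1 N2 j = 0" by (simp add: serre_diff_def)
  qed
  then have "(nabla ^^ 0) (serre_diff N1 N2) = (\<lambda>_. 0)" by simp
  moreover have "coh_fun N1 N2 p j = 0" if "j \<ge> D" for p j
    using ne0[of p j] zero(2)[of j] hz[OF that] by (cases "p = 0") auto
  moreover have "coh_fin N1 N2 p j" for p j using ne0 zero(1) by (cases "p = 0") auto
  moreover have "coh_fun N1 N2 (int p + 1) j \<le> 0 * nat (D - j) ^ p" for p j using ne0[of "int p + 1" j] by simp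
  ultimately show ?thesis unfolding tame_def by blast
qed

context
  fixes N1 N2 N3 :: "('n::{finite,linorder}, 'k::field) mpoly set"
  assumes N: "graded_ideal N1" "graded_ideal N2" "graded_ideal N3" "N3 \<subseteq> N2" "N2 \<subseteq> N1"
begin

private lemma complexes:
  "V.subcomplex (cech_graded j N1)" "V.subcomplex (cech_graded j N2)" "V.subcomplex (cech_graded j N3)"
  "cech_graded j N2 p \<subseteq> cech_graded j N1 p" "cech_graded j N3 p \<subseteq> cech_graded j N2 p"
  using subcomplex_cech_graded N graded_is_ideal cech_graded_mono by blast+

lemma coh_extension:
  assumes "coh_fin N1 N2 p j" "coh_fin N2 N3 p j"
  shows "coh_fin N1 N3 p j" "coh_fun N1 N3 p j \<le> coh_fun N1 N2 p j + coh_fun N2 N3 p j"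
  using V.hdim_extension[of "cech_graded j N1" "cech_graded j N2" "cech_graded j N3" p] complexes assms
  unfolding coh_fin_def coh_fun_def by auto

lemma coh_kernel:
  assumes "coh_fin N1 N3 p j" "coh_fin N1 N2 (p - 1) j"
  shows "coh_fin N2 N3 p j" "coh_fun N2 N3 p j \<le> coh_fun N1 N3 p j + coh_fun N1 N2 (p - 1) j"
  using V.hdim_kernel[of "cech_graded j N1" "cech_graded j N2" "cech_graded j N3" p] complexes assms
  unfolding coh_fin_def coh_fun_def by auto

lemma coh_acyclic_quotient:
  assumes "acyclic_at N1 N2 p"
    "acyclic_at N1 N2 (p - 1)"
    and "coh_fin N1 N3 p j"
  shows "coh_fun N1 N3 p j = coh_fun N2 N3 p j"
  using V.hdim_acyclic_quotient(2)[of "cech_graded j N1" "cech_graded j N2" "cech_graded j N3" p] complexes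
    graded_acyclic[OF N(1,2) assms(1)] graded_acyclic[OF N(1,2) assms(2)] assms(3)
  unfolding coh_fin_def coh_fun_def by auto

lemma coh_acyclic_sub:
  assumes "acyclic_at N2 N3 p"
    "acyclic_at N2 N3 (p + 1)"
    and "coh_fin N1 N3 p j"
  shows "coh_fun N1 N3 p j = coh_fun N1 N2 p j"
  using V.hdim_acyclic_sub(2)[of "cech_graded j N1" "cech_graded j N2" "cech_graded j N3" p] complexes
    graded_acyclic[OF N(2,3) assms(1)] graded_acyclic[OF N(2,3) assms(2)] assms(3)
  unfolding coh_fin_def coh_fun_def by auto

lemma serre_diff_additive:
  assumes "\<And>p. coh_fin N1 N2 p j" "\<And>p. coh_fin N2 N3 p j"
  shows "serre_diff N1 N3 j = serre_diff N1 N2 j + serre_diff N2 N3 j"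
proof -
  note idl = graded_is_ideal[OF N(1)] graded_is_ideal[OF N(2)] graded_is_ideal[OF N(3)]
  have "(\<Sum>p\<le>card (UNIV :: 'n set). (- 1) ^ p * int (coh_fun N1 N3 (int p) j)) =
     (\<Sum>p\<le>card (UNIV :: 'n set). (- 1) ^ p * int (coh_fun N1 N2 (int p) j)) +
     (\<Sum>p\<le>card (UNIV :: 'n set). (- 1) ^ p * int (coh_fun N2 N3 (int p) j))"
    unfolding coh_fun_def
    by (rule V.euler_characteristic_additive[OF complexes(1-5)])
      (use assms cech_graded_out_of_range[OF idl(1)] in \<open>auto simp: coh_fin_def\<close>)
  then show ?thesis
    using hilb_fun_add[OF idl N(4,5), of j] by (simp add: serre_diff_def)
qed

lemma tame_extension:
  assumes "tame N1 N2" "tame N2 N3"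
  shows "tame N1 N3"
proof -
  have fin: "coh_fin N1 N2 p j" "coh_fin N2 N3 p j" for p j using assms by (auto simp: tame_def)
  obtain D1 where D1: "\<And>p j. j \<ge> D1 \<Longrightarrow> coh_fun N1 N2 p j = 0" using assms by (auto simp: tame_def)
  obtain D2 where D2: "\<And>p j. j \<ge> D2 \<Longrightarrow> coh_fun N2 N3 p j = 0" using assms by (auto simp: tame_def)
  have "coh_fun N1 N3 p j = 0" if "j \<ge> max D1 D2" for p j
    using coh_extension(2)[OF fin, of p j] D1[of j p] D2[of j p] that by simp
  moreover have "\<exists>C D. \<forall>j. coh_fun N1 N3 (int p + 1) j \<le> C * nat (D - j) ^ p" for p
  proof -
    obtain C1 E1 where 1: "\<And>j. coh_fun N1 N2 (int p + 1) j \<le> C1 * nat (E1 - j) ^ p"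
      using assms(1) unfolding tame_def by blast
    obtain C2 E2 where 2: "\<And>j. coh_fun N2 N3 (int p + 1) j \<le> C2 * nat (E2 - j) ^ p"
      using assms(2) unfolding tame_def by blast
    have "coh_fun N1 N3 (int p + 1) j \<le> (C1 + C2) * nat (max E1 E2 - j) ^ p" for j
    proof -
      have "C1 * nat (E1 - j) ^ p \<le> C1 * nat (max E1 E2 - j) ^ p"
        "C2 * nat (E2 - j) ^ p \<le> C2 * nat (max E1 E2 - j) ^ p"
        by (intro mult_le_mono2 power_mono; simp)+
      then show ?thesis using coh_extension(2)[OF fin, of "int p + 1" j] 1[of j] 2[of j]
        unfolding distrib_right by linarith
    qed
    then show ?thesis by blast
  qed
  moreover have "\<exists>r. (nabla ^^ r) (serre_diff N1 N3) = (\<lambda>_. 0)"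
  proof -
    obtain r1 r2 where r: "(nabla ^^ r1) (serre_diff N1 N2) = (\<lambda>_. 0)" "(nabla ^^ r2) (serre_diff N2 N3) = (\<lambda>_. 0)"
      using assms by (auto simp: tame_def)
    have "serre_diff N1 N3 = (\<lambda>j. serre_diff N1 N2 j + serre_diff N2 N3 j)"
      using serre_diff_additive fin by blast
    then have "(nabla ^^ max r1 r2) (serre_diff N1 N3) = (\<lambda>_. 0)"
      using nabla_pow_mono[OF r(1), of "max r1 r2"] nabla_pow_mono[OF r(2), of "max r1 r2"]
      by (simp add: nabla_pow_add)
    then show ?thesis by blast
  qed
  ultimately show ?thesis using coh_extension(1)[OF fin] unfolding tame_def by blast
qed

end

text \<open>Everything is drawn from the sequence M(-1), M, M/x_v M: vanishing in large degrees from
  torsion, then finiteness and bounds by descending the degree one by one.\<close>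

lemma tame_nonzerodivisor:
  assumes N: "graded_ideal N1" "graded_ideal N2" "N2 \<subseteq> N1" and v: "nonzerodivisor_on (var v) N1 N2"
    and C: "tame N1 (add_multiples N2 (var v) N1)"
  shows "tame N1 N2"
proof -
  note idl = graded_is_ideal[OF N(1)] graded_is_ideal[OF N(2)]
  let ?N = "add_multiples N2 (var v) N1"
  have gN: "graded_ideal ?N" by (rule graded_add_multiples[OF N(2,1)])
  have sub: "N2 \<subseteq> ?N" "?N \<subseteq> N1"
    using add_multiples_superset[OF idl(1)] add_multiples_subset[OF idl(1) N(3)] by blast+
  have finC: "coh_fin N1 ?N p j" for p j using C by (simp add: tame_def)
  obtain D where D: "\<And>p j. j \<ge> D \<Longrightarrow> coh_fun N1 ?N p j = 0" using C by (auto simp: tame_def)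
  \<comment> \<open>From degree \<open>D\<close> on the cokernel has no cohomology, so x_v is
    injective on H^p(M) in these degrees; yet some power of x_v kills the class.\<close>
  have triv: "V.cocyc (cech_graded j N1) (cech_graded j N2) p \<subseteq> V.cobd (cech_graded j N1) (cech_graded j N2) p"
    if j: "j \<ge> D" for p j
  proof
    fix z assume z: "z \<in> V.cocyc (cech_graded j N1) (cech_graded j N2) p"
    then have z': "z \<in> V.cocyc (cech_ideal N1) (cech_ideal N2) p" "hpart_cochain j z = z" "z \<in> cech_ideal N1 p"
      by (auto simp: V.cocyc_def cech_graded_def)
    obtain k where "act (var v ^ k) z \<in> V.cobd (cech_ideal N1) (cech_ideal N2) p"
      using cohomology_var_torsion[OF idl z'(1)] by blast
    then have k: "hpart_cochain (j + int k) (act (var v ^ k) z) \<in> V.cobd (cech_graded (j + int k) N1) (cech_graded (j + int k) N2) p"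
      by (rule hpart_cobd[OF N(1,2)])
    have deg: "hpart_cochain (j + int k) (act (var v ^ k) z) = act (var v ^ k) z" for k
    proof (induction k)
      case (Suc k)
      have "act (var v ^ Suc k) z = act (var v) (act (var v ^ k) z)" by (simp add: act_act)
      then show ?case using Suc hpart_cochain_act_var[of "j + int (Suc k)" v "act (var v ^ k) z"] by simp
    qed (simp add: z'(2))
    have mem: "act (var v ^ k) z \<in> cech_graded (j + int k) N1 p" for k
      using deg cech_ideal_act[OF idl(1) z'(3)] by (simp add: cech_graded_def)
    have "act (var v ^ k) z \<in> V.cobd (cech_graded (j + int k) N1) (cech_graded (j + int k) N2) p"
      using k by (simp add: deg)
    then show "z \<in> V.cobd (cech_graded j N1) (cech_graded j N2) p"
    proof (induction k)
      case (Suc k)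
      let ?m = "j + int k"
      have "act (var v ^ k) z \<in> V.cobd (cech_graded ?m N1) (cech_graded ?m N2) p"
      proof (rule V.injective_on_cohomology[where g = "act (var v)" and A' = "cech_graded (?m + 1) N1"
            and B' = "cech_graded (?m + 1) N2" and N = "cech_graded (?m + 1) ?N"])
        show "V.subcomplex (cech_graded (?m + 1) N1)" "V.subcomplex (cech_graded (?m + 1) N2)"
          "V.subcomplex (cech_graded ?m N1)"
          using subcomplex_cech_graded idl by blast+
        show "cech_graded (?m + 1) ?N q = {w + act (var v) u |w u. w \<in> cech_graded (?m + 1) N2 q \<and> u \<in> cech_graded ?m N1 q}" for q
          using cech_graded_add_multiples[OF N(2,1), of "?m + 1" v q] by simp
        show "y \<in> cech_graded ?m N2 p" if "y \<in> cech_graded ?m N1 p" "act (var v) y \<in> cech_graded (?m + 1) N2 p" for y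
          using that nonzerodivisor_on_cech[OF idl v] by (simp add: cech_graded_def)
        show "V.cocyc (cech_graded (?m + 1) N1) (cech_graded (?m + 1) ?N) (p - 1) \<subseteq>
            V.cobd (cech_graded (?m + 1) N1) (cech_graded (?m + 1) ?N) (p - 1)"
          using V.qd_eq_0D finC[of "p - 1" "?m + 1"] D[of "?m + 1" "p - 1"] j
          unfolding coh_fin_def coh_fun_def V.hfin_def V.hdim_def by simp
        show "act (var v ^ k) z \<in> cech_graded ?m N1 p" by (rule mem)
        show "act (var v) (act (var v ^ k) z) \<in> V.cobd (cech_graded (?m + 1) N1) (cech_graded (?m + 1) N2) p"
          using Suc.prems by (simp add: act_act add.commute add.left_commute)
      qed (simp_all add: act_add act_cdiff)
      then show ?case by (rule Suc.IH)
    qed simp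
  qed
  note top = coh_trivial[OF idl triv]
  \<comment> \<open>Exactness of H^(p-1)(M/x_v M), H^p(x_v M), H^p(M) in degree
    \<open>j + 1\<close>; by \<open>coh_shift\<close> the middle term is H^p(M) in degree
    \<open>j\<close>.\<close>
  have step: "coh_fin N1 N2 p j \<and> coh_fun N1 N2 p j \<le> coh_fun N1 N2 p (j + 1) + coh_fun N1 ?N (p - 1) (j + 1)"
    if "coh_fin N1 N2 p (j + 1)" for p j
  proof -
    note ker = coh_kernel[OF N(1) gN N(2) sub that finC]
    have "coh_fin N1 N2 p j" using ker(1) coh_shift(1)[OF N v, of p "j + 1"] by simp
    then show ?thesis using ker(2) coh_shift(2)[OF N v, of p "j + 1"] by simp
  qed
  have fin: "coh_fin N1 N2 p j" for p j
  proof (cases "j \<ge> D")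
    case False
    have "coh_fin N1 N2 p (D - int m)" for m
    proof (induction m)
      case (Suc m)
      then show ?case using step[of p "D - int (Suc m)"] by simp
    qed (simp add: top)
    from this[of "nat (D - j)"] show ?thesis using False by simp
  qed (rule top)
  have le: "coh_fun N1 N2 p j \<le> coh_fun N1 N2 p (j + 1) + coh_fun N1 ?N (p - 1) (j + 1)" for p j
    using step fin by blast
  have "\<exists>C D. \<forall>j. coh_fun N1 N2 (int p + 1) j \<le> C * nat (D - j) ^ p" for p
  proof (cases p)
    case 0
    have "coh_fun N1 N2 1 j \<le> (\<Sum>e\<in>{0..D}. coh_fun N1 ?N 0 e)" for j
      using le[of 1] coh_0_negative[OF idl(1) graded_is_ideal[OF gN]] top(2)
      by (intro descending_bound_constant) auto
    then have "\<forall>j. coh_fun N1 N2 (int p + 1) j \<le> (\<Sum>e\<in>{0..D}. coh_fun N1 ?N 0 e) * nat (D - j) ^ p" using 0 by simp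
    then show ?thesis by blast
  next
    case (Suc q)
    obtain C E where E: "\<And>j. coh_fun N1 ?N (int q + 1) j \<le> C * nat (E - j) ^ q"
      using C unfolding tame_def by blast
    have "coh_fun N1 N2 (int p + 1) j \<le> C * nat (max D E - j) ^ Suc q" for j
    proof (rule descending_bound)
      show "coh_fun N1 N2 (int p + 1) j = 0" if "j \<ge> max D E" for j using top(2) that by simp
      show "coh_fun N1 N2 (int p + 1) j \<le> coh_fun N1 N2 (int p + 1) (j + 1) + coh_fun N1 ?N (int q + 1) (j + 1)" for j
        using le[of "int p + 1" j] Suc by (simp add: add.commute)
      show "coh_fun N1 ?N (int q + 1) j \<le> C * nat (max D E - j) ^ q" for j
      proof -
        have "C * nat (E - j) ^ q \<le> C * nat (max D E - j) ^ q" by (intro mult_le_mono2 power_mono) auto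
        then show ?thesis using E[of j] by linarith
      qed
    qed
    then show ?thesis using Suc by blast
  qed
  moreover have "\<exists>r. (nabla ^^ r) (serre_diff N1 N2) = (\<lambda>_. 0)"
  proof -
    obtain r where r: "(nabla ^^ r) (serre_diff N1 ?N) = (\<lambda>_. 0)" using C by (auto simp: tame_def)
    \<comment> \<open>\<open>serre_diff\<close> is additive and that of x_v M is the one of M
      shifted by 1, so the exponent of \<open>nabla\<close> grows by one.\<close>
    have "nabla (serre_diff N1 N2) = serre_diff N1 ?N"
    proof
      fix j
      have finN: "coh_fin ?N N2 p j" for p using coh_shift(1)[OF N v] fin by blast
      have "serre_diff ?N N2 j = serre_diff N1 N2 (j - 1)"
        using coh_shift(2)[OF N v fin] hilb_fun_multiples[OF N v] by (simp add: serre_diff_def)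
      then show "nabla (serre_diff N1 N2) j = serre_diff N1 ?N j"
        using serre_diff_additive[OF N(1) gN N(2) sub finC finN] by (simp add: nabla_def)
    qed
    then have "(nabla ^^ Suc r) (serre_diff N1 N2) = (\<lambda>_. 0)" using r by (simp add: funpow_swap1)
    then show ?thesis by blast
  qed
  ultimately show ?thesis unfolding tame_def using fin top(2) by blast
qed

lemma tame_graded:
  assumes "graded_ideal N1" "graded_ideal N2" "N2 \<subseteq> N1"
  shows "tame N1 N2"
proof (rule graded_devissage[of tame])
  show "tame N1 N3"
    if "graded_ideal N1" "graded_ideal N2" "graded_ideal N3" "N3 \<subseteq> N2" "N2 \<subseteq> N1" "tame N1 N2" "tame N2 N3"
    for N1 N2 N3 :: "('a, 'b) mpoly set"
    using tame_extension[OF that] .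
qed (use assms tame_base tame_nonzerodivisor in blast)+

lemma nabla_hilb_fun_of_concentrated:
  fixes N1 N2 :: "('n::{finite,linorder}, 'k::field) mpoly set"
  assumes N: "graded_ideal N1" "graded_ideal N2" "N2 \<subseteq> N1" and i: "i \<ge> 1"
    and van: "\<And>p j. p \<noteq> int i \<Longrightarrow> coh_fun N1 N2 p j = 0"
  shows "(nabla ^^ i) (\<lambda>j. int (hilb_fun N1 N2 j)) = (\<lambda>j. (- 1) ^ i * (nabla ^^ i) (\<lambda>j. int (coh_fun N1 N2 (int i) j)) j)"
proof -
  note idl = graded_is_ideal[OF N(1)] graded_is_ideal[OF N(2)]
  have T: "tame N1 N2" by (rule tame_graded[OF N])
  let ?H = "\<lambda>j. int (hilb_fun N1 N2 j)" and ?h = "\<lambda>j. int (coh_fun N1 N2 (int i) j)"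
  have "(\<Sum>p\<le>card (UNIV :: 'n set). (- 1) ^ p * int (coh_fun N1 N2 (int p) j)) = (- 1) ^ i * ?h j" for j
  proof -
    have "(\<Sum>p\<le>card (UNIV :: 'n set). (- 1) ^ p * int (coh_fun N1 N2 (int p) j)) =
        (\<Sum>p\<le>card (UNIV :: 'n set). if p = i then (- 1) ^ i * ?h j else 0)"
    proof (intro sum.cong refl)
      fix p
      show "(- 1) ^ p * int (coh_fun N1 N2 (int p) j) = (if p = i then (- 1) ^ i * ?h j else 0)"
        using van[of "int p" j] by (cases "p = i") simp_all
    qed
    also have "\<dots> = (if i \<le> card (UNIV :: 'n set) then (- 1) ^ i * ?h j else 0)" by simp
    \<comment> \<open>If \<open>i\<close> exceeds the number of variables, the sum has no term for
      it, and H^i vanishes as well.\<close>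
    also have "\<dots> = (- 1) ^ i * ?h j" using coh_out_of_range(2)[OF idl, of "int i" j] by auto
    finally show ?thesis .
  qed
  then have sd: "serre_diff N1 N2 = (\<lambda>j. ?H j - (- 1) ^ i * ?h j)" by (simp add: serre_diff_def)
  obtain r where r: "(nabla ^^ r) (serre_diff N1 N2) = (\<lambda>_. 0)" using T by (auto simp: tame_def)
  obtain C D where CD: "\<And>j. coh_fun N1 N2 (int (i - 1) + 1) j \<le> C * nat (D - j) ^ (i - 1)"
    using T unfolding tame_def by blast
  \<comment> \<open>\<open>tame\<close> is read with \<open>p = i - 1\<close>; growth of exponent
    \<open>i - 1\<close> is what makes \<open>i\<close> differences sufficient.\<close>
  have "\<bar>serre_diff N1 N2 j\<bar> \<le> int (C * nat (D - j) ^ (i - 1))" if "j < 0" for j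
  proof -
    have "\<bar>serre_diff N1 N2 j\<bar> = ?h j" using hilb_fun_negative[OF idl that] by (simp add: sd abs_mult)
    also have "\<dots> \<le> int (C * nat (D - j) ^ (i - 1))" using CD[of j] i by (simp only: of_nat_le_iff) simp
    finally show ?thesis .
  qed
  from nabla_pow_zero_of_growth[OF r this] have z: "(nabla ^^ i) (serre_diff N1 N2) = (\<lambda>_. 0)" using i by simp
  have "?H = (\<lambda>j. serre_diff N1 N2 j + (- 1) ^ i * ?h j)" by (simp add: sd)
  then have "(nabla ^^ i) ?H = (nabla ^^ i) (\<lambda>j. serre_diff N1 N2 j + (- 1) ^ i * ?h j)" by (rule arg_cong)
  also have "\<dots> = (\<lambda>j. (- 1) ^ i * (nabla ^^ i) ?h j)" by (simp add: nabla_pow_add nabla_pow_mult z)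
  finally show ?thesis .
qed

section \<open>Generating functions\<close>

lemma fps_nth_one_minus_X_power:
  assumes "\<And>j. j < 0 \<Longrightarrow> H j = 0" "\<And>m. fps_nth f m = H (int m)"
  shows "fps_nth ((1 - fps_X) ^ i * f) m = (nabla ^^ i) H (int m)"
proof (induction i arbitrary: m)
  case 0
  then show ?case by (simp add: assms(2))
next
  case (Suc i)
  have "(1 - fps_X) ^ Suc i * f = (1 - fps_X) ^ i * f - fps_X * ((1 - fps_X) ^ i * f)" by (simp add: algebra_simps)
  then show ?case
    using Suc[of m] Suc[of "m - 1"] nabla_pow_zero_below[of 0 H "- 1" i, OF assms(1)]
    by (cases m) (simp_all add: nabla_def[of "(nabla ^^ i) H"])
qed

text \<open>The coefficient with index \<open>k\<close> belongs to degree \<open>- k\<close>, and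
  multiplication by t reads index \<open>k + 1\<close>. So t - 1 acts as the negative of
  \<open>nabla\<close>, whence the sign.\<close>

lemma fls_nth_X_inv_minus_one_power:
  assumes "\<And>k. fls_nth G k = h (- k)"
  shows "fls_nth ((fls_X_inv - 1) ^ i * G) k = (- 1) ^ i * (nabla ^^ i) h (- k)"
proof (induction i arbitrary: k)
  case (Suc i)
  let ?F = "(fls_X_inv - 1) ^ i * G"
  have "(fls_X_inv - 1) ^ Suc i * G = fls_X_inv * ?F - ?F" by (simp add: algebra_simps)
  then have "fls_nth ((fls_X_inv - 1) ^ Suc i * G) k = fls_nth ?F (k + 1) - fls_nth ?F k"
    by (simp add: fls_X_inv_times_conv_shift)
  moreover have "- (k + 1) = - k - 1" by simp
  ultimately show ?case
    using Suc[of "k + 1"] Suc[of k] by (simp only: funpow.simps o_apply nabla_def[of "(nabla ^^ i) h"]) (simp add: algebra_simps)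
qed (simp add: assms)

lemma fls_nth_poly_X_inv:
  "fls_nth (poly (map_poly of_int p) fls_X_inv) k = (if k \<le> 0 then coeff p (nat (- k)) else (0 :: int))"
proof (induction p arbitrary: k)
  case (pCons a p)
  have "poly (map_poly of_int (pCons a p)) (fls_X_inv :: int fls) =
      of_int a + fls_X_inv * poly (map_poly of_int p) fls_X_inv"
    by (simp add: map_poly_pCons)
  then have "fls_nth (poly (map_poly of_int (pCons a p)) fls_X_inv) k =
      (if k = 0 then a else 0) + fls_nth (poly (map_poly of_int p) fls_X_inv) (k + 1)"
    by (simp add: fls_X_inv_times_conv_shift fls_of_int_nth)
  also have "\<dots> = (if k \<le> 0 then coeff (pCons a p) (nat (- k)) else 0)"
  proof (cases "k < 0")
    case True
    then have "nat (- k) = Suc (nat (- (k + 1)))" by simp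
    then show ?thesis using True pCons.IH[of "k + 1"] by simp
  qed (use pCons.IH[of "k + 1"] in auto)
  finally show ?case .
qed simp

section \<open>Hilbert functions of the layers, cohomology along the filtration, and the
  conclusion\<close>

lemma k_dim_subquotient:
  assumes N: "is_ideal N1" "is_ideal N2" "N2 \<subseteq> N1"
  shows "k_dim (subquotient N1 N2) (piece (subquotient N1 N2) j) = hilb_fun N1 N2 j"
  unfolding piece_subquotient hilb_fun_def
  by (rule k_dim_eq_qd[OF presentation_subquotient[OF N] vector_space_mpoly])
    (use R_subspace_Int qfin_hilb N in auto)

text \<open>Layers below \<open>i\<close> are stripped off as submodules, which needs vanishing in
  degrees \<open>i\<close> and \<open>i + 1\<close>; layers above \<open>i\<close> as quotients,
  which needs degrees \<open>i\<close> and \<open>i - 1\<close>. None of these is the degree in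
  which the stripped layer has cohomology.\<close>

lemma coh_fun_filtration:
  fixes D :: "int \<Rightarrow> ('n::{finite,linorder}, 'k::field) mpoly set"
  assumes gr: "\<And>s. graded_ideal (D s)" and mono: "\<And>s t. s \<le> t \<Longrightarrow> D s \<subseteq> D t"
    and acy: "\<And>s p. s \<le> d \<Longrightarrow> p \<noteq> int s \<Longrightarrow>
      acyclic_at (D (int s)) (D (int s - 1)) p"
    and i: "i \<le> d"
  shows "coh_fun (D (int d)) (D (- 1)) (int i) j = coh_fun (D (int i)) (D (int i - 1)) (int i) j"
proof -
  have fin: "coh_fin (D t) (D s) p j" if "s \<le> t" for s t p
    using tame_graded[OF gr gr mono[OF that]] by (simp add: tame_def)
  have up: "coh_fun (D (int d)) (D (- 1)) (int i) j = coh_fun (D (int d)) (D (int s - 1)) (int i) j" if "s \<le> i" for s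
    using that
  proof (induction s)
    case (Suc s)
    have "coh_fun (D (int d)) (D (int s - 1)) (int i) j = coh_fun (D (int d)) (D (int s)) (int i) j"
      using Suc.prems i by (intro coh_acyclic_sub gr mono acy fin) auto
    then show ?case using Suc by simp
  qed simp
  have down: "coh_fun (D (int t)) (D (int i - 1)) (int i) j = coh_fun (D (int i)) (D (int i - 1)) (int i) j"
    if "i \<le> t" "t \<le> d" for t
    using that
  proof (induction t rule: dec_induct)
    case (step t)
    have "coh_fun (D (int (Suc t))) (D (int i - 1)) (int i) j = coh_fun (D (int (Suc t) - 1)) (D (int i - 1)) (int i) j"
      using step by (intro coh_acyclic_quotient gr mono acy fin) auto
    then show ?case using step by simp
  qed simp
  show ?thesis using up[OF order_refl] down[OF i order_refl] by (rule trans)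
qed

theorem theorem20:
  fixes I :: "('n::{finite,linorder}, 'k::field) mpoly set"
    and Q :: "('n, 'k) mpoly set set"
    and d i :: nat
  assumes "homogeneous_ideal I" and "I \<noteq> UNIV"
    and "reduced_primary_decomposition mpoly_ring I Q"
    and "krull_dim (mpoly_ring Quot I) = ereal (real d)"
    and "sequentially_cohen_macaulay Q d"
    and "1 \<le> i" and "i \<le> d"
  shows "(fls_X_inv - 1) ^ i * hilb_inv (local_cohomology (graded_quot regular_module I) i) =
         poly (map_poly of_int (h_poly (unmixed_layer Q i) i)) fls_X_inv"
proof -
  have I: "graded_ideal I" by (rule graded_ideal_of_homogeneous_ideal[OF assms(1)])
  note idI = graded_is_ideal[OF I]
  define D where "D = dim_filtration_ideal Q"
  have gr: "graded_ideal (D s)" for s unfolding D_def by (rule graded_dim_filtration_ideal[OF I assms(3)])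
  have mono: "D s \<subseteq> D t" if "s \<le> t" for s t unfolding D_def by (rule dim_filtration_ideal_mono[OF that])
  have ends: "D (- 1) = I" "D (int d) = UNIV"
    unfolding D_def using dim_filtration_ideal_bot[OF assms(3)] dim_filtration_ideal_top[OF assms(3) idI assms(4)] by simp_all
  have layer: "unmixed_layer Q s = subquotient (D (int s)) (D (int s - 1))" for s
    by (simp add: unmixed_layer_def subquotient_def D_def)
  note gid = graded_is_ideal[OF gr]
  have acy: "acyclic_at (D (int s)) (D (int s - 1)) p"
    if "s \<le> d" "p \<noteq> int s" for s p
    using assms(5) that unfolding sequentially_cohen_macaulay_def layer
    by (intro acyclic_of_cohen_macaulay[of _ _ s] gid mono) auto
  let ?N1 = "D (int i)" and ?N2 = "D (int i - 1)"
  have N: "graded_ideal ?N1" "graded_ideal ?N2" "?N2 \<subseteq> ?N1" using gr mono by simp_all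
  define H where "H j = int (hilb_fun ?N1 ?N2 j)" for j
  define h where "h j = int (coh_fun ?N1 ?N2 (int i) j)" for j
  have "coh_fun ?N1 ?N2 p j = 0" if "p \<noteq> int i" for p j
    by (rule coh_trivial(2)[OF gid gid graded_acyclic[OF gr gr acy[OF assms(7) that]]])
  from nabla_hilb_fun_of_concentrated[OF N assms(6) this]
  have nab: "(nabla ^^ i) H = (\<lambda>j. (- 1) ^ i * (nabla ^^ i) h j)" unfolding H_def[abs_def] h_def[abs_def] by simp
  have Hneg: "H j = 0" if "j < 0" for j using hilb_fun_negative[OF gid gid that] by (simp add: H_def)
  have "\<exists>b. \<forall>p j. j \<ge> b \<longrightarrow> coh_fun ?N1 ?N2 p j = 0" using tame_graded[OF N] unfolding tame_def by blast
  then obtain b where b: "\<And>j. j \<ge> b \<Longrightarrow> h j = 0" unfolding h_def by auto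
  \<comment> \<open>The candidate for the h-polynomial. Its finite support is not visible from
    \<open>H\<close>; it comes from \<open>h\<close>, which vanishes in large degrees, by way of
    \<open>nab\<close>.\<close>
  define p where "p = Abs_poly (\<lambda>m. (nabla ^^ i) H (int m))"
  have "\<forall>\<^sub>\<infinity>m. (nabla ^^ i) H (int m) = 0"
  proof (rule MOST_nat[THEN iffD2], intro exI allI impI)
    fix m assume "m > nat (b + int i)"
    then have "(nabla ^^ i) h (int m) = 0" by (intro nabla_pow_zero_above[OF b]) auto
    then show "(nabla ^^ i) H (int m) = 0" by (simp add: nab)
  qed
  then have coeff_p: "coeff p m = (nabla ^^ i) H (int m)" for m
    by (simp add: p_def Abs_poly_inverse)
  have "fps_nth (hilb_fps (unmixed_layer Q i)) m = H (int m)" for m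
    by (simp add: hilb_fps_def layer k_dim_subquotient[OF gid gid N(3)] H_def)
  then have "(1 - fps_X) ^ i * hilb_fps (unmixed_layer Q i) = fps_of_poly p"
    using fps_nth_one_minus_X_power[OF Hneg] by (intro fps_ext) (simp add: coeff_p)
  then have hp: "h_poly (unmixed_layer Q i) i = p"
    unfolding h_poly_def by (intro the_equality) (simp_all add: fps_of_poly_eq_iff)
  let ?A = "graded_quot regular_module I"
  have kd: "int (k_dim (local_cohomology ?A i) (piece (local_cohomology ?A i) j)) = h j" for j
  proof -
    obtain i' where i': "i = Suc i'" using assms(6) by (cases i) auto
    have "coh_fin UNIV I (int i) j" using tame_graded[OF graded_ideal_UNIV I] by (simp add: tame_def)
    then have "k_dim (local_cohomology ?A i) (piece (local_cohomology ?A i) j) = coh_fun UNIV I (int i) j"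
      using k_dim_local_cohomology[OF I, of j i'] unfolding quot_regular_module coh_fin_def coh_fun_def i' by blast
    also have "\<dots> = coh_fun ?N1 ?N2 (int i) j"
      using coh_fun_filtration[of D d i j, OF gr mono acy assms(7)] ends by simp
    finally show ?thesis by (simp add: h_def)
  qed
  have "fls_nth (hilb_inv (local_cohomology ?A i)) k = h (- k)" for k
    unfolding hilb_inv_def kd by (rule nth_Abs_fls_lower_bound[of "- b"]) (simp add: b)
  then have lhs: "fls_nth ((fls_X_inv - 1) ^ i * hilb_inv (local_cohomology ?A i)) k = (nabla ^^ i) H (- k)" for k
    by (subst fls_nth_X_inv_minus_one_power[of _ h]) (simp_all add: nab)
  \<comment> \<open>Indices \<open>k > 0\<close> are the negative degrees, where a polynomial in t
    has no coefficients; the left-hand side vanishes there because \<open>H\<close> does.\<close>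
  have "(nabla ^^ i) H (- k) = 0" if "k > 0" for k using that by (intro nabla_pow_zero_below[OF Hneg]) auto
  then show ?thesis
    unfolding hp by (intro fls_eqI) (simp add: lhs fls_nth_poly_X_inv coeff_p)
qed

end
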